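(* Let $\Omega\subset\mathbb{R}^n$ be a bounded Lipschitz domain, $1<q<\infty$, $0\le\lambda<n$. Then the embedding $W^1H_{q,\lambda}(\Omega)\hookrightarrow H_{q,\lambda}(\Omega)$ is compact.
   Context: For $x\in\mathbb{R}^n$, $R>0$: $\Omega_R(x):=\Omega\cap B(x,R)$; $q'=q/(q-1)$. A $(q,\lambda)$-block is $\rho\in L^q_{\mathrm{loc}}(\overline\Omega)$ with $\mathrm{supp}\,\rho\subset\overline{\Omega_R(x)}$ for some $R>0$, $x\in\Omega$, and $R^{\lambda/q'}\|\rho\|_{L^q(\Omega_R(x))}\le1$. The block space $H_{q,\lambda}(\Omega)$ consists of all $\sum_k c_k\phi_k$ with $\phi_k$ $(q,\lambda)$-blocks and $(c_k)\in\ell^1$, normed by the infimum of $\|(c_k)\|_{\ell^1}$ over such representations. $W^1H_{q,\lambda}(\Omega)$: $f\in H_{q,\lambda}(\Omega)$ with weak gradient in $H_{q,\lambda}(\Omega)$, norm $\max(\|f\|,\|\nabla f\|)$. Lipschitz domain: connected open set whose boundary is locally the graph of a Lipschitz function. *)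

theory Defs
  imports "HOL-Analysis.Analysis"
begin

definition conj_exp :: "real \<Rightarrow> real" where
  "conj_exp q = q / (q - 1)"

definition OmegaR :: "'a::euclidean_space set \<Rightarrow> 'a \<Rightarrow> real \<Rightarrow> 'a set" where
  "OmegaR \<Omega> x R = \<Omega> \<inter> ball x R"

text \<open>L^q norm of f over S with respect to Lebesgue measure (q-th root of the
  nonnegative integral of |f|^q); only used when that integral is finite.\<close>
definition Lq_norm :: "real \<Rightarrow> 'a::euclidean_space set \<Rightarrow> ('a \<Rightarrow> real) \<Rightarrow> real" where
  "Lq_norm q S f = (enn2real (\<integral>\<^sup>+ y\<in>S. ennreal (\<bar>f y\<bar> powr q) \<partial>lebesgue)) powr (1 / q)"

definition is_block :: "'a::euclidean_space set \<Rightarrow> real \<Rightarrow> real \<Rightarrow> ('a \<Rightarrow> real) \<Rightarrow> bool" where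
  "is_block \<Omega> q lam \<rho> \<longleftrightarrow>
     \<rho> \<in> borel_measurable lebesgue \<and>
     (\<exists>x R. x \<in> \<Omega> \<and> R > 0 \<and>
        (\<forall>y. y \<notin> closure (OmegaR \<Omega> x R) \<longrightarrow> \<rho> y = 0) \<and>
        (\<integral>\<^sup>+ y\<in>OmegaR \<Omega> x R. ennreal (\<bar>\<rho> y\<bar> powr q) \<partial>lebesgue) < \<infinity> \<and>
        R powr (lam / conj_exp q) * Lq_norm q (OmegaR \<Omega> x R) \<rho> \<le> 1)"

definition block_rep ::
  "'a::euclidean_space set \<Rightarrow> real \<Rightarrow> real \<Rightarrow> ('a \<Rightarrow> real) \<Rightarrow> (nat \<Rightarrow> real) \<Rightarrow> (nat \<Rightarrow> 'a \<Rightarrow> real) \<Rightarrow> bool" where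
  "block_rep \<Omega> q lam f c \<phi> \<longleftrightarrow>
     summable (\<lambda>k. \<bar>c k\<bar>) \<and> (\<forall>k. is_block \<Omega> q lam (\<phi> k)) \<and>
     (AE y in lebesgue. y \<in> \<Omega> \<longrightarrow> (\<lambda>k. c k * \<phi> k y) sums f y)"

definition H_space :: "'a::euclidean_space set \<Rightarrow> real \<Rightarrow> real \<Rightarrow> ('a \<Rightarrow> real) set" where
  "H_space \<Omega> q lam = {f. \<exists>c \<phi>. block_rep \<Omega> q lam f c \<phi>}"

definition H_norm :: "'a::euclidean_space set \<Rightarrow> real \<Rightarrow> real \<Rightarrow> ('a \<Rightarrow> real) \<Rightarrow> real" where
  "H_norm \<Omega> q lam f = Inf {(\<Sum>k. \<bar>c k\<bar>) | c \<phi>. block_rep \<Omega> q lam f c \<phi>}"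

coinductive smooth_fun :: "('a::euclidean_space \<Rightarrow> real) \<Rightarrow> bool" where
  "(\<forall>x. f differentiable (at x)) \<Longrightarrow>
   (\<forall>i\<in>Basis. smooth_fun (\<lambda>x. frechet_derivative f (at x) i)) \<Longrightarrow> smooth_fun f"

definition test_fun :: "'a::euclidean_space set \<Rightarrow> ('a \<Rightarrow> real) \<Rightarrow> bool" where
  "test_fun \<Omega> \<phi> \<longleftrightarrow> smooth_fun \<phi> \<and> compact (closure {x. \<phi> x \<noteq> 0}) \<and> closure {x. \<phi> x \<noteq> 0} \<subseteq> \<Omega>"

definition locally_integrable_on :: "'a::euclidean_space set \<Rightarrow> ('a \<Rightarrow> real) \<Rightarrow> bool" where
  "locally_integrable_on \<Omega> f \<longleftrightarrow>
     (\<forall>K. compact K \<and> K \<subseteq> \<Omega> \<longrightarrow> set_integrable lebesgue K f)"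

definition weak_gradient :: "'a::euclidean_space set \<Rightarrow> ('a \<Rightarrow> real) \<Rightarrow> ('a \<Rightarrow> 'a) \<Rightarrow> bool" where
  "weak_gradient \<Omega> f g \<longleftrightarrow>
     locally_integrable_on \<Omega> f \<and> (\<forall>i\<in>Basis. locally_integrable_on \<Omega> (\<lambda>x. g x \<bullet> i)) \<and>
     (\<forall>\<phi> i. test_fun \<Omega> \<phi> \<and> i \<in> Basis \<longrightarrow>
        (LINT x:\<Omega>|lebesgue. f x * frechet_derivative \<phi> (at x) i)
          = - (LINT x:\<Omega>|lebesgue. (g x \<bullet> i) * \<phi> x))"

definition W1H_space :: "'a::euclidean_space set \<Rightarrow> real \<Rightarrow> real \<Rightarrow> ('a \<Rightarrow> real) set" where
  "W1H_space \<Omega> q lam = {f. f \<in> H_space \<Omega> q lam \<and>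
      (\<exists>g. weak_gradient \<Omega> f g \<and> (\<forall>i\<in>Basis. (\<lambda>x. g x \<bullet> i) \<in> H_space \<Omega> q lam))}"

definition lipschitz_domain :: "'a::euclidean_space set \<Rightarrow> bool" where
  "lipschitz_domain \<Omega> \<longleftrightarrow> open \<Omega> \<and> connected \<Omega> \<and>
     (\<forall>p\<in>frontier \<Omega>. \<exists>e r h L \<gamma>. norm e = 1 \<and> r > 0 \<and> h > 0 \<and>
        L-lipschitz_on {v. v \<bullet> e = 0} \<gamma> \<and>
        (let P = (\<lambda>v. v - (v \<bullet> e) *\<^sub>R e);
             C = {x. norm (P (x - p)) < r \<and> \<bar>(x - p) \<bullet> e\<bar> < h}
         in \<Omega> \<inter> C = {x\<in>C. (x - p) \<bullet> e < \<gamma> (P (x - p))}))"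

end

theory Submission
  imports Defs "HOL-Complex_Analysis.Great_Picard" "HOL-Library.Diagonal_Subsequence"
begin

text \<open>
  Blocks are stable, up to a factor, under translation, under multiplication by indicators of Borel
  sets, and therefore under averages \<open>x \<mapsto> \<integral> a(z) \<rho>(x - v(z)) dz\<close> of translates with integrable weight
  (split the parameter space into cells on which \<open>v\<close> varies by less than the radius of the block).
  Near each point of the closure a Lipschitz domain contains, with \<open>x\<close>, all segments from \<open>x\<close> to
  \<open>x - w\<close> for \<open>w\<close> in a ball of radius \<open>\<kappa> s\<close> around \<open>s e\<close>. Averaging
  \<open>f(x) - f(x - w) = \<integral>\<^sub>0\<^sup>1 \<nabla>f(x - t w) \<cdot> w dt\<close> over \<open>w\<close> shows that there \<open>f\<close> is
  within \<open>O(s)\<close>, in the block norm, of a mollification of \<open>f\<close> shifted into the domain. Since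
  \<open>\<lambda> < n\<close>, the block space embeds into \<open>L\<^sup>1\<close>, so for fixed \<open>s\<close> the mollifications are uniformly
  bounded and equicontinuous, and Arzela-Ascoli applies; bounded functions have small block norm when
  they are uniformly small. As multiplication by indicators is harmless, finitely many such
  neighbourhoods glue without a partition of unity, and a diagonal sequence converges because the
  block space is complete.
\<close>

section \<open>Smooth cutoffs and the fundamental lemma\<close>

text \<open>The textbook route through an extension operator would require blocks to be continued
  across the boundary. Shifting along an inner cone avoids this, because near the given boundary
  point \<open>f\<close> and its gradient are then sampled only inside \<Omega>. The segment
  identity has no pointwise meaning for a weak gradient. It is therefore proved after integration
  against a test function, where it is the fundamental theorem of calculus for that test function,
  and it becomes an almost everywhere identity afterwards. Since \<open>smooth_fun\<close> is
  coinductive, explicit test functions are needed. Products of one-variable cutoffs serve: their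
  translates have the same shape, and sharpening them yields indicators of boxes. The factor O(s) is
  the total mass of the weight \<open>\<eta>(w) w_i\<close> on a kernel supported in
  \<open>norm w \<le> 2 s\<close>; so s is fixed from \<epsilon> first, then the kernel, and only
  then the subsequence. Each factor \<open>2 powr \<alpha>\<close> records one doubling of a radius:
  once when the translates of a molecule by one cell are collected in a common ball, once when a
  ball is recentred at a point of \<Omega>.\<close>

definition smooth_real :: "(real \<Rightarrow> real) \<Rightarrow> bool" where
  "smooth_real u \<longleftrightarrow>
     (\<exists>U. U 0 = u \<and> (\<forall>n x. (U n has_real_derivative U (Suc n) x) (at x)))"

lemma smooth_real_deriv:
  assumes "smooth_real u"
  obtains u' where "smooth_real u'" "\<And>x. (u has_real_derivative u' x) (at x)"
proof -
  obtain U where U: "U 0 = u" "\<And>n x. (U n has_real_derivative U (Suc n) x) (at x)"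
    using assms unfolding smooth_real_def by blast
  have "smooth_real (U 1)"
    unfolding smooth_real_def by (rule exI[of _ "\<lambda>n. U (Suc n)"]) (use U in auto)
  with that U show thesis by (metis One_nat_def)
qed

lemma has_derivative_prod_Basis:
  fixes u u' :: "'a::euclidean_space \<Rightarrow> real \<Rightarrow> real"
  assumes "\<And>i t. i \<in> Basis \<Longrightarrow> (u i has_real_derivative u' i t) (at t)"
  shows "((\<lambda>x. \<Prod>i\<in>Basis. u i (x \<bullet> i)) has_derivative
           (\<lambda>h. \<Sum>i\<in>Basis. (h \<bullet> i) * (u' i (x \<bullet> i) * (\<Prod>j\<in>Basis - {i}. u j (x \<bullet> j))))) (at x)"
proof -
  have "((\<lambda>x. u i (x \<bullet> i)) has_derivative (\<lambda>h. u' i (x \<bullet> i) * (h \<bullet> i))) (at x)" if "i \<in> Basis" for i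
  proof -
    have "(u i has_derivative (*) (u' i (x \<bullet> i))) (at (x \<bullet> i))"
      using assms[OF that] by (simp add: has_field_derivative_def)
    moreover have "((\<lambda>x. x \<bullet> i) has_derivative (\<lambda>h. h \<bullet> i)) (at x)"
      by (intro derivative_eq_intros) auto
    ultimately show ?thesis
      using has_derivative_compose[of "\<lambda>x. x \<bullet> i" "\<lambda>h. h \<bullet> i" x UNIV "u i"] by simp
  qed
  from has_derivative_prod[OF this, of Basis] show ?thesis
    by (simp add: mult_ac)
qed

text \<open>Off the k-th direction all terms of the product rule vanish. Keeping the result a
  coordinate product is what lets the coinduction for smoothness close.\<close>

lemma frechet_derivative_prod_Basis:
  fixes u u' :: "'a::euclidean_space \<Rightarrow> real \<Rightarrow> real"
  assumes "\<And>i t. i \<in> Basis \<Longrightarrow> (u i has_real_derivative u' i t) (at t)" and k: "k \<in> Basis"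
  shows "frechet_derivative (\<lambda>x. \<Prod>i\<in>Basis. u i (x \<bullet> i)) (at x) k
           = (\<Prod>i\<in>Basis. (u(k := u' k)) i (x \<bullet> i))"
proof -
  have "frechet_derivative (\<lambda>x. \<Prod>i\<in>Basis. u i (x \<bullet> i)) (at x) k =
     (\<Sum>i\<in>Basis. (k \<bullet> i) * (u' i (x \<bullet> i) * (\<Prod>j\<in>Basis - {i}. u j (x \<bullet> j))))"
    by (subst frechet_derivative_at[OF has_derivative_prod_Basis[of u u' x, OF assms(1)], symmetric]) auto
  also have "\<dots> = (\<Sum>i\<in>Basis. if i = k then (u' i (x \<bullet> i) * (\<Prod>j\<in>Basis - {i}. u j (x \<bullet> j))) else 0)"
    by (rule sum.cong) (auto simp: inner_Basis k)
  also have "\<dots> = u' k (x \<bullet> k) * (\<Prod>j\<in>Basis - {k}. u j (x \<bullet> j))"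
    using k by simp
  also have "\<dots> = (\<Prod>i\<in>Basis. (u(k := u' k)) i (x \<bullet> i))"
    by (subst prod.remove[OF _ k]) auto
  finally show ?thesis .
qed

lemma smooth_fun_prod_Basis:
  fixes u :: "'a::euclidean_space \<Rightarrow> real \<Rightarrow> real"
  assumes "\<And>i. i \<in> Basis \<Longrightarrow> smooth_real (u i)"
  shows "smooth_fun (\<lambda>x. \<Prod>i\<in>Basis. u i (x \<bullet> i))"
proof -
  \<comment> \<open>The coinduction candidate is the class of all coordinate products of smooth
    one-variable functions. A partial derivative replaces one factor by its derivative and stays in
    the class.\<close>
  define X where "X f \<longleftrightarrow> (\<exists>u. (\<forall>i\<in>Basis. smooth_real (u i)) \<and> f = (\<lambda>x::'a. \<Prod>i\<in>Basis. u i (x \<bullet> i)))"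
    for f :: "'a \<Rightarrow> real"
  have "X (\<lambda>x. \<Prod>i\<in>Basis. u i (x \<bullet> i))" unfolding X_def using assms by blast
  then show ?thesis
  proof (rule smooth_fun.coinduct[of X])
    fix f assume "X f"
    then obtain v where v: "\<And>i. i \<in> Basis \<Longrightarrow> smooth_real (v i)"
      and eq: "f = (\<lambda>x. \<Prod>i\<in>Basis. v i (x \<bullet> i))"
      unfolding X_def by blast
    have "\<exists>v'. \<forall>i\<in>Basis. smooth_real (v' i) \<and> (\<forall>t. (v i has_real_derivative v' i t) (at t))"
    proof (rule bchoice, rule ballI)
      fix i :: 'a assume "i \<in> Basis"
      from smooth_real_deriv[OF v[OF this]]
      show "\<exists>y. smooth_real y \<and> (\<forall>t. (v i has_real_derivative y t) (at t))" by metis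
    qed
    then obtain v' where v': "\<And>i. i \<in> Basis \<Longrightarrow> smooth_real (v' i)"
      "\<And>i t. i \<in> Basis \<Longrightarrow> (v i has_real_derivative v' i t) (at t)" by blast
    have "(\<lambda>x. \<Prod>i\<in>Basis. v i (x \<bullet> i)) differentiable (at x)" for x
      using has_derivative_prod_Basis[of v v' x, OF v'(2)] unfolding differentiable_def by blast
    moreover have "X (\<lambda>x. frechet_derivative (\<lambda>x. \<Prod>i\<in>Basis. v i (x \<bullet> i)) (at x) k)" if "k \<in> Basis" for k
    proof -
      have "(\<lambda>x. frechet_derivative (\<lambda>x. \<Prod>i\<in>Basis. v i (x \<bullet> i)) (at x) k)
          = (\<lambda>x. \<Prod>i\<in>Basis. (v(k := v' k)) i (x \<bullet> i))"
        using frechet_derivative_prod_Basis[of v v', OF v'(2) that] by blast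
      moreover have "\<forall>i\<in>Basis. smooth_real ((v(k := v' k)) i)" using v v' by simp
      ultimately show ?thesis unfolding X_def by blast
    qed
    ultimately show "\<exists>g. f = g \<and> (\<forall>x. g differentiable (at x)) \<and>
        (\<forall>i\<in>Basis. X (\<lambda>x. frechet_derivative g (at x) i) \<or> smooth_fun (\<lambda>x. frechet_derivative g (at x) i))"
      unfolding eq by (intro exI[of _ "\<lambda>x. \<Prod>i\<in>Basis. v i (x \<bullet> i)"] conjI refl allI ballI disjI1)
  qed
qed

text \<open>The parameter \<tau> controls the sharpness: as it decreases to 0 the profile increases
  to the indicator of the open interval.\<close>

definition cutoff :: "real \<Rightarrow> real \<Rightarrow> real \<Rightarrow> real \<Rightarrow> real" where
  "cutoff \<tau> a b t = (if a < t \<and> t < b then exp (- \<tau> / ((t - a) * (b - t))) else 0)"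

text \<open>A single term of the exponential series at \<tau>/w bounds the whole series from below.
  Hence the exponential beats every negative power of w near the endpoints.\<close>

lemma exp_minus_inverse_le:
  fixes w \<tau> :: real
  assumes "0 < w" "0 < \<tau>"
  shows "exp (- \<tau> / w) \<le> fact k / \<tau> ^ k * w ^ k"
proof -
  have "(\<tau> / w) ^ k / fact k \<le> exp (\<tau> / w)"
  proof -
    have "(\<tau> / w) ^ k /\<^sub>R fact k \<le> (\<Sum>n. (\<tau> / w) ^ n /\<^sub>R fact n)"
      using sum_le_suminf[OF summable_exp_generic[of "\<tau> / w"], of "{k}"] assms by simp
    then show ?thesis by (simp add: exp_def divide_inverse mult.commute)
  qed
  then have "exp (- (\<tau> / w)) \<le> fact k / (\<tau> / w) ^ k"
    using assms by (simp add: exp_minus field_simps)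
  then show ?thesis using assms by (simp add: field_simps)
qed

lemma has_real_derivative_0_quadratic:
  fixes f :: "real \<Rightarrow> real"
  assumes "f c = 0" "\<And>t. \<bar>f t\<bar> \<le> C * (t - c)\<^sup>2"
  shows "(f has_real_derivative 0) (at c)"
proof -
  have "((\<lambda>h. C * \<bar>h\<bar>) \<longlongrightarrow> C * \<bar>0\<bar>) (at 0)"
    by (intro tendsto_intros)
  then have lim: "((\<lambda>h. C * \<bar>h\<bar>) \<longlongrightarrow> 0) (at 0)" by simp
  have bd: "norm (f (c + h) / h) \<le> C * \<bar>h\<bar>" for h
  proof (cases "h = 0")
    case False
    have "\<bar>f (c + h)\<bar> \<le> C * \<bar>h\<bar> * \<bar>h\<bar>"
      using assms(2)[of "c + h"] by (simp add: power2_eq_square mult.assoc)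
    then show ?thesis using False by (simp add: field_simps)
  qed simp
  have "((\<lambda>h. f (c + h) / h) \<longlongrightarrow> 0) (at 0)"
    using bd by (intro Lim_null_comparison[OF _ lim] always_eventually allI)
  then show ?thesis using assms(1) by (simp add: DERIV_def)
qed

text \<open>With W the quadratic vanishing at both endpoints, the functions P exp(-\<tau>/W) / W^m,
  extended by 0, form a class closed under differentiation. One differentiability proof for this
  class gives the whole tower of derivatives.\<close>

lemma smooth_real_cutoff:
  assumes ab: "a < b" and \<tau>: "0 < \<tau>"
  shows "smooth_real (cutoff \<tau> a b)"
proof -
  define W where "W = [:-a, 1:] * [:b, -1:]"
  have W: "poly W t = (t - a) * (b - t)" for t by (simp add: W_def algebra_simps)
  define F where "F P m t = (if a < t \<and> t < b then poly P t * exp (- \<tau> / poly W t) / poly W t ^ m else 0)"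
    for P and m :: nat and t
  \<comment> \<open>The numerator that the quotient rule produces over the common denominator
    \<open>W ^ (m + 2)\<close>.\<close>
  define D where "D P m = pderiv P * W ^ 2 + smult \<tau> (P * pderiv W) - smult (of_nat m) (P * pderiv W * W)"
    for P and m :: nat
  have der: "(F P m has_real_derivative F (D P m) (m + 2) t) (at t)" for P m t
  proof -
    have "continuous_on {a..b} (poly P)" by (intro continuous_intros)
    then have "bounded (poly P ` {a..b})" by (intro compact_imp_bounded compact_continuous_image) auto
    then obtain K where K: "\<And>t. t \<in> {a..b} \<Longrightarrow> \<bar>poly P t\<bar> \<le> K"
      unfolding bounded_iff real_norm_def by blast
    \<comment> \<open>The power m + 2 of W from the exponential bound cancels the denominator
      \<open>W ^ m\<close> and leaves a square, which forces derivative 0 at each endpoint.\<close>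
    define C where "C = K * (fact (m + 2) / \<tau> ^ (m + 2))"
    have "K \<ge> 0" using K[of a] ab by auto
    then have C0: "C \<ge> 0" using \<tau> by (simp add: C_def)
    have bd: "\<bar>F P m t\<bar> \<le> C * ((t - a) * (b - t))\<^sup>2" for t
    proof (cases "a < t \<and> t < b")
      case True
      then have w: "poly W t > 0" by (simp add: W)
      have "\<bar>F P m t\<bar> = \<bar>poly P t\<bar> * (exp (- \<tau> / poly W t) / poly W t ^ m)"
        using w True by (simp add: F_def abs_mult)
      also have "\<dots> \<le> K * ((fact (m + 2) / \<tau> ^ (m + 2) * poly W t ^ (m + 2)) / poly W t ^ m)"
        using exp_minus_inverse_le[OF w \<tau>, of "m + 2"] w True K[of t] \<open>K \<ge> 0\<close>
        by (intro mult_mono divide_right_mono) auto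
      also have "\<dots> = C * (poly W t)\<^sup>2" using w by (simp add: C_def power_add power2_eq_square)
      finally show ?thesis by (simp add: W)
    next
      case False
      then have "F P m t = 0" by (auto simp: F_def)
      then show ?thesis using C0 by simp
    qed
    have bd_a: "\<bar>F P m t\<bar> \<le> C * (b - a)\<^sup>2 * (t - a)\<^sup>2" and bd_b: "\<bar>F P m t\<bar> \<le> C * (b - a)\<^sup>2 * (t - b)\<^sup>2" for t
    proof -
      have "\<bar>F P m t\<bar> \<le> C * (b - a)\<^sup>2 * (t - a)\<^sup>2 \<and> \<bar>F P m t\<bar> \<le> C * (b - a)\<^sup>2 * (t - b)\<^sup>2"
      proof (cases "a < t \<and> t < b")
        case True
        have "(b - t)\<^sup>2 \<le> (b - a)\<^sup>2" "(t - a)\<^sup>2 \<le> (b - a)\<^sup>2"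
          using True by (auto intro!: power_mono)
        then have "(b - t)\<^sup>2 * (t - a)\<^sup>2 \<le> (b - a)\<^sup>2 * (t - a)\<^sup>2"
          "(t - a)\<^sup>2 * (b - t)\<^sup>2 \<le> (b - a)\<^sup>2 * (b - t)\<^sup>2"
          by (simp_all add: mult_right_mono)
        moreover have "((t - a) * (b - t))\<^sup>2 = (b - t)\<^sup>2 * (t - a)\<^sup>2"
          "((t - a) * (b - t))\<^sup>2 = (t - a)\<^sup>2 * (b - t)\<^sup>2" "(t - b)\<^sup>2 = (b - t)\<^sup>2"
          by (simp_all add: power2_eq_square algebra_simps)
        ultimately have "C * ((t - a) * (b - t))\<^sup>2 \<le> C * ((b - a)\<^sup>2 * (t - a)\<^sup>2)"
          "C * ((t - a) * (b - t))\<^sup>2 \<le> C * ((b - a)\<^sup>2 * (t - b)\<^sup>2)"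
          using C0 by (metis mult_left_mono)+
        then show ?thesis using bd[of t] by (auto simp: mult.assoc)
      next
        case False
        then have "F P m t = 0" by (auto simp: F_def)
        then show ?thesis using C0 by simp
      qed
      then show "\<bar>F P m t\<bar> \<le> C * (b - a)\<^sup>2 * (t - a)\<^sup>2" "\<bar>F P m t\<bar> \<le> C * (b - a)\<^sup>2 * (t - b)\<^sup>2" by auto
    qed
    consider "t = a" | "t = b" | "t < a \<or> b < t" | "a < t" "t < b" by linarith
    then show ?thesis
    proof cases
      case 1
      have "(F P m has_real_derivative 0) (at a)"
        by (rule has_real_derivative_0_quadratic[OF _ bd_a]) (simp add: F_def)
      then show ?thesis using 1 by (simp add: F_def)
    next
      case 2
      have "(F P m has_real_derivative 0) (at b)"
        by (rule has_real_derivative_0_quadratic[OF _ bd_b]) (simp add: F_def)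
      then show ?thesis using 2 by (simp add: F_def)
    next
      case 3
      have "((\<lambda>_. 0) has_real_derivative 0) (at t)" by simp
      then have "(F P m has_real_derivative 0) (at t)"
        by (rule has_field_derivative_transform_within_open[where S = "- {a..b}"])
           (use 3 in \<open>auto simp: F_def\<close>)
      then show ?thesis using 3 by (auto simp: F_def)
    next
      case 4
      then have w: "poly W t > 0" by (simp add: W)
      have "((\<lambda>t. poly P t * exp (- \<tau> / poly W t) / poly W t ^ m) has_real_derivative
              poly (D P m) t * exp (- \<tau> / poly W t) / poly W t ^ (m + 2)) (at t)"
      proof -
        have "((\<lambda>t. poly P t * exp (- \<tau> / poly W t) / poly W t ^ m) has_real_derivative
           ((poly (pderiv P) t * exp (- \<tau> / poly W t) +
              poly P t * (exp (- \<tau> / poly W t) * (\<tau> * poly (pderiv W) t / (poly W t)\<^sup>2))) * poly W t ^ m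
             - poly P t * exp (- \<tau> / poly W t) * (of_nat m * (poly W t ^ (m - 1) * poly (pderiv W) t)))
           / (poly W t ^ m * poly W t ^ m)) (at t)"
          using w by (auto intro!: derivative_eq_intros poly_DERIV simp: power2_eq_square)
        also have "((poly (pderiv P) t * exp (- \<tau> / poly W t) +
              poly P t * (exp (- \<tau> / poly W t) * (\<tau> * poly (pderiv W) t / (poly W t)\<^sup>2))) * poly W t ^ m
             - poly P t * exp (- \<tau> / poly W t) * (of_nat m * (poly W t ^ (m - 1) * poly (pderiv W) t)))
           / (poly W t ^ m * poly W t ^ m) = poly (D P m) t * exp (- \<tau> / poly W t) / poly W t ^ (m + 2)"
          using w by (cases m) (auto simp: D_def field_simps power2_eq_square power_add)
        finally show ?thesis .
      qed
      then have "(F P m has_real_derivative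
              poly (D P m) t * exp (- \<tau> / poly W t) / poly W t ^ (m + 2)) (at t)"
        by (rule has_field_derivative_transform_within_open[where S = "{a<..<b}"])
           (use 4 in \<open>auto simp: F_def\<close>)
      then show ?thesis using 4 by (simp add: F_def)
    qed
  qed
  define G where "G n = ((\<lambda>(P, m). (D P m, m + 2)) ^^ n) (1, 0)" for n
  have "smooth_real (F 1 0)"
    unfolding smooth_real_def
    by (rule exI[of _ "\<lambda>n. F (fst (G n)) (snd (G n))"])
       (use der in \<open>auto simp: G_def case_prod_beta\<close>)
  also have "F 1 0 = cutoff \<tau> a b"
    by (auto simp: F_def cutoff_def W fun_eq_iff)
  finally show ?thesis .
qed

section \<open>Product cutoffs on boxes\<close>

definition box_cutoff :: "real \<Rightarrow> 'a::euclidean_space \<Rightarrow> 'a \<Rightarrow> 'a \<Rightarrow> real" where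
  "box_cutoff \<tau> a b x = (\<Prod>i\<in>Basis. cutoff \<tau> (a \<bullet> i) (b \<bullet> i) (x \<bullet> i))"

lemma box_cutoff_nonzero_iff: "box_cutoff \<tau> a b x \<noteq> 0 \<longleftrightarrow> x \<in> box a b"
  by (auto simp: box_cutoff_def cutoff_def mem_box)

lemma box_cutoff_shift: "box_cutoff \<tau> a b (x + v) = box_cutoff \<tau> (a - v) (b - v) x"
  unfolding box_cutoff_def cutoff_def by (intro prod.cong) (auto simp: inner_simps algebra_simps)

lemma abs_box_cutoff_le_1: "0 < \<tau> \<Longrightarrow> \<bar>box_cutoff \<tau> a b x\<bar> \<le> 1"
  unfolding box_cutoff_def abs_prod
  by (rule prod_le_1) (auto simp: cutoff_def)

lemma test_fun_box_cutoff:
  assumes "0 < \<tau>" "box a b \<noteq> {}" "cbox a b \<subseteq> \<Omega>"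
  shows "test_fun \<Omega> (box_cutoff \<tau> a b)"
proof -
  have "\<And>i. i \<in> Basis \<Longrightarrow> a \<bullet> i < b \<bullet> i" using assms(2) by (simp add: box_ne_empty)
  then have "smooth_fun (box_cutoff \<tau> a b)"
    unfolding box_cutoff_def using assms(1) by (intro smooth_fun_prod_Basis smooth_real_cutoff)
  moreover have "{x. box_cutoff \<tau> a b x \<noteq> 0} = box a b" by (auto simp: box_cutoff_nonzero_iff)
  ultimately show ?thesis using assms by (simp add: test_fun_def)
qed

lemma box_cutoff_tendsto_indicator:
  "(\<lambda>n. box_cutoff (1 / Suc n) a b x) \<longlonglongrightarrow> indicator (box a b) x"
proof (cases "x \<in> box a b")
  case True
  have "(\<lambda>n. cutoff (1 / Suc n) (a \<bullet> i) (b \<bullet> i) (x \<bullet> i)) \<longlonglongrightarrow> 1" if "i \<in> Basis" for i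
  proof -
    define w where "w = (x \<bullet> i - a \<bullet> i) * (b \<bullet> i - x \<bullet> i)"
    have "(\<lambda>n. exp (- (inverse (real (Suc n))) / w)) \<longlonglongrightarrow> exp (- 0 / w)"
      using True that by (intro tendsto_intros LIMSEQ_inverse_real_of_nat) (auto simp: w_def mem_box)
    moreover have "cutoff (1 / Suc n) (a \<bullet> i) (b \<bullet> i) (x \<bullet> i) = exp (- (inverse (real (Suc n))) / w)" for n
      using True that by (simp add: cutoff_def w_def mem_box inverse_eq_divide)
    ultimately show ?thesis by simp
  qed
  from tendsto_prod[OF this] show ?thesis using True by (simp add: box_cutoff_def)
next
  case False
  then have "box_cutoff \<tau> a b x = 0" for \<tau> using box_cutoff_nonzero_iff by blast
  then show ?thesis using False by simp
qed

lemma box_cutoff_has_derivative_explicit: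
  assumes "0 < \<tau>" "box a b \<noteq> {}"
  obtains d where "\<And>i x. i \<in> Basis \<Longrightarrow> frechet_derivative (box_cutoff \<tau> a b) (at x) i = d i x"
    "\<And>x. (box_cutoff \<tau> a b has_derivative (\<lambda>h. \<Sum>i\<in>Basis. (h \<bullet> i) * d i x)) (at x)"
    "\<And>i. i \<in> Basis \<Longrightarrow> continuous_on UNIV (d i)"
    "\<And>i x. x \<notin> box a b \<Longrightarrow> i \<in> Basis \<Longrightarrow> d i x = 0"
proof -
  let ?\<psi> = "box_cutoff \<tau> a b" 
  define d where "d i x = frechet_derivative ?\<psi> (at x) i" for i x
  have "test_fun UNIV ?\<psi>" using test_fun_box_cutoff[OF assms] by simp
  then have sm: "smooth_fun ?\<psi>" by (simp add: test_fun_def)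
  then have diff: "?\<psi> differentiable (at x)" and sm': "i \<in> Basis \<Longrightarrow> smooth_fun (d i)" for x i
    unfolding d_def by (auto elim: smooth_fun.cases)
  have lin: "frechet_derivative ?\<psi> (at x) h = (\<Sum>i\<in>Basis. (h \<bullet> i) * d i x)" for x h
  proof -
    interpret bounded_linear "frechet_derivative ?\<psi> (at x)"
      using diff frechet_derivative_works has_derivative_bounded_linear by blast
    have "frechet_derivative ?\<psi> (at x) h = frechet_derivative ?\<psi> (at x) (\<Sum>i\<in>Basis. (h \<bullet> i) *\<^sub>R i)"
      by (simp add: euclidean_representation)
    also have "\<dots> = (\<Sum>i\<in>Basis. (h \<bullet> i) * d i x)" by (simp add: sum scaleR d_def)
    finally show ?thesis .
  qed
  have hd: "(?\<psi> has_derivative (\<lambda>h. \<Sum>i\<in>Basis. (h \<bullet> i) * d i x)) (at x)" for x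
  proof -
    have "frechet_derivative ?\<psi> (at x) = (\<lambda>h. \<Sum>i\<in>Basis. (h \<bullet> i) * d i x)"
      by (intro ext lin)
    with diff[of x] show ?thesis by (simp add: frechet_derivative_works)
  qed
  have cont: "continuous_on UNIV (d i)" if "i \<in> Basis" for i
    using sm'[OF that] by (auto elim!: smooth_fun.cases intro!: differentiable_imp_continuous_on
      simp: differentiable_on_def)
  have zero: "d i x = 0" if "x \<notin> box a b" "i \<in> Basis" for i x
  proof -
    have "?\<psi> x = 0" using that box_cutoff_nonzero_iff by blast
    moreover have "0 \<le> ?\<psi> y" for y
      unfolding box_cutoff_def by (intro prod_nonneg) (auto simp: cutoff_def)
    \<comment> \<open>Every point outside the open box, its frontier included, is a global minimum
      of the nonnegative cutoff.\<close>
    ultimately have "(\<lambda>h. \<Sum>i\<in>Basis. (h \<bullet> i) * d i x) = (\<lambda>h. 0)"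
      using differential_zero_maxmin[of x UNIV ?\<psi>] hd[of x] by auto
    from fun_cong[OF this, of i] have "(\<Sum>j\<in>Basis. (i \<bullet> j) * d j x) = 0" .
    moreover have "(\<Sum>j\<in>Basis. (i \<bullet> j) * d j x) = (\<Sum>j\<in>Basis. if j = i then d j x else 0)"
      by (rule sum.cong) (auto simp: inner_Basis that(2))
    ultimately show ?thesis using that(2) by simp
  qed
  show thesis by (rule that[of d]) (use hd cont zero in \<open>auto simp: d_def\<close>)
qed

text \<open>The positive and the negative part of h are densities of two finite measures that agree
  on boxes, a generator stable under intersection; so the measures and then the densities
  agree.\<close>

lemma AE_zero_if_box_integrals_zero:
  fixes h :: "'a::euclidean_space \<Rightarrow> real"
  assumes int: "integrable lborel h"
    and zero: "\<And>a b. (\<integral>x. indicator (box a b) x * h x \<partial>lborel) = 0"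
  shows "AE x in lborel. h x = 0"
proof -
  have [measurable]: "h \<in> borel_measurable borel" using int by auto
  let ?p = "\<lambda>x. ennreal (h x)" and ?n = "\<lambda>x. ennreal (- h x)"
  have fin: "(\<integral>\<^sup>+x. ?p x \<partial>lborel) < \<infinity>" "(\<integral>\<^sup>+x. ?n x \<partial>lborel) < \<infinity>"
    using int unfolding real_integrable_def by (auto simp: less_top)
  have eq: "emeasure (density lborel ?p) (box a b) = emeasure (density lborel ?n) (box a b)" for a b :: 'a
  proof -
    let ?g = "\<lambda>x. indicator (box a b) x * h x"
    have "integrable lborel ?g"
      using integrable_mult_indicator[OF _ int, of "box a b"] by simp
    then have "(\<integral>x. ?g x \<partial>lborel) = enn2real (\<integral>\<^sup>+x. ennreal (?g x) \<partial>lborel) - enn2real (\<integral>\<^sup>+x. ennreal (- ?g x) \<partial>lborel)"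
      and f: "(\<integral>\<^sup>+x. ennreal (?g x) \<partial>lborel) < \<infinity>" "(\<integral>\<^sup>+x. ennreal (- ?g x) \<partial>lborel) < \<infinity>"
      using real_lebesgue_integral_def[of lborel ?g] unfolding real_integrable_def by (auto simp: less_top)
    then have "(\<integral>\<^sup>+x. ennreal (?g x) \<partial>lborel) = (\<integral>\<^sup>+x. ennreal (- ?g x) \<partial>lborel)"
      using zero[of a b] by (metis eq_iff_diff_eq_0 ennreal_enn2real infinity_ennreal_def)
    moreover have "(\<integral>\<^sup>+x. ennreal (?g x) \<partial>lborel) = (\<integral>\<^sup>+x. ?p x * indicator (box a b) x \<partial>lborel)"
      "(\<integral>\<^sup>+x. ennreal (- ?g x) \<partial>lborel) = (\<integral>\<^sup>+x. ?n x * indicator (box a b) x \<partial>lborel)"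
      by (auto intro!: nn_integral_cong split: split_indicator)
    ultimately show ?thesis by (simp add: emeasure_density)
  qed
  let ?E = "range (\<lambda>(a::'a, b). box a b)"
  have "density lborel ?p = density lborel ?n"
  proof (rule measure_eqI_generator_eq[where E = ?E and \<Omega> = UNIV and A = "\<lambda>n. box (- real n *\<^sub>R One) (real n *\<^sub>R One)"])
    show "Int_stable ?E"
      by (auto simp: Int_stable_def box_Int_box)
    show "emeasure (density lborel ?p) X = emeasure (density lborel ?n) X" if "X \<in> ?E" for X
      using that eq by auto
    show "sets (density lborel ?p) = sigma_sets UNIV ?E" "sets (density lborel ?n) = sigma_sets UNIV ?E"
      by (simp_all add: borel_eq_box)
    show "(\<Union>n. box (- real n *\<^sub>R One) (real n *\<^sub>R One)) = (UNIV::'a set)"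
      using UN_box_eq_UNIV by simp
    show "emeasure (density lborel ?p) (box (- real n *\<^sub>R One) (real n *\<^sub>R One)) \<noteq> \<infinity>" for n
    proof -
      have "emeasure (density lborel ?p) (box (- real n *\<^sub>R One) (real n *\<^sub>R One)) \<le> (\<integral>\<^sup>+x. ?p x \<partial>lborel)"
        by (auto simp: emeasure_density intro!: nn_integral_mono split: split_indicator)
      then show ?thesis using fin by (auto simp: top_unique)
    qed
  qed auto
  then have "AE x in lborel. ?p x = ?n x"
    using fin by (subst (asm) finite_density_unique) auto
  then show ?thesis
  proof eventually_elim
    case (elim x)
    then show ?case
      \<comment> \<open>\<open>ennreal\<close> truncates negative numbers to 0, so one of the two
        equal sides is 0, hence both are.\<close>
      by (cases "h x \<ge> 0") (auto simp: ennreal_neg ennreal_eq_0_iff dest!: sym[of 0])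
  qed
qed

text \<open>Sharpening the cutoffs gives vanishing integrals over all boxes with closure in U.
  Countably many closed boxes exhaust U, and the previous lemma applies to h cut down to each of
  them, up to a null frontier.\<close>

lemma AE_zero_if_cutoff_integrals_zero:
  fixes h :: "'a::euclidean_space \<Rightarrow> real"
  assumes int: "integrable lborel h" and U: "open U"
    and zero: "\<And>a b \<tau>. 0 < \<tau> \<Longrightarrow> box a b \<noteq> {} \<Longrightarrow> cbox a b \<subseteq> U \<Longrightarrow>
                 (\<integral>x. box_cutoff \<tau> a b x * h x \<partial>lborel) = 0"
  shows "AE x in lborel. x \<in> U \<longrightarrow> h x = 0"
proof -
  have [measurable]: "h \<in> borel_measurable borel" using int by auto
  have bx: "(\<integral>x. indicator (box a b) x * h x \<partial>lborel) = 0" if sub: "cbox a b \<subseteq> U" for a b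
  proof (cases "box a b = {}")
    case False
    have [measurable]: "box_cutoff \<tau> a b \<in> borel_measurable borel" for \<tau> and a b :: 'a
      unfolding box_cutoff_def cutoff_def by measurable
    have "(\<lambda>n. \<integral>x. box_cutoff (1 / Suc n) a b x * h x \<partial>lborel) \<longlonglongrightarrow> (\<integral>x. indicator (box a b) x * h x \<partial>lborel)"
    proof (rule integral_dominated_convergence[where w = "\<lambda>x. \<bar>h x\<bar>"])
      show "AE x in lborel. (\<lambda>n. box_cutoff (1 / Suc n) a b x * h x) \<longlonglongrightarrow> indicator (box a b) x * h x"
        by (intro AE_I2 tendsto_mult box_cutoff_tendsto_indicator tendsto_const)
      show "AE x in lborel. norm (box_cutoff (1 / Suc n) a b x * h x) \<le> \<bar>h x\<bar>" for n
        using abs_box_cutoff_le_1[of "1 / Suc n" a b]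
        by (intro AE_I2) (simp add: abs_mult mult_left_le_one_le)
    qed (use int in auto)
    moreover have "(\<integral>x. box_cutoff (1 / Suc n) a b x * h x \<partial>lborel) = 0" for n
      using zero[of "1 / Suc n" a b] False sub by simp
    ultimately show ?thesis by (simp add: LIMSEQ_const_iff)
  qed simp
  obtain D where "countable D" "D \<subseteq> Pow U" "\<And>X. X \<in> D \<Longrightarrow> \<exists>a b. X = cbox a b" "\<Union>D = U"
    using open_countable_Union_open_cbox[OF U] by metis
  note D = this
  have "AE x in lborel. x \<in> X \<longrightarrow> h x = 0" if XD: "X \<in> D" for X
  proof -
    obtain a b where X: "X = cbox a b" using D(3)[OF XD] by blast
    have sub: "cbox a b \<subseteq> U" using D(2) XD X by blast
    have "AE x in lborel. indicator (box a b) x * h x = 0"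
    proof (rule AE_zero_if_box_integrals_zero)
      show "integrable lborel (\<lambda>x. indicator (box a b) x * h x)"
        using integrable_mult_indicator[OF _ int, of "box a b"] by simp
      fix c d :: 'a
      obtain c' d' where cd: "box c d \<inter> box a b = box c' d'" by (auto simp: box_Int_box)
      have "(\<integral>x. indicator (box c d) x * (indicator (box a b) x * h x) \<partial>lborel) = (\<integral>x. indicator (box c' d') x * h x \<partial>lborel)"
        unfolding cd[symmetric] by (auto simp: indicator_inter_arith mult.assoc)
      also have "\<dots> = 0"
      proof (cases "box c' d' = {}")
        case False
        \<comment> \<open>For a nonempty open box the closed box is its closure, so the inclusion
          passes to the closed box that \<open>bx\<close> asks for.\<close>
        have "box c' d' \<subseteq> cbox a b" using cd box_subset_cbox by blast
        then have "cbox c' d' \<subseteq> cbox a b"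
          using closure_box[OF False] closure_minimal[of "box c' d'" "cbox a b"] by auto
        then show ?thesis using bx[of c' d'] sub by blast
      qed simp
      finally show "(\<integral>x. indicator (box c d) x * (indicator (box a b) x * h x) \<partial>lborel) = 0" .
    qed
    moreover have "AE x in lborel. x \<notin> cbox a b - box a b"
      using negligible_frontier_interval[of a b] by (intro AE_not_in) (auto simp: negligible_iff_null_sets null_sets_completion_iff)
    ultimately show ?thesis unfolding X by eventually_elim auto
  qed
  then have "AE x in lborel. \<forall>X\<in>D. x \<in> X \<longrightarrow> h x = 0"
    using D(1) by (subst AE_ball_countable) auto
  then show ?thesis by eventually_elim (use D(4) in auto)
qed

section \<open>Sums of molecules\<close>

lemma le_tangent_powr:
  fixes u s q :: real
  assumes "0 \<le> u" "0 < s" "1 < q"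
  shows "u \<le> s powr (1 - q) / q * u powr q + (1 - 1 / q) * s"
proof (cases "u = 0")
  case True
  then show ?thesis using assms by (simp add: field_simps)
next
  case False
  \<comment> \<open>Chosen so that the weighted geometric mean of \<open>?a\<close> and
    \<open>s\<close> is \<open>u\<close>. The resulting bound is the tangent at
    \<open>s powr q\<close> to the concave function \<open>v powr (1 / q)\<close>, taken at
    \<open>v = u powr q\<close>.\<close>
  let ?a = "s powr (1 - q) * u powr q"
  have "?a powr (1 / q) * s powr (1 - 1 / q) \<le> (1 / q) * ?a + (1 - 1 / q) * s"
    using assms False by (intro Youngs_inequality_0) (auto simp: field_simps)
  moreover have "?a powr (1 / q) * s powr (1 - 1 / q) = u"
  proof -
    have "?a powr (1 / q) = s powr ((1 - q) / q) * u"
      using assms by (simp add: powr_mult powr_powr)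
    moreover have "s powr ((1 - q) / q) * s powr (1 - 1 / q) = 1"
      using assms by (simp add: powr_add[symmetric] diff_divide_distrib)
    ultimately show ?thesis by (simp add: mult_ac)
  qed
  ultimately show ?thesis by (simp add: mult_ac)
qed

text \<open>Integrate the tangent bound for u against the weight and optimise the point of tangency.
  All integrals are nonnegative ones, so integrability of \<open>a z * u z\<close> comes out as a
  consequence.\<close>

lemma weighted_Holder:
  fixes a u :: "'z \<Rightarrow> real"
  assumes [measurable]: "a \<in> borel_measurable M" "u \<in> borel_measurable M"
    and pos: "\<And>z. 0 \<le> a z" "\<And>z. 0 \<le> u z" "0 \<le> A" "0 \<le> E" and q: "1 < q"
    and A: "(\<integral>\<^sup>+z. ennreal (a z) \<partial>M) \<le> ennreal A"
    and E: "(\<integral>\<^sup>+z. ennreal (a z * u z powr q) \<partial>M) \<le> ennreal E"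
  shows "(\<integral>\<^sup>+z. ennreal (a z * u z) \<partial>M) \<le> ennreal (A powr (1 - 1 / q) * E powr (1 / q))"
\<comment> \<open>The optimal point of tangency degenerates when A or E is 0; in these cases the
  integrand vanishes almost everywhere.\<close>
proof (cases "A = 0 \<or> E = 0")
  case True
  have "AE z in M. a z * u z = 0"
  proof (cases "A = 0")
    case True
    then have "(\<integral>\<^sup>+z. ennreal (a z) \<partial>M) = 0" using A by simp
    then have "AE z in M. ennreal (a z) = 0" by (subst (asm) nn_integral_0_iff_AE) auto
    then show ?thesis by eventually_elim (use pos in \<open>auto simp: ennreal_eq_0_iff antisym\<close>)
  next
    case False
    then have "(\<integral>\<^sup>+z. ennreal (a z * u z powr q) \<partial>M) = 0" using E True by simp
    then have "AE z in M. ennreal (a z * u z powr q) = 0" by (subst (asm) nn_integral_0_iff_AE) auto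
    then show ?thesis
    proof eventually_elim
      case (elim z)
      have "0 \<le> a z * u z powr q" using pos by simp
      with elim have "a z * u z powr q = 0" by (auto simp: ennreal_eq_0_iff intro: antisym)
      then show ?case by auto
    qed
  qed
  then have "(\<integral>\<^sup>+z. ennreal (a z * u z) \<partial>M) = (\<integral>\<^sup>+z. 0 \<partial>M)"
    by (intro nn_integral_cong_AE) auto
  then show ?thesis by simp
next
  case False
  with pos have AE: "A > 0" "E > 0" by auto
  \<comment> \<open>The minimiser of \<open>c * E + d * A\<close>; with it both E-term and A-term
    become multiples of \<open>s * A\<close>.\<close>
  define s where "s = E powr (1 / q) / A powr (1 / q)"
  have s: "s > 0" using AE by (simp add: s_def)
  define c where "c = s powr (1 - q) / q"
  define d where "d = (1 - 1 / q) * s"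
  have cd: "c \<ge> 0" "d \<ge> 0" using s q by (auto simp: c_def d_def)
  have "(\<integral>\<^sup>+z. ennreal (a z * u z) \<partial>M) \<le> (\<integral>\<^sup>+z. ennreal c * ennreal (a z * u z powr q) + ennreal d * ennreal (a z) \<partial>M)"
  proof (rule nn_integral_mono)
    fix z
    have "a z * u z \<le> a z * (c * u z powr q + d)"
      unfolding c_def d_def using pos q s by (intro mult_left_mono le_tangent_powr) auto
    also have "\<dots> = c * (a z * u z powr q) + d * a z" by (simp add: algebra_simps)
    finally have "ennreal (a z * u z) \<le> ennreal (c * (a z * u z powr q) + d * a z)"
      by (rule ennreal_leI)
    also have "\<dots> = ennreal c * ennreal (a z * u z powr q) + ennreal d * ennreal (a z)"
      using cd pos by (simp add: ennreal_plus ennreal_mult)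
    finally show "ennreal (a z * u z) \<le> ennreal c * ennreal (a z * u z powr q) + ennreal d * ennreal (a z)" .
  qed
  also have "\<dots> = ennreal c * (\<integral>\<^sup>+z. ennreal (a z * u z powr q) \<partial>M) + ennreal d * (\<integral>\<^sup>+z. ennreal (a z) \<partial>M)"
    by (simp add: nn_integral_add nn_integral_cmult)
  also have "\<dots> \<le> ennreal c * ennreal E + ennreal d * ennreal A"
    using A E by (intro add_mono mult_left_mono) auto
  also have "\<dots> = ennreal (c * E + d * A)"
    using cd pos by (simp add: ennreal_plus ennreal_mult)
  also have "c * E + d * A = A powr (1 - 1 / q) * E powr (1 / q)"
  proof -
    have sA: "s * A = A powr (1 - 1 / q) * E powr (1 / q)"
    proof -
      have "A / A powr (1 / q) = A powr (1 - 1 / q)"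
        using AE by (simp add: powr_diff)
      then show ?thesis by (metis mult.commute s_def times_divide_eq_left times_divide_eq_right)
    qed
    have "s powr (1 - q) * E = s * (E / s powr q)"
      using s by (simp add: powr_diff)
    also have "s powr q = E / A"
      using AE q by (simp add: s_def powr_divide powr_powr)
    finally have "s powr (1 - q) * E = s * A" using AE by simp
    then have "c * E + d * A = (1 / q) * (s * A) + (1 - 1 / q) * (s * A)"
      by (simp add: c_def d_def)
    also have "\<dots> = s * A" using q by (simp add: field_simps)
    finally show ?thesis using sA by simp
  qed
  finally show ?thesis .
qed

text \<open>Jensen's inequality for a signed weight of mass at most A. Integrated over x it will
  bound the L^q norm of an average of translates by that of the function averaged.\<close>

lemma powr_abs_integral_le:
  fixes a u :: "'z \<Rightarrow> real"
  assumes [measurable]: "a \<in> borel_measurable M" "u \<in> borel_measurable M"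
    and q: "1 < q" and A0: "0 \<le> A" and A: "(\<integral>\<^sup>+z. ennreal \<bar>a z\<bar> \<partial>M) \<le> ennreal A"
  shows "ennreal (\<bar>\<integral>z. a z * u z \<partial>M\<bar> powr q)
           \<le> ennreal (A powr (q - 1)) * (\<integral>\<^sup>+z. ennreal (\<bar>a z\<bar> * \<bar>u z\<bar> powr q) \<partial>M)"
proof (cases "(\<integral>\<^sup>+z. ennreal (\<bar>a z\<bar> * \<bar>u z\<bar> powr q) \<partial>M) = \<infinity>")
  case True
  \<comment> \<open>In \<open>ennreal\<close> the product of 0 and infinity is 0, so an infinite
    integral does not settle the case A = 0. There the weight vanishes almost everywhere.\<close>
  show ?thesis
  proof (cases "A = 0")
    case True
    then have "(\<integral>\<^sup>+z. ennreal \<bar>a z\<bar> \<partial>M) = 0" using A by simp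
    then have "AE z in M. ennreal \<bar>a z\<bar> = 0" by (subst (asm) nn_integral_0_iff_AE) auto
    then have "(\<integral>z. a z * u z \<partial>M) = (\<integral>z. 0 \<partial>M)"
      by (intro integral_cong_AE) (auto simp: ennreal_eq_0_iff)
    then show ?thesis by simp
  next
    case False
    with A0 have "ennreal (A powr (q - 1)) * \<infinity> = \<infinity>"
      by (simp add: ennreal_mult_top)
    then show ?thesis using True by simp
  qed
next
  case False
  then obtain E where E: "0 \<le> E" "(\<integral>\<^sup>+z. ennreal (\<bar>a z\<bar> * \<bar>u z\<bar> powr q) \<partial>M) = ennreal E"
    by (cases "\<integral>\<^sup>+z. ennreal (\<bar>a z\<bar> * \<bar>u z\<bar> powr q) \<partial>M") auto
  have le: "(\<integral>\<^sup>+z. ennreal (\<bar>a z\<bar> * \<bar>u z\<bar>) \<partial>M) \<le> ennreal (A powr (1 - 1 / q) * E powr (1 / q))"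
    using A A0 E q by (intro weighted_Holder) auto
  have "integrable M (\<lambda>z. a z * u z)"
    using le by (intro integrableI_bounded) (auto simp: abs_mult intro: le_less_trans)
  then have "ennreal \<bar>\<integral>z. a z * u z \<partial>M\<bar> \<le> (\<integral>\<^sup>+z. ennreal (\<bar>a z\<bar> * \<bar>u z\<bar>) \<partial>M)"
    using integral_norm_bound_ennreal[of M "\<lambda>z. a z * u z"] by (simp add: abs_mult)
  with le have "\<bar>\<integral>z. a z * u z \<partial>M\<bar> \<le> A powr (1 - 1 / q) * E powr (1 / q)"
    by (meson ennreal_le_iff mult_nonneg_nonneg order_trans powr_ge_zero)
  then have "\<bar>\<integral>z. a z * u z \<partial>M\<bar> powr q \<le> (A powr (1 - 1 / q) * E powr (1 / q)) powr q"
    using q by (intro powr_mono2) auto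
  also have "\<dots> = A powr (q - 1) * E"
    using q E by (simp add: powr_mult powr_powr left_diff_distrib)
  finally show ?thesis
    unfolding E(2) using E(1) by (simp add: ennreal_mult[symmetric] ennreal_leI)
qed

text \<open>\<alpha> stands for lam / q', the exponent of the radius in the normalisation of blocks.
  The last assumption says \<alpha> \<le> n / q', which is how the bound of lam by the dimension n
  enters.\<close>

locale block_domain =
  fixes \<Omega> :: "'a::euclidean_space set" and q \<alpha> :: real
  assumes open_\<Omega>: "open \<Omega>" and bounded_\<Omega>: "bounded \<Omega>" and q_gt_1: "1 < q" and \<alpha>_nonneg: "0 \<le> \<alpha>"
    and \<alpha>_le: "\<alpha> * q \<le> real DIM('a) * (q - 1)"
begin

text \<open>A multiple of a block, of size \<open>m\<close>: unlike for blocks, the centre of the ball need not lie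
  in \<open>\<Omega>\<close>, which makes the notion stable under translations.\<close>

definition mol :: "('a \<Rightarrow> real) \<Rightarrow> real \<Rightarrow> bool" where
  "mol b m \<longleftrightarrow> b \<in> borel_measurable borel \<and> 0 \<le> m \<and>
     (\<exists>x R. R > 0 \<and> (\<forall>y. y \<notin> \<Omega> \<inter> ball x R \<longrightarrow> b y = 0) \<and>
        (\<integral>\<^sup>+y. ennreal (\<bar>b y\<bar> powr q) \<partial>lborel) \<le> ennreal ((m / R powr \<alpha>) powr q))"

text \<open>Up to constants this says that the block norm of f is at most C. Asking for one
  representation of cost at most C instead of taking an infimum spares the choice of
  near-minimisers. Values of f off \<Omega> are left free.\<close>

definition Hle :: "('a \<Rightarrow> real) \<Rightarrow> real \<Rightarrow> bool" where
  "Hle f C \<longleftrightarrow> (\<exists>b m. (\<forall>k. mol (b k) (m k)) \<and> summable m \<and> suminf m \<le> C \<and>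
     (AE y in lborel. y \<in> \<Omega> \<longrightarrow> (\<lambda>k. b k y) sums f y))"

text \<open>Hoelder's inequality on \<Omega> \<inter> B(x,R) leaves the volume of this set to the
  power 1 - 1/q. The two summands bound the two regimes, small and large R.\<close>

definition L1_const :: real where
  "L1_const = (unit_ball_vol (real DIM('a)) + measure lborel \<Omega>) powr (1 - 1 / q)"

lemma L1_const_nonneg: "0 \<le> L1_const" by (simp add: L1_const_def)

lemma \<Omega>_borel [measurable]: "\<Omega> \<in> sets borel" using open_\<Omega> by simp

lemma emeasure_\<Omega>: "emeasure lborel \<Omega> = ennreal (measure lborel \<Omega>)"
  using emeasure_bounded_finite[OF bounded_\<Omega>] by (simp add: emeasure_eq_ennreal_measure less_top)

lemma mol_measurable: "mol b m \<Longrightarrow> b \<in> borel_measurable borel"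
  by (simp add: mol_def)

lemma mol_nonneg: "mol b m \<Longrightarrow> 0 \<le> m"
  by (simp add: mol_def)

lemma mol_zero: "mol (\<lambda>x. 0) 0"
  unfolding mol_def by (auto intro!: exI[of _ 1])

lemma mol_scale:
  assumes "mol b m" shows "mol (\<lambda>x. c * b x) (\<bar>c\<bar> * m)"
proof -
  obtain x R where R: "R > 0" "\<forall>y. y \<notin> \<Omega> \<inter> ball x R \<longrightarrow> b y = 0"
    "(\<integral>\<^sup>+y. ennreal (\<bar>b y\<bar> powr q) \<partial>lborel) \<le> ennreal ((m / R powr \<alpha>) powr q)"
    and [measurable]: "b \<in> borel_measurable borel" and m: "0 \<le> m" using assms unfolding mol_def by blast
  have "(\<integral>\<^sup>+y. ennreal (\<bar>c * b y\<bar> powr q) \<partial>lborel) = ennreal (\<bar>c\<bar> powr q) * (\<integral>\<^sup>+y. ennreal (\<bar>b y\<bar> powr q) \<partial>lborel)"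
    by (subst nn_integral_cmult[symmetric]) (auto simp: abs_mult powr_mult ennreal_mult)
  also have "\<dots> \<le> ennreal (\<bar>c\<bar> powr q) * ennreal ((m / R powr \<alpha>) powr q)"
    using R by (intro mult_left_mono) auto
  also have "\<dots> = ennreal ((\<bar>c\<bar> * m / R powr \<alpha>) powr q)"
    using m by (simp add: ennreal_mult[symmetric] powr_mult powr_divide)
  finally show ?thesis unfolding mol_def using R m by (auto intro!: exI[of _ x] exI[of _ R])
qed

lemma mol_restrict:
  assumes "mol b m" and [measurable]: "S \<in> sets borel" shows "mol (\<lambda>x. indicator S x * b x) m"
proof -
  obtain x R where R: "R > 0" "\<forall>y. y \<notin> \<Omega> \<inter> ball x R \<longrightarrow> b y = 0"
    "(\<integral>\<^sup>+y. ennreal (\<bar>b y\<bar> powr q) \<partial>lborel) \<le> ennreal ((m / R powr \<alpha>) powr q)"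
    and [measurable]: "b \<in> borel_measurable borel" and m: "0 \<le> m" using assms unfolding mol_def by blast
  have "(\<integral>\<^sup>+y. ennreal (\<bar>indicator S y * b y\<bar> powr q) \<partial>lborel) \<le> (\<integral>\<^sup>+y. ennreal (\<bar>b y\<bar> powr q) \<partial>lborel)"
    by (intro nn_integral_mono) (auto split: split_indicator)
  then show ?thesis unfolding mol_def using R m by (auto intro!: exI[of _ x] exI[of _ R])
qed

lemma mol_L1:
  assumes "mol b m"
  shows "(\<integral>\<^sup>+x. ennreal \<bar>b x\<bar> \<partial>lborel) \<le> ennreal (L1_const * m)"
proof -
  obtain x R where R: "R > 0" "\<forall>y. y \<notin> \<Omega> \<inter> ball x R \<longrightarrow> b y = 0"
    "(\<integral>\<^sup>+y. ennreal (\<bar>b y\<bar> powr q) \<partial>lborel) \<le> ennreal ((m / R powr \<alpha>) powr q)"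
    and [measurable]: "b \<in> borel_measurable borel" and m: "0 \<le> m" using assms unfolding mol_def by blast
  define S where "S = \<Omega> \<inter> ball x R"
  have [measurable]: "S \<in> sets borel" by (simp add: S_def)
  define A where "A = measure lborel S"
  have emS: "emeasure lborel S = ennreal A"
  proof -
    have "bounded S" using bounded_\<Omega> by (auto simp: S_def intro: bounded_subset)
    then show ?thesis
      using emeasure_bounded_finite[of S] by (simp add: A_def emeasure_eq_ennreal_measure less_top)
  qed
  have A0: "0 \<le> A" by (simp add: A_def)
  have A1: "A \<le> unit_ball_vol (real DIM('a)) * R ^ DIM('a)"
  proof -
    have "ennreal A \<le> emeasure lborel (ball x R)"
      unfolding emS[symmetric] by (intro emeasure_mono) (auto simp: S_def)
    also have "\<dots> = ennreal (unit_ball_vol (real DIM('a)) * R ^ DIM('a))"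
      using R by (simp add: emeasure_ball)
    finally show ?thesis using R(1) by (subst (asm) ennreal_le_iff) auto
  qed
  have A2: "A \<le> measure lborel \<Omega>"
  proof -
    have "ennreal A \<le> emeasure lborel \<Omega>"
      unfolding emS[symmetric] by (intro emeasure_mono) (auto simp: S_def)
    then show ?thesis unfolding emeasure_\<Omega> by simp
  qed
  have "(\<integral>\<^sup>+x. ennreal \<bar>b x\<bar> \<partial>lborel) = (\<integral>\<^sup>+x. ennreal (indicator S x * \<bar>b x\<bar>) \<partial>lborel)"
    using R(2) by (intro nn_integral_cong) (auto simp: S_def split: split_indicator)
  also have "\<dots> \<le> ennreal (A powr (1 - 1 / q) * ((m / R powr \<alpha>) powr q) powr (1 / q))"
  proof (rule weighted_Holder)
    show "(\<integral>\<^sup>+ z. ennreal (indicator S z) \<partial>lborel) \<le> ennreal A"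
      unfolding emS[symmetric] by (simp add: ennreal_indicator)
    show "(\<integral>\<^sup>+ z. ennreal (indicator S z * \<bar>b z\<bar> powr q) \<partial>lborel) \<le> ennreal ((m / R powr \<alpha>) powr q)"
      by (rule order_trans[OF nn_integral_mono R(3)]) (auto split: split_indicator)
  qed (use A0 q_gt_1 in auto)
  also have "((m / R powr \<alpha>) powr q) powr (1 / q) = m / R powr \<alpha>"
    using q_gt_1 m by (simp add: powr_powr)
  also have "A powr (1 - 1 / q) * (m / R powr \<alpha>) \<le> L1_const * m"
  proof -
    have qq: "0 \<le> 1 - 1 / q" using q_gt_1 by simp
    have "A powr (1 - 1 / q) / R powr \<alpha> \<le> L1_const"
    \<comment> \<open>Up to radius 1 the volume of the ball contributes R^(n(1 - 1/q)), which
      \<alpha> \<le> n(1 - 1/q) makes at most \<open>R powr \<alpha>\<close>. Beyond 1 the factor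
      \<open>R powr \<alpha>\<close> is at least 1 and the volume of \<Omega> suffices.\<close>
    proof (cases "R \<le> 1")
      case True
      have "A powr (1 - 1 / q) \<le> (unit_ball_vol (real DIM('a)) * R ^ DIM('a)) powr (1 - 1 / q)"
        using A0 A1 qq by (intro powr_mono2) auto
      also have "\<dots> = unit_ball_vol (real DIM('a)) powr (1 - 1 / q) * R powr (real DIM('a) * (1 - 1 / q))"
        using R by (simp add: powr_mult powr_powr flip: powr_realpow)
      also have "\<dots> \<le> L1_const * R powr \<alpha>"
      proof (rule mult_mono)
        show "unit_ball_vol (real DIM('a)) powr (1 - 1 / q) \<le> L1_const"
          unfolding L1_const_def using qq by (intro powr_mono2) auto
        have "\<alpha> \<le> real DIM('a) * (1 - 1 / q)" using \<alpha>_le q_gt_1 by (simp add: field_simps)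
        then show "R powr (real DIM('a) * (1 - 1 / q)) \<le> R powr \<alpha>"
          using True R by (intro powr_mono') auto
      qed (auto simp: L1_const_nonneg)
      finally show ?thesis using R by (simp add: field_simps)
    next
      case False
      have "A powr (1 - 1 / q) \<le> L1_const"
        unfolding L1_const_def using A0 A2 qq by (intro powr_mono2) (auto intro: add_increasing)
      moreover have "1 \<le> R powr \<alpha>" using False \<alpha>_nonneg by (simp add: ge_one_powr_ge_zero)
      moreover have "A powr (1 - 1 / q) / R powr \<alpha> \<le> A powr (1 - 1 / q) / 1"
        using \<open>1 \<le> R powr \<alpha>\<close> by (intro divide_left_mono) auto
      ultimately show ?thesis by simp
    qed
    from mult_right_mono[OF this m] show ?thesis by simp
  qed
  finally show ?thesis by (simp add: ennreal_leI)
qed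

text \<open>Summing the L1 bounds of the molecules gives absolute convergence almost everywhere, so
  the pointwise \<open>suminf\<close> is a legitimate representative; its default values sit on a
  null set.\<close>

lemma mol_series:
  assumes mol: "\<And>k. mol (b k) (m k)" and m: "summable m"
  shows mol_AE_summable: "AE x in lborel. summable (\<lambda>k. \<bar>b k x\<bar>)"
    and mol_suminf_integrable: "integrable lborel (\<lambda>x. \<Sum>k. b k x)"
    and mol_suminf_L1: "(\<integral>x. \<bar>\<Sum>k. b k x\<bar> \<partial>lborel) \<le> L1_const * suminf m"
    and mol_suminf_nn: "(\<Sum>k. \<integral>\<^sup>+x. ennreal \<bar>b k x\<bar> \<partial>lborel) \<le> ennreal (L1_const * suminf m)"
proof -
  have [measurable]: "b k \<in> borel_measurable borel" for k using mol mol_measurable by blast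
  have m0: "0 \<le> m k" for k using mol mol_nonneg by blast
  have "(\<Sum>k. \<integral>\<^sup>+x. ennreal \<bar>b k x\<bar> \<partial>lborel) \<le> (\<Sum>k. ennreal (L1_const * m k))"
    by (intro suminf_le mol_L1 mol) auto
  also have "\<dots> = ennreal (\<Sum>k. L1_const * m k)"
    using m0 m L1_const_nonneg by (intro suminf_ennreal2 summable_mult) auto
  also have "(\<Sum>k. L1_const * m k) = L1_const * suminf m" using m by (rule suminf_mult)
  finally show nn: "(\<Sum>k. \<integral>\<^sup>+x. ennreal \<bar>b k x\<bar> \<partial>lborel) \<le> ennreal (L1_const * suminf m)" .
  then have nn': "(\<integral>\<^sup>+x. (\<Sum>k. ennreal \<bar>b k x\<bar>) \<partial>lborel) \<le> ennreal (L1_const * suminf m)"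
    by (subst nn_integral_suminf) auto
  then have "(\<integral>\<^sup>+x. (\<Sum>k. ennreal \<bar>b k x\<bar>) \<partial>lborel) \<noteq> \<infinity>"
    using le_less_trans[OF nn' ennreal_less_top] by auto
  then have "AE x in lborel. (\<Sum>k. ennreal \<bar>b k x\<bar>) \<noteq> \<infinity>"
    by (intro nn_integral_noteq_infinite) auto
  then show AEs: "AE x in lborel. summable (\<lambda>k. \<bar>b k x\<bar>)"
    by eventually_elim (auto intro: summable_suminf_not_top)
  have le: "(\<integral>\<^sup>+x. ennreal \<bar>\<Sum>k. b k x\<bar> \<partial>lborel) \<le> ennreal (L1_const * suminf m)"
  proof (rule order_trans[OF nn_integral_mono_AE nn'])
    show "AE x in lborel. ennreal \<bar>\<Sum>k. b k x\<bar> \<le> (\<Sum>k. ennreal \<bar>b k x\<bar>)"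
      using AEs
    proof eventually_elim
      case (elim x)
      then have "\<bar>\<Sum>k. b k x\<bar> \<le> (\<Sum>k. \<bar>b k x\<bar>)" by (rule summable_rabs)
      then show ?case using elim by (simp add: suminf_ennreal2 ennreal_leI)
    qed
  qed
  show int: "integrable lborel (\<lambda>x. \<Sum>k. b k x)"
    using le by (intro integrableI_bounded) (auto intro: le_less_trans)
  have "ennreal (\<integral>x. \<bar>\<Sum>k. b k x\<bar> \<partial>lborel) = (\<integral>\<^sup>+x. ennreal \<bar>\<Sum>k. b k x\<bar> \<partial>lborel)"
    using int by (subst nn_integral_eq_integral) auto
  with le show "(\<integral>x. \<bar>\<Sum>k. b k x\<bar> \<partial>lborel) \<le> L1_const * suminf m"
    using L1_const_nonneg suminf_nonneg[OF m m0] by (metis ennreal_le_iff mult_nonneg_nonneg)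
qed

section \<open>Calculus of the block norm bound\<close>

lemma Hle_cong:
  assumes "Hle f C" "AE x in lborel. x \<in> \<Omega> \<longrightarrow> f x = g x" "C \<le> C'"
  shows "Hle g C'"
proof -
  obtain b m where "\<forall>k. mol (b k) (m k)" "summable m" "suminf m \<le> C"
    and AEb: "AE y in lborel. y \<in> \<Omega> \<longrightarrow> (\<lambda>k. b k y) sums f y"
    using assms(1) unfolding Hle_def by blast
  moreover have "AE y in lborel. y \<in> \<Omega> \<longrightarrow> (\<lambda>k. b k y) sums g y"
    using AEb assms(2) by eventually_elim auto
  ultimately show ?thesis unfolding Hle_def using assms(3) order_trans by blast
qed

lemma Hle_nonneg: "Hle f C \<Longrightarrow> 0 \<le> C"
  unfolding Hle_def by (auto intro: order_trans[OF suminf_nonneg] mol_nonneg)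

lemma Hle_mol:
  assumes "mol b m" shows "Hle b m"
proof -
  let ?b = "\<lambda>k::nat. if k = 0 then b else (\<lambda>x. 0)" and ?m = "\<lambda>k::nat. if k = 0 then m else 0"
  have "?m sums m" using sums_single[of 0 "\<lambda>_. m"] by simp
  moreover have "(\<lambda>k. ?b k y) sums b y" for y
    using sums_single[of 0 "\<lambda>_. b y"] by (simp add: if_distrib[of "\<lambda>f. f y"] cong: if_cong)
  ultimately show ?thesis unfolding Hle_def using assms mol_zero
    by (intro exI[of _ ?b] exI[of _ ?m]) (auto simp: sums_iff)
qed

lemma Hle_zero: "Hle (\<lambda>x. 0) 0"
  by (rule Hle_mol[OF mol_zero])

lemma Hle_scale:
  assumes "Hle f C" shows "Hle (\<lambda>x. c * f x) (\<bar>c\<bar> * C)"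
proof -
  obtain b m where bm: "\<forall>k. mol (b k) (m k)" "summable m" "suminf m \<le> C"
    and AEb: "AE y in lborel. y \<in> \<Omega> \<longrightarrow> (\<lambda>k. b k y) sums f y"
    using assms(1) unfolding Hle_def by blast
  have "AE y in lborel. y \<in> \<Omega> \<longrightarrow> (\<lambda>k. c * b k y) sums (c * f y)"
    using AEb by eventually_elim (auto intro: sums_mult)
  moreover have "(\<Sum>k. \<bar>c\<bar> * m k) \<le> \<bar>c\<bar> * C"
    using bm by (simp add: suminf_mult mult_left_mono)
  ultimately show ?thesis unfolding Hle_def using bm mol_scale
    by (intro exI[of _ "\<lambda>k x. c * b k x"] exI[of _ "\<lambda>k. \<bar>c\<bar> * m k"]) auto
qed

lemma Hle_restrict:
  assumes "Hle f C" "S \<in> sets borel" shows "Hle (\<lambda>x. indicator S x * f x) C"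
proof -
  obtain b m where bm: "\<forall>k. mol (b k) (m k)" "summable m" "suminf m \<le> C"
    and AEb: "AE y in lborel. y \<in> \<Omega> \<longrightarrow> (\<lambda>k. b k y) sums f y"
    using assms(1) unfolding Hle_def by blast
  have "AE y in lborel. y \<in> \<Omega> \<longrightarrow> (\<lambda>k. indicator S y * b k y) sums (indicator S y * f y)"
    using AEb by eventually_elim (auto intro: sums_mult)
  then show ?thesis unfolding Hle_def using bm mol_restrict[OF _ assms(2)]
    by (intro exI[of _ "\<lambda>k x. indicator S x * b k x"] exI[of _ m]) auto
qed

text \<open>The representations of all \<open>u n\<close> form a double family of molecules, which a
  pairing function turns into one sequence. Absolute convergence almost everywhere, from the L1
  bounds, permits the rearrangement. This is the completeness of the block space.\<close>

lemma Hle_series: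
  assumes u: "\<And>n::nat. Hle (u n) (C n)" and C: "summable C"
  shows Hle_AE_summable: "AE x in lborel. x \<in> \<Omega> \<longrightarrow> summable (\<lambda>n. u n x)"
    and Hle_suminf: "Hle (\<lambda>x. \<Sum>n. u n x) (suminf C)"
proof -
  have "\<forall>n. \<exists>b m. (\<forall>k. mol (b k) (m k)) \<and> summable m \<and> suminf m \<le> C n \<and>
     (AE y in lborel. y \<in> \<Omega> \<longrightarrow> (\<lambda>k. b k y) sums u n y)"
    using u unfolding Hle_def by blast
  from choice[OF this] obtain b where "\<forall>n. \<exists>m. (\<forall>k. mol (b n k) (m k)) \<and> summable m \<and> suminf m \<le> C n \<and>
     (AE y in lborel. y \<in> \<Omega> \<longrightarrow> (\<lambda>k. b n k y) sums u n y)" by blast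
  from choice[OF this] obtain m where bm: "\<And>n k. mol (b n k) (m n k)" "\<And>n. summable (m n)" "\<And>n. suminf (m n) \<le> C n"
    and AEb: "\<And>n. AE y in lborel. y \<in> \<Omega> \<longrightarrow> (\<lambda>k. b n k y) sums u n y" by blast
  define b' where "b' j = (case prod_decode j of (n, k) \<Rightarrow> b n k)" for j
  define m' where "m' j = (case prod_decode j of (n, k) \<Rightarrow> m n k)" for j
  have mol': "mol (b' j) (m' j)" for j
    using bm by (auto simp: b'_def m'_def split: prod.splits)
  have m0: "0 \<le> m n k" for n k using bm mol_nonneg by blast
  have bij: "bij_betw prod_decode UNIV (UNIV :: (nat \<times> nat) set)" by (rule bij_prod_decode)
  have inner: "((\<lambda>k. case (n, k) of (n, k) \<Rightarrow> m n k) has_sum suminf (m n)) UNIV" for n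
    using bm(2) m0 by (simp add: sums_nonneg_imp_has_sum summable_sums)
  have sm0: "0 \<le> suminf (m n)" for n using bm(2) m0 by (intro suminf_nonneg)
  have g: "summable (\<lambda>n. suminf (m n))"
    by (rule summable_comparison_test'[OF C, of 0]) (use bm sm0 in auto)
  have g': "((\<lambda>n. suminf (m n)) has_sum (\<Sum>n. suminf (m n))) UNIV"
    using g sm0 by (intro sums_nonneg_imp_has_sum) (auto simp: summable_sums)
  have "(\<lambda>(n, k). m n k) summable_on (Sigma UNIV (\<lambda>_. UNIV))"
    by (rule summable_on_SigmaI[OF inner]) (use g' m0 in \<open>auto simp: summable_on_def\<close>)
  then have "((\<lambda>(n, k). m n k) has_sum (\<Sum>n. suminf (m n))) (Sigma UNIV (\<lambda>_. UNIV))"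
    by (intro has_sum_SigmaI[OF inner g'])
  then have "(m' has_sum (\<Sum>n. suminf (m n))) UNIV"
    using has_sum_reindex_bij_betw[OF bij, of "\<lambda>(n, k). m n k"] by (simp add: m'_def[abs_def] case_prod_beta)
  then have m'_sums: "m' sums (\<Sum>n. suminf (m n))" by (rule has_sum_imp_sums)
  have "(\<Sum>n. suminf (m n)) \<le> suminf C" by (intro suminf_le g C bm)
  with m'_sums have m': "summable m'" "suminf m' \<le> suminf C" by (auto simp: sums_iff)
  have AE1: "AE x in lborel. \<forall>n. summable (\<lambda>k. \<bar>b n k x\<bar>)"
    using bm by (subst AE_all_countable) (auto intro: mol_AE_summable)
  have AE2: "AE x in lborel. summable (\<lambda>j. \<bar>b' j x\<bar>)"
    using mol' m' by (intro mol_AE_summable)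
  have AE3: "AE x in lborel. \<forall>n. x \<in> \<Omega> \<longrightarrow> (\<lambda>k. b n k x) sums u n x"
    using AEb by (subst AE_all_countable) auto
  have key: "AE x in lborel. x \<in> \<Omega> \<longrightarrow> (\<lambda>n. u n x) sums (\<Sum>j. b' j x) \<and> summable (\<lambda>j. b' j x)"
    using AE1 AE2 AE3
  proof eventually_elim
    case (elim x)
    show ?case
    proof (rule impI)
      assume x: "x \<in> \<Omega>"
      have inn: "((\<lambda>k. case (n, k) of (n, k) \<Rightarrow> b n k x) has_sum u n x) UNIV" for n
        using elim x by (simp add: norm_summable_imp_has_sum)
      have sm: "summable (\<lambda>j. b' j x)" using elim(2) by (rule summable_rabs_cancel)
      then have "((\<lambda>j. b' j x) has_sum (\<Sum>j. b' j x)) UNIV"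
        using elim(2) by (intro norm_summable_imp_has_sum) (auto simp: summable_sums)
      then have "((\<lambda>(n, k). b n k x) has_sum (\<Sum>j. b' j x)) (Sigma UNIV (\<lambda>_. UNIV))"
        using has_sum_reindex_bij_betw[OF bij, of "\<lambda>(n, k). b n k x"]
        by (simp add: b'_def[abs_def] case_prod_beta)
      then have "((\<lambda>n. u n x) has_sum (\<Sum>j. b' j x)) UNIV"
        by (rule has_sum_SigmaD[OF _ inn])
      then show "(\<lambda>n. u n x) sums (\<Sum>j. b' j x) \<and> summable (\<lambda>j. b' j x)"
        using sm has_sum_imp_sums by blast
    qed
  qed
  then show "AE x in lborel. x \<in> \<Omega> \<longrightarrow> summable (\<lambda>n. u n x)"
    by eventually_elim (auto simp: sums_iff)
  have "AE x in lborel. x \<in> \<Omega> \<longrightarrow> (\<lambda>j. b' j x) sums (\<Sum>n. u n x)"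
    using key by eventually_elim (auto simp: sums_iff)
  then show "Hle (\<lambda>x. \<Sum>n. u n x) (suminf C)"
    unfolding Hle_def using mol' m' by blast
qed

lemma Hle_sum:
  assumes "finite I" "\<And>i. i \<in> I \<Longrightarrow> Hle (u i) (C i)"
  shows "Hle (\<lambda>x. \<Sum>i\<in>I. u i x) (\<Sum>i\<in>I. C i)"
proof -
  have add: "Hle (\<lambda>x. f x + g x) (c + d)" if f: "Hle f c" and g: "Hle g d" for f g c d
  proof -
    let ?u = "\<lambda>n::nat. if n = 0 then f else if n = 1 then g else (\<lambda>x. 0)"
    let ?C = "\<lambda>n::nat. if n = 0 then c else if n = 1 then d else 0"
    have "?C sums (\<Sum>n\<in>{0,1}. ?C n)" by (rule sums_finite) auto
    then have C: "summable ?C" "suminf ?C = c + d" by (auto simp: sums_iff)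
    have "(\<lambda>n. ?u n x) sums (\<Sum>n\<in>{0,1}. ?u n x)" for x by (rule sums_finite) auto
    then have u: "(\<Sum>n. ?u n x) = f x + g x" for x by (auto simp: sums_iff)
    have "Hle (\<lambda>x. \<Sum>n. ?u n x) (suminf ?C)"
      using f g Hle_zero C by (intro Hle_suminf) auto
    then show ?thesis unfolding u C .
  qed
  show ?thesis using assms
    by (induction I rule: finite_induct) (auto intro!: add Hle_zero)
qed

lemma Hle_add: "Hle f c \<Longrightarrow> Hle g d \<Longrightarrow> Hle (\<lambda>x. f x + g x) (c + d)"
  using Hle_sum[of "{True, False}" "\<lambda>t. if t then f else g" "\<lambda>t. if t then c else d"] by simp

lemma Hle_diff: "Hle f c \<Longrightarrow> Hle g d \<Longrightarrow> Hle (\<lambda>x. f x - g x) (c + d)"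
  using Hle_add[of f c "\<lambda>x. (-1) * g x" d] Hle_scale[of g d "-1"] by simp

lemma Hle_bounded:
  obtains K where "0 \<le> K"
    "\<And>f M. f \<in> borel_measurable borel \<Longrightarrow> 0 \<le> M \<Longrightarrow> (\<And>x. x \<in> \<Omega> \<Longrightarrow> \<bar>f x\<bar> \<le> M) \<Longrightarrow> Hle f (K * M)"
proof -
  obtain D where D: "0 < D" "\<Omega> \<subseteq> ball 0 D" using bounded_subset_ballD[OF bounded_\<Omega>] by blast
  define V where "V = measure lborel \<Omega>"
  \<comment> \<open>\<Omega> lies in one ball of radius D, so a bounded function cut off to \<Omega>
    is a single molecule. Its L^q norm is at most \<open>M * V powr (1 / q)\<close>, and
    \<open>D powr \<alpha>\<close> is the price of the radius.\<close>
  define K where "K = D powr \<alpha> * V powr (1 / q)"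
  have "Hle f (K * M)" if [measurable]: "f \<in> borel_measurable borel" and M: "0 \<le> M" "\<And>x. x \<in> \<Omega> \<Longrightarrow> \<bar>f x\<bar> \<le> M" for f M
  proof -
    let ?b = "\<lambda>x. indicator \<Omega> x * f x"
    have "(\<integral>\<^sup>+y. ennreal (\<bar>?b y\<bar> powr q) \<partial>lborel) \<le> (\<integral>\<^sup>+y. ennreal (M powr q) * indicator \<Omega> y \<partial>lborel)"
      using M q_gt_1 by (intro nn_integral_mono) (auto split: split_indicator intro!: ennreal_leI powr_mono2)
    also have "\<dots> = ennreal (M powr q * V)"
      by (simp add: nn_integral_cmult_indicator emeasure_\<Omega> V_def ennreal_mult)
    also have "M powr q * V = (K * M / D powr \<alpha>) powr q"
      using D M q_gt_1 by (simp add: K_def powr_mult powr_powr V_def)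
    finally have "mol ?b (K * M)"
      unfolding mol_def using D M
      by (intro conjI exI[of _ 0] exI[of _ D]) (auto simp: K_def split: split_indicator)
    then have "Hle ?b (K * M)" by (rule Hle_mol)
    then show ?thesis by (rule Hle_cong) auto
  qed
  moreover have "0 \<le> K" by (simp add: K_def)
  ultimately show thesis using that by blast
qed

end

section \<open>Averages of translates\<close>

lemma nn_integral_lborel_shift:
  fixes F :: "'a::euclidean_space \<Rightarrow> ennreal"
  assumes [measurable]: "F \<in> borel_measurable borel"
  shows "(\<integral>\<^sup>+x. F (x - c) \<partial>lborel) = (\<integral>\<^sup>+x. F x \<partial>lborel)"
proof -
  have "(\<integral>\<^sup>+x. F x \<partial>lborel) = (\<integral>\<^sup>+x. F x \<partial>distr lborel borel ((+) (- c)))"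
    by (simp add: lborel_distr_plus)
  also have "\<dots> = (\<integral>\<^sup>+x. F (x - c) \<partial>lborel)"
    by (subst nn_integral_distr) (auto simp: algebra_simps)
  finally show ?thesis by simp
qed

lemma nn_integral_weighted_shift:
  fixes F :: "'a::euclidean_space \<Rightarrow> ennreal" and c :: "'z \<Rightarrow> ennreal"
  assumes "sigma_finite_measure M"
    and [measurable]: "c \<in> borel_measurable M" "v \<in> borel_measurable M" "F \<in> borel_measurable borel"
  shows "(\<integral>\<^sup>+x. (\<integral>\<^sup>+z. c z * F (x - v z) \<partial>M) \<partial>lborel) = (\<integral>\<^sup>+z. c z \<partial>M) * (\<integral>\<^sup>+x. F x \<partial>lborel)"
proof -
  interpret M: sigma_finite_measure M by fact
  interpret P: pair_sigma_finite M lborel ..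
  have "(\<integral>\<^sup>+x. (\<integral>\<^sup>+z. c z * F (x - v z) \<partial>M) \<partial>lborel) = (\<integral>\<^sup>+z. (\<integral>\<^sup>+x. c z * F (x - v z) \<partial>lborel) \<partial>M)"
    by (rule P.Fubini') measurable
  also have "\<dots> = (\<integral>\<^sup>+z. c z * (\<integral>\<^sup>+x. F x \<partial>lborel) \<partial>M)"
    by (simp add: nn_integral_cmult nn_integral_lborel_shift)
  also have "\<dots> = (\<integral>\<^sup>+z. c z \<partial>M) * (\<integral>\<^sup>+x. F x \<partial>lborel)"
    by (simp add: nn_integral_multc)
  finally show ?thesis .
qed

text \<open>Summability of the norms on the product space yields, for almost every x, summability of
  the norms in z, and there the series may be integrated termwise. H must equal the series only
  where it converges absolutely, because elsewhere \<open>suminf\<close> has an arbitrary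
  value.\<close>

lemma AE_sums_section:
  fixes h :: "nat \<Rightarrow> 'z \<Rightarrow> 'a::euclidean_space \<Rightarrow> real"
  assumes "sigma_finite_measure M"
    and h [measurable]: "\<And>k. (\<lambda>(x, z). h k z x) \<in> borel_measurable (borel \<Otimes>\<^sub>M M)"
    and fin: "(\<Sum>k. \<integral>\<^sup>+x. (\<integral>\<^sup>+z. ennreal \<bar>h k z x\<bar> \<partial>M) \<partial>lborel) < \<infinity>"
    and H: "\<And>z x. summable (\<lambda>k. \<bar>h k z x\<bar>) \<Longrightarrow> H z x = (\<Sum>k. h k z x)"
    and [measurable]: "\<And>x. (\<lambda>z. H z x) \<in> borel_measurable M"
  shows "AE x in lborel. (\<lambda>k. \<integral>z. h k z x \<partial>M) sums (\<integral>z. H z x \<partial>M)"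
proof -
  interpret M: sigma_finite_measure M by fact
  have [measurable]: "(\<lambda>x. \<integral>\<^sup>+z. ennreal \<bar>h k z x\<bar> \<partial>M) \<in> borel_measurable borel" for k
    by measurable
  have "(\<integral>\<^sup>+x. (\<Sum>k. \<integral>\<^sup>+z. ennreal \<bar>h k z x\<bar> \<partial>M) \<partial>lborel) < \<infinity>"
    using fin by (subst nn_integral_suminf) auto
  then have "AE x in lborel. (\<Sum>k. \<integral>\<^sup>+z. ennreal \<bar>h k z x\<bar> \<partial>M) \<noteq> \<infinity>"
    by (intro nn_integral_noteq_infinite) auto
  then show ?thesis
  proof eventually_elim
    case (elim x)
    have [measurable]: "(\<lambda>z. h k z x) \<in> borel_measurable M" for k
      using measurable_compose[OF measurable_Pair1' h, of x k] by simp
    have "(\<integral>\<^sup>+z. (\<Sum>k. ennreal \<bar>h k z x\<bar>) \<partial>M) = (\<Sum>k. \<integral>\<^sup>+z. ennreal \<bar>h k z x\<bar> \<partial>M)"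
      by (rule nn_integral_suminf) measurable
    then have "AE z in M. (\<Sum>k. ennreal \<bar>h k z x\<bar>) \<noteq> \<infinity>"
      using elim by (intro nn_integral_noteq_infinite) auto
    then have AEz: "AE z in M. summable (\<lambda>k. \<bar>h k z x\<bar>)"
      by eventually_elim (auto intro: summable_suminf_not_top)
    have fink: "(\<integral>\<^sup>+z. ennreal \<bar>h k z x\<bar> \<partial>M) \<noteq> \<infinity>" for k
      using elim ennreal_suminf_lessD[of "\<lambda>k. \<integral>\<^sup>+z. ennreal \<bar>h k z x\<bar> \<partial>M" \<infinity> k] by (auto simp: less_top)
    have int: "integrable M (\<lambda>z. h k z x)" for k
      using fink[of k] by (intro integrableI_bounded) (auto simp: less_top)
    have eq: "(\<integral>\<^sup>+z. ennreal \<bar>h k z x\<bar> \<partial>M) = ennreal (\<integral>z. \<bar>h k z x\<bar> \<partial>M)" for k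
      using int[of k] by (intro nn_integral_eq_integral) auto
    have "summable (\<lambda>k. \<integral>z. \<bar>h k z x\<bar> \<partial>M)"
      using elim unfolding eq by (intro summable_suminf_not_top) auto
    then have "(\<lambda>k. \<integral>z. h k z x \<partial>M) sums (\<integral>z. (\<Sum>k. h k z x) \<partial>M)"
      using AEz int by (intro sums_integral) auto
    also have "(\<integral>z. (\<Sum>k. h k z x) \<partial>M) = (\<integral>z. H z x \<partial>M)"
      using AEz H by (intro integral_cong_AE) auto
    finally show ?case .
  qed
qed

text \<open>The balls around a countable dense set cover the space; making them disjoint in sequence
  keeps each piece inside its ball.\<close>

lemma ball_partition:
  assumes "0 < R"
  obtains d :: "nat \<Rightarrow> 'a::euclidean_space" and Q where
    "\<And>n. Q n \<in> sets borel" "\<And>n. Q n \<subseteq> ball (d n) R" "disjoint_family Q" "(\<Union>n. Q n) = UNIV"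
proof -
  obtain D :: "'a set" where D: "countable D" "\<And>X. open X \<Longrightarrow> X \<noteq> {} \<Longrightarrow> \<exists>d\<in>D. d \<in> X"
    by (erule countable_dense_setE)
  have ne: "D \<noteq> {}" using D(2)[of UNIV] by auto
  define d where "d = from_nat_into D"
  have "(\<Union>n. ball (d n) R) = UNIV"
  proof (intro equalityI subset_UNIV subsetI)
    fix x :: 'a
    obtain y where "y \<in> D" "y \<in> ball x R" using D(2)[of "ball x R"] assms by auto
    then show "x \<in> (\<Union>n. ball (d n) R)"
      using from_nat_into_surj[OF D(1)] unfolding d_def by (auto simp: dist_commute)
  qed
  then have U: "(\<Union>n. disjointed (\<lambda>n. ball (d n) R) n) = UNIV"
    by (simp add: UN_disjointed_eq)
  have "range (disjointed (\<lambda>n. ball (d n) R)) \<subseteq> sets borel"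
    by (rule sets.range_disjointed_sets) auto
  then have B: "disjointed (\<lambda>n. ball (d n) R) n \<in> sets borel" for n by blast
  show thesis
    by (rule that[of "disjointed (\<lambda>n. ball (d n) R)" d, OF B disjointed_subset disjoint_family_disjointed U])
qed

context block_domain
begin

context
  fixes M :: "'z measure" and a :: "'z \<Rightarrow> real" and v :: "'z \<Rightarrow> 'a" and A :: real
  assumes M: "sigma_finite_measure M" and a [measurable]: "a \<in> borel_measurable M"
    and v [measurable]: "v \<in> borel_measurable M" and A0: "0 \<le> A"
    and A: "(\<integral>\<^sup>+z. ennreal \<bar>a z\<bar> \<partial>M) \<le> ennreal A"
begin

text \<open>Cutting the parameter space into cells on which \<open>v\<close> varies by less than the radius \<open>R\<close> of the
  ball of \<open>b\<close> makes each partial average a molecule on a ball of radius \<open>2R\<close>.\<close>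

lemma Hle_average_mol:
  assumes "mol b m"
  shows "Hle (\<lambda>x. \<integral>z. a z * b (x - v z) \<partial>M) (2 powr \<alpha> * A * m)"
proof -
  interpret M: sigma_finite_measure M by (rule M)
  obtain x0 R where R: "R > 0" "\<forall>y. y \<notin> \<Omega> \<inter> ball x0 R \<longrightarrow> b y = 0"
    "(\<integral>\<^sup>+y. ennreal (\<bar>b y\<bar> powr q) \<partial>lborel) \<le> ennreal ((m / R powr \<alpha>) powr q)"
    and b [measurable]: "b \<in> borel_measurable borel" and m: "0 \<le> m" using assms unfolding mol_def by blast
  obtain d :: "nat \<Rightarrow> 'a" and Q where Q [measurable]: "\<And>n. Q n \<in> sets borel" and Qd: "\<And>n. Q n \<subseteq> ball (d n) R"
    and Qdis: "disjoint_family Q" and QU: "(\<Union>n. Q n) = UNIV"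
    by (rule ball_partition[OF R(1)], blast)
  define c where "c n z = indicator (Q n) (v z) * a z" for n z
  have [measurable]: "c n \<in> borel_measurable M" for n unfolding c_def by measurable
  \<comment> \<open>Each y lies in exactly one cell, so the series has a single nonzero
    term.\<close>
  have one: "(\<lambda>n. indicator (Q n) y * r) sums r" for y and r :: real
  proof -
    obtain N where N: "y \<in> Q N" using QU by blast
    have "indicator (Q n) y * r = (if n = N then r else 0)" for n
      using N Qdis by (auto simp: disjoint_family_on_def split: split_indicator)
    then show ?thesis using sums_single[of N "\<lambda>_. r"] by simp
  qed
  have csum: "(\<integral>\<^sup>+z. ennreal \<bar>a z\<bar> \<partial>M) = (\<Sum>n. \<integral>\<^sup>+z. ennreal \<bar>c n z\<bar> \<partial>M)"
  proof -
    have "(\<Sum>n. ennreal \<bar>c n z\<bar>) = ennreal \<bar>a z\<bar>" for z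
    proof -
      have "(\<lambda>n. \<bar>c n z\<bar>) sums \<bar>a z\<bar>"
        using one[of "v z" "\<bar>a z\<bar>"] by (simp add: c_def abs_mult)
      then show ?thesis by (intro suminf_ennreal_eq) auto
    qed
    then have "(\<integral>\<^sup>+z. ennreal \<bar>a z\<bar> \<partial>M) = (\<integral>\<^sup>+z. (\<Sum>n. ennreal \<bar>c n z\<bar>) \<partial>M)" by simp
    also have "\<dots> = (\<Sum>n. \<integral>\<^sup>+z. ennreal \<bar>c n z\<bar> \<partial>M)" by (rule nn_integral_suminf) measurable
    finally show ?thesis .
  qed
  have cfin: "(\<Sum>n. \<integral>\<^sup>+z. ennreal \<bar>c n z\<bar> \<partial>M) \<le> ennreal A" using A unfolding csum .
  have cn: "(\<integral>\<^sup>+z. ennreal \<bar>c n z\<bar> \<partial>M) < \<infinity>" for n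
    using ennreal_suminf_lessD[of "\<lambda>n. \<integral>\<^sup>+z. ennreal \<bar>c n z\<bar> \<partial>M" \<infinity> n] le_less_trans[OF cfin] by simp
  define An where "An n = enn2real (\<integral>\<^sup>+z. ennreal \<bar>c n z\<bar> \<partial>M)" for n
  have An: "(\<integral>\<^sup>+z. ennreal \<bar>c n z\<bar> \<partial>M) = ennreal (An n)" for n
    unfolding An_def using cn by (simp add: ennreal_enn2real less_top)
  have An0: "0 \<le> An n" for n by (simp add: An_def)
  have Asum: "summable An" "suminf An \<le> A"
  proof -
    have "(\<Sum>n. ennreal (An n)) \<noteq> \<infinity>" using le_less_trans[OF cfin ennreal_less_top] unfolding An by auto
    then show sm: "summable An" using An0 by (intro summable_suminf_not_top) auto
    have "ennreal (suminf An) \<le> ennreal A"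
      using cfin unfolding An using sm An0 by (subst (asm) suminf_ennreal2) auto
    then show "suminf An \<le> A" using A0 by simp
  qed
  define p where "p n x = (\<integral>z. c n z * b (x - v z) \<partial>M)" for n x
  have p_meas [measurable]: "p n \<in> borel_measurable borel" for n
    unfolding p_def by measurable
  have mol_p: "mol (\<lambda>x. indicator \<Omega> x * p n x) (2 powr \<alpha> * m * An n)" for n
  proof -
    have zero: "p n x = 0" if "x \<notin> ball (x0 + d n) (2 * R)" for x
    proof -
      \<comment> \<open>On the n-th cell \<open>v z\<close> is within R of \<open>d n\<close>, and b
        lives within R of x0; so the piece lives within 2R of \<open>x0 + d n\<close>.\<close>
      have "c n z * b (x - v z) = 0" for z
      proof (rule ccontr)
        assume "c n z * b (x - v z) \<noteq> 0"
        then have 1: "v z \<in> Q n" and 2: "b (x - v z) \<noteq> 0" by (auto simp: c_def split: split_indicator_asm)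
        from 1 Qd[of n] have "dist (d n) (v z) < R" by auto
        moreover from 2 R(2) have "dist x0 (x - v z) < R" by auto
        ultimately have "norm (d n - v z) < R" "norm (x0 - (x - v z)) < R" by (auto simp: dist_norm)
        then have "norm ((d n - v z) + (x0 - (x - v z))) < 2 * R" by (intro norm_triangle_lt) auto
        then show False using that by (simp add: dist_norm algebra_simps)
      qed
      then have "(\<lambda>z. c n z * b (x - v z)) = (\<lambda>z. 0)" by (rule ext)
      then show ?thesis unfolding p_def by (simp only: integral_zero)
    qed
    have "(\<integral>\<^sup>+x. ennreal (\<bar>indicator \<Omega> x * p n x\<bar> powr q) \<partial>lborel) \<le> (\<integral>\<^sup>+x. ennreal (\<bar>p n x\<bar> powr q) \<partial>lborel)"
      by (intro nn_integral_mono) (auto split: split_indicator)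
    \<comment> \<open>Jensen's inequality with mass \<open>An n\<close>; integrating over x then
      contributes another factor \<open>An n\<close>, which makes up the full power q.\<close>
    also have "\<dots> \<le> (\<integral>\<^sup>+x. ennreal (An n powr (q - 1)) * (\<integral>\<^sup>+z. ennreal (\<bar>c n z\<bar> * \<bar>b (x - v z)\<bar> powr q) \<partial>M) \<partial>lborel)"
      unfolding p_def by (intro nn_integral_mono powr_abs_integral_le) (use q_gt_1 An0 An in auto)
    also have "\<dots> = (\<integral>\<^sup>+x. ennreal (An n powr (q - 1)) * (\<integral>\<^sup>+z. ennreal \<bar>c n z\<bar> * ennreal (\<bar>b (x - v z)\<bar> powr q) \<partial>M) \<partial>lborel)"
      by (simp add: ennreal_mult)
    also have "\<dots> = ennreal (An n powr (q - 1)) * (\<integral>\<^sup>+x. (\<integral>\<^sup>+z. ennreal \<bar>c n z\<bar> * ennreal (\<bar>b (x - v z)\<bar> powr q) \<partial>M) \<partial>lborel)"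
      by (rule nn_integral_cmult) measurable
    also have "(\<integral>\<^sup>+x. (\<integral>\<^sup>+z. ennreal \<bar>c n z\<bar> * ennreal (\<bar>b (x - v z)\<bar> powr q) \<partial>M) \<partial>lborel)
        = ennreal (An n) * (\<integral>\<^sup>+y. ennreal (\<bar>b y\<bar> powr q) \<partial>lborel)"
      unfolding An[symmetric] by (rule nn_integral_weighted_shift[OF M, where F = "\<lambda>y. ennreal (\<bar>b y\<bar> powr q)"]) measurable
    also have "ennreal (An n powr (q - 1)) * (ennreal (An n) * (\<integral>\<^sup>+y. ennreal (\<bar>b y\<bar> powr q) \<partial>lborel))
        \<le> ennreal (An n powr (q - 1)) * (ennreal (An n) * ennreal ((m / R powr \<alpha>) powr q))"
      using R(3) by (intro mult_left_mono) auto
    also have "\<dots> = ennreal (An n powr (q - 1) * An n * (m / R powr \<alpha>) powr q)"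
      using An0[of n] by (simp add: ennreal_mult[symmetric] mult.assoc)
    \<comment> \<open>The factor \<open>2 powr \<alpha>\<close> in the size cancels the one in
      \<open>(2 * R) powr \<alpha>\<close>.\<close>
    also have "An n powr (q - 1) * An n * (m / R powr \<alpha>) powr q = (2 powr \<alpha> * m * An n / (2 * R) powr \<alpha>) powr q"
    proof -
      have "An n powr (q - 1) * An n = An n powr q"
        using An0[of n] by (cases "An n = 0") (auto simp: powr_diff)
      moreover have "2 powr \<alpha> * m * An n / (2 * R) powr \<alpha> = An n * (m / R powr \<alpha>)"
        using R(1) by (simp add: powr_mult)
      ultimately show ?thesis using An0[of n] m by (simp add: powr_mult powr_divide)
    qed
    finally show ?thesis
      unfolding mol_def using R(1) m An0[of n] zero
      by (intro conjI exI[of _ "x0 + d n"] exI[of _ "2 * R"]) (auto split: split_indicator)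
  qed
  have H: "Hle (\<lambda>x. \<Sum>n. indicator \<Omega> x * p n x) (\<Sum>n. 2 powr \<alpha> * m * An n)"
    using Asum by (intro Hle_suminf Hle_mol mol_p summable_mult)
  \<comment> \<open>The pieces must still be shown to add up to the average. The exchange of sum and
    integral rests on the L1 bound of b.\<close>
  have "AE x in lborel. (\<lambda>n. \<integral>z. c n z * b (x - v z) \<partial>M) sums (\<integral>z. a z * b (x - v z) \<partial>M)"
  proof (rule AE_sums_section[OF M])
    show "(\<lambda>(x, z). c n z * b (x - v z)) \<in> borel_measurable (borel \<Otimes>\<^sub>M M)" for n by measurable
    show "a z * b (x - v z) = (\<Sum>n. c n z * b (x - v z))" for z x
      using one[of "v z" "a z * b (x - v z)"] by (simp add: c_def sums_iff mult.assoc)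
    have "(\<Sum>n. \<integral>\<^sup>+x. (\<integral>\<^sup>+z. ennreal \<bar>c n z * b (x - v z)\<bar> \<partial>M) \<partial>lborel)
        = (\<Sum>n. \<integral>\<^sup>+x. (\<integral>\<^sup>+z. ennreal \<bar>c n z\<bar> * ennreal \<bar>b (x - v z)\<bar> \<partial>M) \<partial>lborel)"
      by (simp add: abs_mult ennreal_mult)
    also have "\<dots> = (\<Sum>n. (\<integral>\<^sup>+z. ennreal \<bar>c n z\<bar> \<partial>M) * (\<integral>\<^sup>+y. ennreal \<bar>b y\<bar> \<partial>lborel))"
      by (subst nn_integral_weighted_shift[OF M, where F = "\<lambda>y. ennreal \<bar>b y\<bar>"]) auto
    also have "\<dots> = (\<Sum>n. \<integral>\<^sup>+z. ennreal \<bar>c n z\<bar> \<partial>M) * (\<integral>\<^sup>+y. ennreal \<bar>b y\<bar> \<partial>lborel)"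
      by (rule ennreal_suminf_multc)
    also have "\<dots> \<le> ennreal A * ennreal (L1_const * m)"
      by (rule mult_mono[OF cfin mol_L1[OF assms]]) auto
    also have "\<dots> < \<infinity>" by (simp add: ennreal_mult_less_top)
    finally show "(\<Sum>n. \<integral>\<^sup>+x. (\<integral>\<^sup>+z. ennreal \<bar>c n z * b (x - v z)\<bar> \<partial>M) \<partial>lborel) < \<infinity>" .
  qed measurable
  then have eq: "AE x in lborel. x \<in> \<Omega> \<longrightarrow> (\<Sum>n. indicator \<Omega> x * p n x) = (\<integral>z. a z * b (x - v z) \<partial>M)"
    by eventually_elim (auto simp: p_def sums_iff)
  have "(\<Sum>n. 2 powr \<alpha> * m * An n) = 2 powr \<alpha> * m * suminf An" using Asum by (intro suminf_mult)
  also have "\<dots> \<le> 2 powr \<alpha> * m * A" using Asum m by (intro mult_left_mono) auto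
  finally show ?thesis using Hle_cong[OF H eq] by (simp add: mult_ac)
qed

text \<open>Averaging acts molecule by molecule. The L1 bounds of the series justify exchanging the
  sum with the integral for almost every x.\<close>

lemma Hle_average:
  assumes mol: "\<And>k. mol (b k) (s k)" and s: "summable s"
  shows "Hle (\<lambda>x. \<integral>z. a z * (\<Sum>k. b k (x - v z)) \<partial>M) (2 powr \<alpha> * A * suminf s)"
proof -
  interpret M: sigma_finite_measure M by (rule M)
  have [measurable]: "b k \<in> borel_measurable borel" for k using mol mol_measurable by blast
  have H: "Hle (\<lambda>x. \<Sum>k. \<integral>z. a z * b k (x - v z) \<partial>M) (\<Sum>k. 2 powr \<alpha> * A * s k)"
    using s by (intro Hle_suminf Hle_average_mol mol summable_mult)
  have "AE x in lborel. (\<lambda>k. \<integral>z. a z * b k (x - v z) \<partial>M) sums (\<integral>z. a z * (\<Sum>k. b k (x - v z)) \<partial>M)"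
  proof (rule AE_sums_section[OF M])
    show "(\<lambda>(x, z). a z * b k (x - v z)) \<in> borel_measurable (borel \<Otimes>\<^sub>M M)" for k by measurable
    show "a z * (\<Sum>k. b k (x - v z)) = (\<Sum>k. a z * b k (x - v z))"
      if "summable (\<lambda>k. \<bar>a z * b k (x - v z)\<bar>)" for z x
    \<comment> \<open>For \<open>a z = 0\<close> the series of the \<open>b k\<close> may diverge,
      but both sides are 0 whatever value \<open>suminf\<close> then takes.\<close>
    proof (cases "a z = 0")
      case False
      from summable_rabs_cancel[OF that] False have "summable (\<lambda>k. b k (x - v z))"
        by (simp add: summable_cmult_iff)
      then show ?thesis by (simp add: suminf_mult)
    qed simp
    have "(\<Sum>k. \<integral>\<^sup>+x. (\<integral>\<^sup>+z. ennreal \<bar>a z * b k (x - v z)\<bar> \<partial>M) \<partial>lborel)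
        = (\<Sum>k. \<integral>\<^sup>+x. (\<integral>\<^sup>+z. ennreal \<bar>a z\<bar> * ennreal \<bar>b k (x - v z)\<bar> \<partial>M) \<partial>lborel)"
      by (simp add: abs_mult ennreal_mult)
    also have "\<dots> = (\<Sum>k. (\<integral>\<^sup>+z. ennreal \<bar>a z\<bar> \<partial>M) * (\<integral>\<^sup>+y. ennreal \<bar>b k y\<bar> \<partial>lborel))"
      by (subst nn_integral_weighted_shift[OF M, where F = "\<lambda>y. ennreal \<bar>b _ y\<bar>"]) auto
    also have "\<dots> = (\<integral>\<^sup>+z. ennreal \<bar>a z\<bar> \<partial>M) * (\<Sum>k. \<integral>\<^sup>+y. ennreal \<bar>b k y\<bar> \<partial>lborel)"
      by (rule ennreal_suminf_cmult)
    also have "\<dots> \<le> ennreal A * ennreal (L1_const * suminf s)"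
      by (rule mult_mono[OF A mol_suminf_nn[OF mol s]]) auto
    also have "\<dots> < \<infinity>" by (simp add: ennreal_mult_less_top)
    finally show "(\<Sum>k. \<integral>\<^sup>+x. (\<integral>\<^sup>+z. ennreal \<bar>a z * b k (x - v z)\<bar> \<partial>M) \<partial>lborel) < \<infinity>" .
  qed measurable
  then have "AE x in lborel. x \<in> \<Omega> \<longrightarrow>
      (\<Sum>k. \<integral>z. a z * b k (x - v z) \<partial>M) = (\<integral>z. a z * (\<Sum>k. b k (x - v z)) \<partial>M)"
    by eventually_elim (auto simp: sums_iff)
  then show ?thesis
    by (rule Hle_cong[OF H]) (use s in \<open>simp add: suminf_mult\<close>)
qed

end

end

section \<open>Blocks and molecules\<close>

context block_domain
begin

text \<open>A block needs its centre in \<Omega>. If the ball of the molecule meets \<Omega>, it is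
  contained in the ball of twice the radius around any common point, and the coefficient absorbs the
  factor \<open>2 powr \<alpha>\<close>.\<close>

lemma mol_imp_block:
  assumes mol: "mol b m" and w0: "w0 \<in> \<Omega>" and lam: "\<alpha> = lam / conj_exp q"
  obtains c \<phi> where "is_block \<Omega> q lam \<phi>" "\<bar>c\<bar> \<le> 2 powr \<alpha> * m"
    "AE y in lborel. y \<in> \<Omega> \<longrightarrow> c * \<phi> y = b y"
proof -
  obtain x R where R: "R > 0" "\<forall>y. y \<notin> \<Omega> \<inter> ball x R \<longrightarrow> b y = 0"
    "(\<integral>\<^sup>+y. ennreal (\<bar>b y\<bar> powr q) \<partial>lborel) \<le> ennreal ((m / R powr \<alpha>) powr q)"
    and [measurable]: "b \<in> borel_measurable borel" and m: "0 \<le> m" using mol unfolding mol_def by blast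
  show thesis
  \<comment> \<open>In the degenerate cases b vanishes almost everywhere, and the zero block centred
    at w0 with coefficient 0 represents it.\<close>
  proof (cases "m = 0 \<or> \<Omega> \<inter> ball x R = {}")
    case True
    have "AE y in lborel. b y = 0"
    proof (cases "m = 0")
      case True
      then have "(\<integral>\<^sup>+y. ennreal (\<bar>b y\<bar> powr q) \<partial>lborel) = 0" using R(3) by simp
      then have "AE y in lborel. ennreal (\<bar>b y\<bar> powr q) = 0" by (subst (asm) nn_integral_0_iff_AE) auto
      then show ?thesis by eventually_elim (simp add: ennreal_eq_0_iff)
    next
      case False
      then have "b y = 0" for y using R(2) True by blast
      then show ?thesis by simp
    qed
    then have AEb: "AE y in lborel. y \<in> \<Omega> \<longrightarrow> 0 * (0::real) = b y" by eventually_elim auto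
    have "is_block \<Omega> q lam (\<lambda>y. 0)"
      unfolding is_block_def using w0 by (auto intro!: exI[of _ w0] exI[of _ 1] simp: Lq_norm_def)
    then show thesis using that[of "\<lambda>y. 0" 0] m AEb by simp
  next
    case False
    then obtain w where w: "w \<in> \<Omega>" "w \<in> ball x R" and m: "m > 0" using m by auto
    define c where "c = 2 powr \<alpha> * m"
    have c: "c > 0" using m by (simp add: c_def)
    define \<phi> where "\<phi> y = b y / c" for y
    have [measurable]: "\<phi> \<in> borel_measurable borel" unfolding \<phi>_def by measurable
    have sub: "ball x R \<subseteq> ball w (2 * R)"
    proof
      fix y assume "y \<in> ball x R"
      then have "dist x y < R" "dist x w < R" using w by auto
      then show "y \<in> ball w (2 * R)" using dist_triangle[of w y x] by (simp add: dist_commute)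
    qed
    let ?I = "\<integral>\<^sup>+ y\<in>OmegaR \<Omega> w (2 * R). ennreal (\<bar>\<phi> y\<bar> powr q) \<partial>lebesgue"
    have I: "?I \<le> ennreal (((2 * R) powr (- \<alpha>)) powr q)"
    proof -
      have "?I \<le> (\<integral>\<^sup>+ y. ennreal (\<bar>\<phi> y\<bar> powr q) \<partial>lborel)"
        unfolding nn_integral_completion by (intro nn_integral_mono) (auto split: split_indicator)
      also have "\<dots> = (\<integral>\<^sup>+ y. ennreal (1 / c powr q) * ennreal (\<bar>b y\<bar> powr q) \<partial>lborel)"
        using c by (intro nn_integral_cong) (simp add: \<phi>_def powr_divide ennreal_mult[symmetric])
      also have "\<dots> = ennreal (1 / c powr q) * (\<integral>\<^sup>+ y. ennreal (\<bar>b y\<bar> powr q) \<partial>lborel)"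
        by (rule nn_integral_cmult) measurable
      also have "\<dots> \<le> ennreal (1 / c powr q) * ennreal ((m / R powr \<alpha>) powr q)"
        using R(3) by (intro mult_left_mono) auto
      also have "\<dots> = ennreal (((m / R powr \<alpha>) / c) powr q)"
        using c m by (simp add: ennreal_mult[symmetric] powr_divide powr_mult mult.commute)
      also have "(m / R powr \<alpha>) / c = (2 * R) powr (- \<alpha>)"
        using m R(1) by (simp add: c_def powr_mult powr_minus field_simps)
      finally show ?thesis .
    qed
    have "is_block \<Omega> q lam \<phi>"
      unfolding is_block_def
    proof (intro conjI exI[of _ w] exI[of _ "2 * R"])
      show "\<phi> \<in> borel_measurable lebesgue" by (intro measurable_completion) simp
      show "\<forall>y. y \<notin> closure (OmegaR \<Omega> w (2 * R)) \<longrightarrow> \<phi> y = 0"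
      proof (intro allI impI)
        fix y assume "y \<notin> closure (OmegaR \<Omega> w (2 * R))"
        then have "y \<notin> OmegaR \<Omega> w (2 * R)" using closure_subset by blast
        then have "y \<notin> \<Omega> \<inter> ball x R" using sub by (auto simp: OmegaR_def)
        then show "\<phi> y = 0" using R(2) by (simp add: \<phi>_def)
      qed
      show "?I < \<infinity>" using I le_less_trans[OF I ennreal_less_top] by simp
      have "enn2real ?I \<le> ((2 * R) powr (- \<alpha>)) powr q"
        using I by (intro enn2real_leI) auto
      then have "Lq_norm q (OmegaR \<Omega> w (2 * R)) \<phi> \<le> (((2 * R) powr (- \<alpha>)) powr q) powr (1 / q)"
        unfolding Lq_norm_def using q_gt_1 by (intro powr_mono2) auto
      also have "\<dots> = (2 * R) powr (- \<alpha>)" using q_gt_1 R(1) by (simp add: powr_powr)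
      finally have "(2 * R) powr \<alpha> * Lq_norm q (OmegaR \<Omega> w (2 * R)) \<phi> \<le> (2 * R) powr \<alpha> * (2 * R) powr (- \<alpha>)"
        by (intro mult_left_mono) auto
      also have "\<dots> = 1" using R(1) by (simp add: powr_minus)
      finally show "(2 * R) powr (lam / conj_exp q) * Lq_norm q (OmegaR \<Omega> w (2 * R)) \<phi> \<le> 1"
        unfolding lam .
    qed (use w R(1) in auto)
    moreover have "c * \<phi> y = b y" for y using c by (simp add: \<phi>_def)
    ultimately show thesis using that[of \<phi> c] c by (simp add: c_def)
  qed
qed

lemma Hle_imp_H:
  assumes f: "Hle f C" and ne: "\<Omega> \<noteq> {}" and lam: "\<alpha> = lam / conj_exp q"
  shows Hle_imp_H_space: "f \<in> H_space \<Omega> q lam"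
    and Hle_imp_H_norm_le: "H_norm \<Omega> q lam f \<le> 2 powr \<alpha> * C"
    and Hle_imp_H_norm_nonneg: "0 \<le> H_norm \<Omega> q lam f"
proof -
  obtain b m where bm: "\<And>k. mol (b k) (m k)" "summable m" "suminf m \<le> C"
    and AEb: "AE y in lborel. y \<in> \<Omega> \<longrightarrow> (\<lambda>k. b k y) sums f y"
    using f unfolding Hle_def by blast
  obtain w0 where w0: "w0 \<in> \<Omega>" using ne by blast
  have "\<forall>k. \<exists>c \<phi>. is_block \<Omega> q lam \<phi> \<and> \<bar>c\<bar> \<le> 2 powr \<alpha> * m k \<and>
    (AE y in lborel. y \<in> \<Omega> \<longrightarrow> c * \<phi> y = b k y)"
    using mol_imp_block[OF bm(1) w0 lam] by blast
  from choice[OF this] obtain c where "\<forall>k. \<exists>\<phi>. is_block \<Omega> q lam \<phi> \<and> \<bar>c k\<bar> \<le> 2 powr \<alpha> * m k \<and>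
    (AE y in lborel. y \<in> \<Omega> \<longrightarrow> c k * \<phi> y = b k y)" by blast
  from choice[OF this] obtain \<phi> where \<phi>: "\<And>k. is_block \<Omega> q lam (\<phi> k)" "\<And>k. \<bar>c k\<bar> \<le> 2 powr \<alpha> * m k"
    and AE\<phi>: "\<And>k. AE y in lborel. y \<in> \<Omega> \<longrightarrow> c k * \<phi> k y = b k y" by blast
  have sm: "summable (\<lambda>k. 2 powr \<alpha> * m k)" using bm(2) by (rule summable_mult)
  have smc: "summable (\<lambda>k. \<bar>c k\<bar>)"
    by (rule summable_comparison_test'[OF sm, of 0]) (use \<phi>(2) in auto)
  have "AE y in lborel. \<forall>k. y \<in> \<Omega> \<longrightarrow> c k * \<phi> k y = b k y"
    using AE\<phi> by (subst AE_all_countable) auto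
  then have "AE y in lborel. y \<in> \<Omega> \<longrightarrow> (\<lambda>k. c k * \<phi> k y) sums f y"
    using AEb by eventually_elim auto
  then have rep: "block_rep \<Omega> q lam f c \<phi>"
    unfolding block_rep_def using smc \<phi>(1) by (simp add: AE_completion_iff)
  then show "f \<in> H_space \<Omega> q lam" unfolding H_space_def by blast
  define S where "S = {(\<Sum>k. \<bar>c k\<bar>) | c \<phi>. block_rep \<Omega> q lam f c \<phi>}"
  have norm: "H_norm \<Omega> q lam f = Inf S" by (simp add: H_norm_def S_def)
  have inS: "(\<Sum>k. \<bar>c k\<bar>) \<in> S" unfolding S_def using rep by blast
  have nn: "0 \<le> s" if "s \<in> S" for s
    using that by (auto simp: S_def block_rep_def intro!: suminf_nonneg)
  show "0 \<le> H_norm \<Omega> q lam f"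
    unfolding norm using inS nn by (intro cInf_greatest) auto
  have "H_norm \<Omega> q lam f \<le> (\<Sum>k. \<bar>c k\<bar>)"
    unfolding norm using inS nn by (intro cInf_lower bdd_belowI[of _ 0])
  also have "\<dots> \<le> (\<Sum>k. 2 powr \<alpha> * m k)" using \<phi>(2) smc sm by (rule suminf_le)
  also have "\<dots> = 2 powr \<alpha> * suminf m" using bm(2) by (rule suminf_mult)
  also have "\<dots> \<le> 2 powr \<alpha> * C" using bm(3) by (intro mult_left_mono) auto
  finally show "H_norm \<Omega> q lam f \<le> 2 powr \<alpha> * C" .
qed

text \<open>Two repairs on null sets: a Lebesgue measurable block gets a Borel version, and it is
  cut down from the closure of \<Omega> \<inter> B(x,R) to the set itself, on which its norm is
  measured. Inside \<Omega> the two differ only on a sphere.\<close>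

lemma block_imp_mol:
  assumes bl: "is_block \<Omega> q lam \<rho>" and lam: "\<alpha> = lam / conj_exp q"
  obtains b where "mol b 1" "AE y in lborel. y \<in> \<Omega> \<longrightarrow> b y = \<rho> y"
proof -
  obtain x R where [measurable]: "\<rho> \<in> borel_measurable lebesgue" and R: "R > 0"
    and supp: "\<And>y. y \<notin> closure (OmegaR \<Omega> x R) \<Longrightarrow> \<rho> y = 0"
    and fin: "(\<integral>\<^sup>+ y\<in>OmegaR \<Omega> x R. ennreal (\<bar>\<rho> y\<bar> powr q) \<partial>lebesgue) < \<infinity>"
    and le: "R powr \<alpha> * Lq_norm q (OmegaR \<Omega> x R) \<rho> \<le> 1"
    using bl unfolding is_block_def lam by blast
  let ?S = "OmegaR \<Omega> x R"
  have [measurable]: "?S \<in> sets borel" by (simp add: OmegaR_def)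
  obtain g where g [measurable]: "g \<in> borel_measurable lborel" and AEg: "AE y in lborel. \<rho> y = g y"
    using completion_ex_borel_measurable_real[of \<rho> lborel] by auto
  define b where "b y = indicator ?S y * g y" for y
  have [measurable]: "b \<in> borel_measurable borel" unfolding b_def using g by simp
  define I where "I = (\<integral>\<^sup>+ y\<in>?S. ennreal (\<bar>\<rho> y\<bar> powr q) \<partial>lebesgue)"
  have "(\<integral>\<^sup>+ y. ennreal (\<bar>b y\<bar> powr q) \<partial>lborel) = I"
    unfolding I_def nn_integral_completion
    by (intro nn_integral_cong_AE) (use AEg in \<open>eventually_elim, auto simp: b_def split: split_indicator\<close>)
  also have "I \<le> ennreal ((1 / R powr \<alpha>) powr q)"
  proof -
    have I: "I = ennreal (enn2real I)" using fin by (simp add: I_def ennreal_enn2real)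
    have "(enn2real I) powr (1 / q) \<le> 1 / R powr \<alpha>"
      using le R by (simp add: Lq_norm_def I_def field_simps)
    then have "((enn2real I) powr (1 / q)) powr q \<le> (1 / R powr \<alpha>) powr q"
      using q_gt_1 by (intro powr_mono2) auto
    then have "enn2real I \<le> (1 / R powr \<alpha>) powr q" using q_gt_1 by (simp add: powr_powr)
    then show ?thesis by (subst I) (rule ennreal_leI)
  qed
  finally have "mol b 1"
    unfolding mol_def using R
    by (intro conjI exI[of _ x] exI[of _ R]) (auto simp: b_def OmegaR_def split: split_indicator)
  moreover have "AE y in lborel. y \<in> \<Omega> \<longrightarrow> b y = \<rho> y"
  proof -
    have "AE y in lborel. y \<notin> sphere x R"
      using negligible_sphere[of x R]
      by (intro AE_not_in) (auto simp: negligible_iff_null_sets null_sets_completion_iff)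
    then show ?thesis using AEg
    proof eventually_elim
      case (elim y)
      show ?case
      proof (cases "y \<in> ball x R")
        case True
        then show ?thesis using elim by (auto simp: b_def OmegaR_def)
      next
        case False
        have "closure ?S \<subseteq> cball x R"
          by (rule closure_minimal) (auto simp: OmegaR_def)
        then have "\<rho> y = 0" using False elim(1) by (intro supp) auto
        then show ?thesis using False by (auto simp: b_def OmegaR_def)
      qed
    qed
  qed
  ultimately show thesis using that by blast
qed

text \<open>The infimum defining the norm need not be attained; the additional 1 leaves room for an
  actual representation.\<close>

lemma H_imp_Hle:
  assumes f: "f \<in> H_space \<Omega> q lam" "H_norm \<Omega> q lam f \<le> B" and lam: "\<alpha> = lam / conj_exp q"
  shows "Hle f (B + 1)"
proof -
  define S where "S = {(\<Sum>k. \<bar>c k\<bar>) | c \<phi>. block_rep \<Omega> q lam f c \<phi>}"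
  have ne: "S \<noteq> {}" using f(1) unfolding H_space_def S_def by blast
  have bb: "bdd_below S"
    by (rule bdd_belowI[of _ 0]) (auto simp: S_def block_rep_def intro!: suminf_nonneg)
  have "Inf S < B + 1" using f(2) unfolding H_norm_def S_def by linarith
  then obtain s where "s \<in> S" "s < B + 1" using cInf_less_iff[OF ne bb] by blast
  then obtain c \<phi> where rep: "block_rep \<Omega> q lam f c \<phi>" and s: "(\<Sum>k. \<bar>c k\<bar>) < B + 1"
    unfolding S_def by blast
  have "\<forall>k. \<exists>b. mol b 1 \<and> (AE y in lborel. y \<in> \<Omega> \<longrightarrow> b y = \<phi> k y)"
    using rep block_imp_mol[OF _ lam] unfolding block_rep_def by blast
  from choice[OF this] obtain b where b: "\<And>k. mol (b k) 1"
    and AEb: "\<And>k. AE y in lborel. y \<in> \<Omega> \<longrightarrow> b k y = \<phi> k y" by blast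
  have "AE y in lborel. \<forall>k. y \<in> \<Omega> \<longrightarrow> b k y = \<phi> k y"
    using AEb by (subst AE_all_countable) auto
  moreover have "AE y in lborel. y \<in> \<Omega> \<longrightarrow> (\<lambda>k. c k * \<phi> k y) sums f y"
    using rep by (simp add: block_rep_def AE_completion_iff)
  ultimately have "AE y in lborel. y \<in> \<Omega> \<longrightarrow> (\<lambda>k. c k * b k y) sums f y"
    by eventually_elim auto
  moreover have "mol (\<lambda>x. c k * b k x) \<bar>c k\<bar>" for k
    using mol_scale[OF b, of "c k" k] by simp
  ultimately show ?thesis
    unfolding Hle_def using rep s
    by (intro exI[of _ "\<lambda>k x. c k * b k x"] exI[of _ "\<lambda>k. \<bar>c k\<bar>"]) (auto simp: block_rep_def)
qed

end

section \<open>Averages of weakly differentiable functions\<close>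

lemma integral_lborel_shift:
  fixes F :: "'a::euclidean_space \<Rightarrow> real"
  assumes [measurable]: "F \<in> borel_measurable borel"
  shows "(\<integral>x. F (x + c) \<partial>lborel) = (\<integral>x. F x \<partial>lborel)"
proof -
  have "(\<integral>x. F x \<partial>lborel) = (\<integral>x. F x \<partial>distr lborel borel ((+) c))"
    by (simp add: lborel_distr_plus)
  also have "\<dots> = (\<integral>x. F (x + c) \<partial>lborel)"
    by (subst integral_distr) (auto simp: add.commute)
  finally show ?thesis by simp
qed

text \<open>By Fubini and translation invariance the shift moves from f to the test function.
  Integrability of the weight times the translate on the product space is the one estimate behind
  both claims.\<close>

lemma average_duality:
  fixes f \<psi> :: "'a::euclidean_space \<Rightarrow> real" and a :: "'z \<Rightarrow> real"
  assumes M: "sigma_finite_measure M" and a: "integrable M a" and v [measurable]: "v \<in> borel_measurable M"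
    and f: "integrable lborel f"
  shows integrable_average: "integrable lborel (\<lambda>x. \<integral>z. a z * f (x - v z) \<partial>M)"
    and integral_average_test: "\<psi> \<in> borel_measurable borel \<Longrightarrow> (\<And>x. \<bar>\<psi> x\<bar> \<le> 1) \<Longrightarrow>
      (\<integral>x. \<psi> x * (\<integral>z. a z * f (x - v z) \<partial>M) \<partial>lborel)
        = (\<integral>z. a z * (\<integral>y. \<psi> (y + v z) * f y \<partial>lborel) \<partial>M)"
proof -
  interpret M: sigma_finite_measure M by fact
  interpret P: pair_sigma_finite lborel M ..
  have [measurable]: "f \<in> borel_measurable borel" "a \<in> borel_measurable M" using f a by auto
  have J: "integrable (lborel \<Otimes>\<^sub>M M) (\<lambda>(x, z). a z * f (x - v z))"
  proof (rule integrableI_bounded)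
    have "(\<integral>\<^sup>+p. ennreal (norm (case p of (x, z) \<Rightarrow> a z * f (x - v z))) \<partial>(lborel \<Otimes>\<^sub>M M))
       = (\<integral>\<^sup>+x. (\<integral>\<^sup>+z. ennreal \<bar>a z * f (x - v z)\<bar> \<partial>M) \<partial>lborel)"
      by (subst M.nn_integral_fst[symmetric]) auto
    also have "\<dots> = (\<integral>\<^sup>+x. (\<integral>\<^sup>+z. ennreal \<bar>a z\<bar> * ennreal \<bar>f (x - v z)\<bar> \<partial>M) \<partial>lborel)"
      by (simp add: abs_mult ennreal_mult)
    also have "\<dots> = (\<integral>\<^sup>+z. ennreal \<bar>a z\<bar> \<partial>M) * (\<integral>\<^sup>+y. ennreal \<bar>f y\<bar> \<partial>lborel)"
      by (rule nn_integral_weighted_shift[OF M, where F = "\<lambda>y. ennreal \<bar>f y\<bar>"]) measurable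
    also have "\<dots> < \<infinity>"
      using a f by (auto simp: integrable_iff_bounded ennreal_mult_less_top)
    finally show "(\<integral>\<^sup>+p. ennreal (norm (case p of (x, z) \<Rightarrow> a z * f (x - v z))) \<partial>(lborel \<Otimes>\<^sub>M M)) < \<infinity>" .
  qed measurable
  from P.integrable_fst'[OF J] show "integrable lborel (\<lambda>x. \<integral>z. a z * f (x - v z) \<partial>M)" by simp
  assume [measurable]: "\<psi> \<in> borel_measurable borel" and \<psi>: "\<And>x. \<bar>\<psi> x\<bar> \<le> 1"
  have J': "integrable (lborel \<Otimes>\<^sub>M M) (\<lambda>(x, z). \<psi> x * (a z * f (x - v z)))"
  proof (rule Bochner_Integration.integrable_bound[OF J])
    show "AE p in lborel \<Otimes>\<^sub>M M. norm (case p of (x, z) \<Rightarrow> \<psi> x * (a z * f (x - v z)))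
        \<le> norm (case p of (x, z) \<Rightarrow> a z * f (x - v z))"
      using \<psi> by (intro AE_I2) (auto simp: abs_mult intro!: mult_left_le_one_le)
  qed measurable
  have "(\<integral>x. \<psi> x * (\<integral>z. a z * f (x - v z) \<partial>M) \<partial>lborel) = (\<integral>x. (\<integral>z. \<psi> x * (a z * f (x - v z)) \<partial>M) \<partial>lborel)"
    by simp
  also have "\<dots> = (\<integral>z. (\<integral>x. \<psi> x * (a z * f (x - v z)) \<partial>lborel) \<partial>M)"
    by (rule P.Fubini_integral[OF J', symmetric])
  also have "\<dots> = (\<integral>z. a z * (\<integral>y. \<psi> (y + v z) * f y \<partial>lborel) \<partial>M)"
  proof (rule Bochner_Integration.integral_cong[OF refl])
    fix z
    have "(\<integral>x. \<psi> x * (a z * f (x - v z)) \<partial>lborel) = a z * (\<integral>x. \<psi> x * f (x - v z) \<partial>lborel)"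
      by (subst integral_mult_right_zero[symmetric]) (simp add: mult.left_commute)
    also have "(\<integral>x. \<psi> x * f (x - v z) \<partial>lborel) = (\<integral>y. \<psi> (y + v z) * f y \<partial>lborel)"
      using integral_lborel_shift[of "\<lambda>x. \<psi> x * f (x - v z)" "v z"] by simp
    finally show "(\<integral>x. \<psi> x * (a z * f (x - v z)) \<partial>lborel) = a z * (\<integral>y. \<psi> (y + v z) * f y \<partial>lborel)" .
  qed
  finally show "(\<integral>x. \<psi> x * (\<integral>z. a z * f (x - v z) \<partial>M) \<partial>lborel)
        = (\<integral>z. a z * (\<integral>y. \<psi> (y + v z) * f y \<partial>lborel) \<partial>M)" .
qed

text \<open>Weak differentiability in the form the averaging argument uses: f and its partials are
  Borel functions integrable over the whole space, and the test functions are box cutoffs inside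
  \<Omega>.\<close>

definition weak_partials :: "'a::euclidean_space set \<Rightarrow> ('a \<Rightarrow> real) \<Rightarrow> ('a \<Rightarrow> 'a \<Rightarrow> real) \<Rightarrow> bool" where
  "weak_partials \<Omega> f g \<longleftrightarrow>
     integrable lborel f \<and> (\<forall>i\<in>Basis. integrable lborel (g i)) \<and>
     (\<forall>\<tau> a b. \<forall>i\<in>Basis. 0 < \<tau> \<and> box a b \<noteq> {} \<and> cbox a b \<subseteq> \<Omega> \<longrightarrow>
       (\<integral>x. f x * frechet_derivative (box_cutoff \<tau> a b) (at x) i \<partial>lborel)
         = - (\<integral>x. g i x * box_cutoff \<tau> a b x \<partial>lborel))"

text \<open>The formula \<open>f(x) - f(x - w) = \<integral> \<nabla>f(x - t w) \<bullet> w
  dt\<close> over [0,1], tested with \<psi>. After translation the difference falls on \<psi>, where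
  the fundamental theorem of calculus holds classically; Fubini and the definition of the weak
  partials then return the derivative to f.\<close>

lemma weak_partials_shift_test:
  fixes f :: "'a::euclidean_space \<Rightarrow> real"
  assumes wp: "weak_partials \<Omega> f g" and \<tau>: "0 < \<tau>" and ne: "box a b \<noteq> {}"
    and sub: "\<And>t x. t \<in> {0..1} \<Longrightarrow> x \<in> cbox a b \<Longrightarrow> x - t *\<^sub>R w \<in> \<Omega>"
  defines "\<psi> \<equiv> box_cutoff \<tau> a b"
  shows "(\<integral>y. \<psi> y * f y \<partial>lborel) - (\<integral>y. \<psi> (y + w) * f y \<partial>lborel)
    = (\<integral>t. indicator {0..1} t * (\<Sum>i\<in>Basis. (w \<bullet> i) * (\<integral>y. \<psi> (y + t *\<^sub>R w) * g i y \<partial>lborel)) \<partial>lborel)"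
proof -
  obtain d where d: "\<And>i x. i \<in> Basis \<Longrightarrow> frechet_derivative \<psi> (at x) i = d i x"
    and hd: "\<And>x. (\<psi> has_derivative (\<lambda>h. \<Sum>i\<in>Basis. (h \<bullet> i) * d i x)) (at x)"
    and dc: "\<And>i. i \<in> Basis \<Longrightarrow> continuous_on UNIV (d i)"
    and d0: "\<And>i x. x \<notin> box a b \<Longrightarrow> i \<in> Basis \<Longrightarrow> d i x = 0"
    unfolding \<psi>_def using box_cutoff_has_derivative_explicit[OF \<tau> ne] by blast
  have f: "integrable lborel f" and g: "\<And>i. i \<in> Basis \<Longrightarrow> integrable lborel (g i)"
    using wp unfolding weak_partials_def by blast+
  have [measurable]: "f \<in> borel_measurable borel" using f by auto
  have \<psi>c: "continuous_on UNIV \<psi>"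
    using hd by (intro has_derivative_continuous_on) (auto intro: has_derivative_at_withinI)
  define D where "D x = (\<Sum>i\<in>Basis. (w \<bullet> i) * d i x)" for x
  have Dc: "continuous_on UNIV D" unfolding D_def using dc by (intro continuous_intros) auto
  then have [measurable]: "D \<in> borel_measurable borel" by (rule borel_measurable_continuous_onI)
  have [measurable]: "\<psi> \<in> borel_measurable borel" using \<psi>c by (rule borel_measurable_continuous_onI)
  obtain K where K: "\<And>x. \<bar>D x\<bar> \<le> K"
  proof -
    have "bounded (D ` cbox a b)"
      using continuous_on_subset[OF Dc] by (intro compact_imp_bounded compact_continuous_image) auto
    then obtain K where K: "\<And>x. x \<in> cbox a b \<Longrightarrow> \<bar>D x\<bar> \<le> K" "K > 0"
      unfolding bounded_pos by auto
    have "\<bar>D x\<bar> \<le> K" for x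
    proof (cases "x \<in> cbox a b")
      case False
      then have "D x = 0" unfolding D_def using d0[of x] box_subset_cbox[of a b] by (intro sum.neutral) auto
      then show ?thesis using K by simp
    qed (use K in auto)
    then show thesis by (rule that)
  qed
  have J: "integrable (lborel \<Otimes>\<^sub>M lborel) (\<lambda>(t::real, y::'a). indicator {0..1} t * (D (y + t *\<^sub>R w) * f y))"
  proof (rule Bochner_Integration.integrable_bound)
    have "integrable (lborel :: real measure) (indicator {0..1} :: real \<Rightarrow> real)" by auto
    then have 1: "integrable (lborel :: real measure) (\<lambda>t. \<integral>y. \<bar>indicator {0..1} t * f y\<bar> \<partial>lborel)"
      by (simp add: abs_mult)
    show "integrable (lborel \<Otimes>\<^sub>M lborel) (\<lambda>(t::real, y::'a). K * (indicator {0..1} t * f y))"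
    proof -
      have "integrable (lborel \<Otimes>\<^sub>M lborel) (\<lambda>(t::real, y::'a). indicator {0..1} t * f y)"
        by (rule lborel_pair.Fubini_integrable) (use 1 f in auto)
      from integrable_mult_right[OF this, of K] show ?thesis by (simp add: case_prod_unfold)
    qed
    show "AE p in lborel \<Otimes>\<^sub>M lborel. norm (case p of (t::real, y) \<Rightarrow> indicator {0..1} t * (D (y + t *\<^sub>R w) * f y))
        \<le> norm (case p of (t, y) \<Rightarrow> K * (indicator {0..1} t * f y))"
    proof (intro AE_I2, clarify)
      fix t :: real and y :: 'a
      have "\<bar>D (y + t *\<^sub>R w)\<bar> * \<bar>indicator {0..1} t * f y\<bar> \<le> \<bar>K\<bar> * \<bar>indicator {0..1} t * f y\<bar>"
        using K[of "y + t *\<^sub>R w"] by (intro mult_right_mono) auto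
      then show "norm (indicator {0..1} t * (D (y + t *\<^sub>R w) * f y)) \<le> norm (K * (indicator {0..1} t * f y))"
        by (simp add: abs_mult mult_ac)
    qed
  qed measurable
  have ftc: "(\<integral>t. indicator {0..1} t * (D (y + t *\<^sub>R w) * f y) \<partial>lborel) = (\<psi> (y + w) - \<psi> y) * f y" for y
  proof -
    have der: "((\<lambda>t. \<psi> (y + t *\<^sub>R w)) has_real_derivative D (y + t *\<^sub>R w)) (at t)" for t
    proof -
      have "((\<lambda>t. y + t *\<^sub>R w) has_derivative (\<lambda>h. h *\<^sub>R w)) (at t)"
        by (auto intro!: derivative_eq_intros)
      from has_derivative_compose[OF this hd]
      have "((\<lambda>t. \<psi> (y + t *\<^sub>R w)) has_derivative (\<lambda>h. \<Sum>i\<in>Basis. ((h *\<^sub>R w) \<bullet> i) * d i (y + t *\<^sub>R w))) (at t)" .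
      moreover have "(\<lambda>h. \<Sum>i\<in>Basis. ((h *\<^sub>R w) \<bullet> i) * d i (y + t *\<^sub>R w)) = (*) (D (y + t *\<^sub>R w))"
        by (auto simp: D_def fun_eq_iff sum_distrib_right sum_distrib_left mult_ac)
      ultimately show ?thesis by (simp add: has_field_derivative_def)
    qed
    have cont: "isCont (\<lambda>t. D (y + t *\<^sub>R w)) t" for t
      using Dc by (intro continuous_at_compose[of t "\<lambda>t. y + t *\<^sub>R w" D, unfolded o_def] continuous_intros)
        (simp add: continuous_on_eq_continuous_at)
    have "(\<integral>t. indicator {0..1} t * (D (y + t *\<^sub>R w) * f y) \<partial>lborel)
        = (\<integral>t. (D (y + t *\<^sub>R w) * indicator {0..1} t) * f y \<partial>lborel)"
      by (simp add: mult_ac)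
    also have "\<dots> = (\<integral>t. D (y + t *\<^sub>R w) * indicator {0..1} t \<partial>lborel) * f y"
      by simp
    also have "(\<integral>t. D (y + t *\<^sub>R w) * indicator {0..1} t \<partial>lborel) = \<psi> (y + 1 *\<^sub>R w) - \<psi> (y + 0 *\<^sub>R w)"
      by (rule integral_FTC_Icc_real) (use der cont in auto)
    finally show ?thesis by simp
  qed
  \<comment> \<open>For fixed t the translate of \<psi> is the cutoff of the box moved by
    \<open>- t w\<close>. The hypothesis on segments puts this box inside \<Omega>, so it is an
    admissible test function.\<close>
  have inner: "(\<integral>y. indicator {0..1} t * (D (y + t *\<^sub>R w) * f y) \<partial>lborel)
      = - (indicator {0..1} t * (\<Sum>i\<in>Basis. (w \<bullet> i) * (\<integral>y. \<psi> (y + t *\<^sub>R w) * g i y \<partial>lborel)))" for t :: real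
  proof (cases "t \<in> {0..1}")
    case True
    define c where "c = t *\<^sub>R w"
    have eqs: "(\<lambda>y. \<psi> (y + c)) = box_cutoff \<tau> (a - c) (b - c)"
      by (simp add: \<psi>_def box_cutoff_shift)
    have bne: "box (a - c) (b - c) \<noteq> {}" using ne by (simp add: box_ne_empty inner_simps)
    have bsub: "cbox (a - c) (b - c) \<subseteq> \<Omega>"
    proof
      fix y assume "y \<in> cbox (a - c) (b - c)"
      then have "y + c \<in> cbox a b" by (auto simp: mem_box inner_simps algebra_simps)
      from sub[OF True this] show "y \<in> \<Omega>" by (simp add: c_def)
    qed
    have fd: "frechet_derivative (box_cutoff \<tau> (a - c) (b - c)) (at y) i = d i (y + c)" if "i \<in> Basis" for i y
    proof -
      have "((\<lambda>y. y + c) has_derivative (\<lambda>h. h)) (at y)" by (auto intro!: derivative_eq_intros)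
      from has_derivative_compose[OF this hd]
      have "((\<lambda>y. \<psi> (y + c)) has_derivative (\<lambda>h. \<Sum>i\<in>Basis. (h \<bullet> i) * d i (y + c))) (at y)" .
      then have "frechet_derivative (\<lambda>y. \<psi> (y + c)) (at y) = (\<lambda>h. \<Sum>i\<in>Basis. (h \<bullet> i) * d i (y + c))"
        by (rule frechet_derivative_at[symmetric])
      moreover have "frechet_derivative \<psi> (at (y + c)) = (\<lambda>h. \<Sum>i\<in>Basis. (h \<bullet> i) * d i (y + c))"
        using hd by (rule frechet_derivative_at[symmetric])
      ultimately show ?thesis using d[OF that, of "y + c"] by (simp add: eqs)
    qed
    have weak: "(\<integral>y. f y * d i (y + c) \<partial>lborel) = - (\<integral>y. \<psi> (y + c) * g i y \<partial>lborel)" if i: "i \<in> Basis" for i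
    proof -
      have "(\<integral>y. f y * frechet_derivative (box_cutoff \<tau> (a - c) (b - c)) (at y) i \<partial>lborel)
          = - (\<integral>y. g i y * box_cutoff \<tau> (a - c) (b - c) y \<partial>lborel)"
        using wp i \<tau> bne bsub unfolding weak_partials_def by blast
      then have "(\<integral>y. f y * d i (y + c) \<partial>lborel) = - (\<integral>y. g i y * box_cutoff \<tau> (a - c) (b - c) y \<partial>lborel)"
        by (simp only: fd[OF i])
      then show ?thesis unfolding eqs[symmetric] by (simp add: mult.commute)
    qed
    have di: "integrable lborel (\<lambda>y. d i (y + c) * f y)" if i: "i \<in> Basis" for i
    proof -
      have "bounded (d i ` cbox a b)"
        using continuous_on_subset[OF dc[OF i]] by (intro compact_imp_bounded compact_continuous_image) auto
      then obtain K where K: "\<And>x. x \<in> cbox a b \<Longrightarrow> \<bar>d i x\<bar> \<le> K" "K > 0"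
        unfolding bounded_pos by auto
      have Kx: "\<bar>d i x\<bar> \<le> \<bar>K\<bar>" for x
        using K d0[OF _ i, of x] box_subset_cbox[of a b] by (cases "x \<in> cbox a b") force+
      have [measurable]: "d i \<in> borel_measurable borel"
        using dc[OF i] by (rule borel_measurable_continuous_onI)
      show ?thesis
        by (rule Bochner_Integration.integrable_bound[OF integrable_mult_right[OF f, of K]])
           (use Kx in \<open>auto simp: abs_mult intro!: mult_right_mono\<close>)
    qed
    have "(\<integral>y. D (y + c) * f y \<partial>lborel) = (\<integral>y. (\<Sum>i\<in>Basis. (w \<bullet> i) * (d i (y + c) * f y)) \<partial>lborel)"
      by (simp add: D_def sum_distrib_right mult.assoc)
    also have "\<dots> = (\<Sum>i\<in>Basis. \<integral>y. (w \<bullet> i) * (d i (y + c) * f y) \<partial>lborel)"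
      by (rule Bochner_Integration.integral_sum) (use di in auto)
    also have "\<dots> = (\<Sum>i\<in>Basis. (w \<bullet> i) * (- (\<integral>y. \<psi> (y + c) * g i y \<partial>lborel)))"
      by (rule sum.cong[OF refl]) (use weak in \<open>simp add: mult.commute\<close>)
    also have "\<dots> = - (\<Sum>i\<in>Basis. (w \<bullet> i) * (\<integral>y. \<psi> (y + c) * g i y \<partial>lborel))"
      by (simp add: sum_negf)
    finally show ?thesis using True by (simp add: c_def)
  qed simp
  have bd1: "\<bar>\<psi> x\<bar> \<le> 1" for x unfolding \<psi>_def using abs_box_cutoff_le_1[OF \<tau>] .
  have i1: "integrable lborel (\<lambda>y. \<psi> (y + w) * f y)" "integrable lborel (\<lambda>y. \<psi> y * f y)"
    by (rule Bochner_Integration.integrable_bound[OF f];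
        use bd1 in \<open>auto simp: abs_mult intro!: mult_left_le_one_le\<close>)+
  have "(\<integral>y. \<psi> (y + w) * f y \<partial>lborel) - (\<integral>y. \<psi> y * f y \<partial>lborel)
      = (\<integral>y. (\<psi> (y + w) - \<psi> y) * f y \<partial>lborel)"
    using i1 by (simp add: left_diff_distrib)
  also have "\<dots> = (\<integral>y. (\<integral>t. indicator {0..1} t * (D (y + t *\<^sub>R w) * f y) \<partial>lborel) \<partial>lborel)"
    by (simp only: ftc)
  also have "\<dots> = (\<integral>t. (\<integral>y. indicator {0..1} t * (D (y + t *\<^sub>R w) * f y) \<partial>lborel) \<partial>lborel)"
    by (rule lborel_pair.Fubini_integral[OF J])
  also have "\<dots> = - (\<integral>t. indicator {0..1} t * (\<Sum>i\<in>Basis. (w \<bullet> i) * (\<integral>y. \<psi> (y + t *\<^sub>R w) * g i y \<partial>lborel)) \<partial>lborel)"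
    unfolding inner by simp
  finally show ?thesis by simp
qed

text \<open>The average of the segment formula over w with density \<eta>. The parameter is the pair
  z = (t, w) and the translation is by t w, so the right side is a sum of averages of translates to
  which the block norm bound applies.\<close>

lemma weak_partials_average_identity:
  fixes f :: "'a::euclidean_space \<Rightarrow> real" and \<eta> :: "'a \<Rightarrow> real"
  assumes wp: "weak_partials \<Omega> f g" and U: "open U"
    and \<eta>: "integrable lborel \<eta>" "(\<integral>w. \<eta> w \<partial>lborel) = 1" "\<And>w. \<eta> w \<noteq> 0 \<Longrightarrow> norm w \<le> \<rho>"
    and sub: "\<And>x w t. x \<in> U \<Longrightarrow> \<eta> w \<noteq> 0 \<Longrightarrow> t \<in> {0..1} \<Longrightarrow> x - t *\<^sub>R w \<in> \<Omega>"
  defines "a \<equiv> \<lambda>i z. indicator {0..1} (fst z) * (\<eta> (snd z) * (snd z \<bullet> i))"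
  shows "i \<in> Basis \<Longrightarrow> integrable (lborel :: (real \<times> 'a) measure) (a i)"
    and "AE x in lborel. x \<in> U \<longrightarrow>
      f x - (\<integral>w. \<eta> w * f (x - w) \<partial>lborel)
        = (\<Sum>i\<in>Basis. \<integral>z. a i z * g i (x - fst z *\<^sub>R snd z) \<partial>(lborel :: (real \<times> 'a) measure))"
proof -
  have f: "integrable lborel f" and g: "\<And>i. i \<in> Basis \<Longrightarrow> integrable lborel (g i)"
    using wp unfolding weak_partials_def by blast+
  have [measurable]: "f \<in> borel_measurable borel" "\<eta> \<in> borel_measurable borel" using f \<eta> by auto
  have [measurable]: "a i \<in> borel_measurable borel" for i
    unfolding a_def borel_prod[symmetric] by measurable
  have ai: "integrable (lborel :: (real \<times> 'a) measure) (a i)" if i: "i \<in> Basis" for i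
  proof -
    have 1: "integrable lborel (\<lambda>w. \<eta> w * (w \<bullet> i))"
    proof (rule Bochner_Integration.integrable_bound[OF integrable_mult_right[OF \<eta>(1), of \<rho>]])
      show "AE w in lborel. norm (\<eta> w * (w \<bullet> i)) \<le> norm (\<rho> * \<eta> w)"
      proof (intro AE_I2)
        fix w
        show "norm (\<eta> w * (w \<bullet> i)) \<le> norm (\<rho> * \<eta> w)"
        proof (cases "\<eta> w = 0")
          case False
          then have "\<bar>w \<bullet> i\<bar> \<le> \<bar>\<rho>\<bar>" using \<eta>(3)[OF False] Basis_le_norm[OF i, of w] by linarith
          then have "\<bar>w \<bullet> i\<bar> * \<bar>\<eta> w\<bar> \<le> \<bar>\<rho>\<bar> * \<bar>\<eta> w\<bar>" by (intro mult_right_mono) auto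
          then show ?thesis by (simp add: abs_mult mult.commute)
        qed simp
      qed
    qed measurable
    have "integrable (lborel :: real measure) (indicator {0..1} :: real \<Rightarrow> real)" by auto
    then have 2: "integrable (lborel :: real measure) (\<lambda>t. \<integral>w. norm (indicator {0..1} t * (\<eta> w * (w \<bullet> i))) \<partial>lborel)"
      by (simp add: abs_mult)
    have "integrable (lborel \<Otimes>\<^sub>M lborel) (\<lambda>(t::real, w). indicator {0..1} t * (\<eta> w * (w \<bullet> i)))"
      by (rule lborel_pair.Fubini_integrable) (use 1 2 in auto)
    then show ?thesis by (simp add: lborel_prod a_def case_prod_unfold)
  qed
  then show "i \<in> Basis \<Longrightarrow> integrable (lborel :: (real \<times> 'a) measure) (a i)" by simp
  define v :: "real \<times> 'a \<Rightarrow> 'a" where "v z = fst z *\<^sub>R snd z" for z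
  have [measurable]: "v \<in> borel_measurable borel"
    unfolding v_def borel_prod[symmetric] by measurable
  have sfl: "sigma_finite_measure (lborel :: (real \<times> 'a) measure)" "sigma_finite_measure (lborel :: 'a measure)"
    by (rule sigma_finite_lborel)+
  define T where "T x = (\<integral>w. \<eta> w * f (x - w) \<partial>lborel)" for x
  define S where "S i x = (\<integral>z. a i z * g i (x - v z) \<partial>(lborel :: (real \<times> 'a) measure))" for i x
  have Ti: "integrable lborel T"
    unfolding T_def using integrable_average[OF sfl(2) \<eta>(1) _ f, of "\<lambda>w. w"] by simp
  have Si: "integrable lborel (S i)" if "i \<in> Basis" for i
    unfolding S_def using integrable_average[OF sfl(1) ai[OF that] _ g[OF that], of v] by simp
  define h where "h x = f x - T x - (\<Sum>i\<in>Basis. S i x)" for x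
  have hi: "integrable lborel h"
    unfolding h_def using f Ti Si by (intro Bochner_Integration.integrable_diff Bochner_Integration.integrable_sum)
  have "AE x in lborel. x \<in> U \<longrightarrow> h x = 0"
  \<comment> \<open>The difference h of the two sides is integrable, so it is enough that its
    integral against every cutoff in U vanishes.\<close>
  proof (rule AE_zero_if_cutoff_integrals_zero[OF hi U])
    fix b c :: 'a and \<tau> :: real
    assume \<tau>: "0 < \<tau>" and ne: "box b c \<noteq> {}" and cU: "cbox b c \<subseteq> U"
    define \<psi> where "\<psi> = box_cutoff \<tau> b c"
    have [measurable]: "\<psi> \<in> borel_measurable borel"
      unfolding \<psi>_def box_cutoff_def cutoff_def by measurable
    have bd: "\<bar>\<psi> x\<bar> \<le> 1" for x unfolding \<psi>_def using abs_box_cutoff_le_1[OF \<tau>] .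
    have \<psi>i: "integrable lborel (\<lambda>x. \<psi> (x + y) * u x)" if u: "integrable lborel u" for u y
    proof (rule Bochner_Integration.integrable_bound[OF u])
      show "(\<lambda>x. \<psi> (x + y) * u x) \<in> borel_measurable lborel" using u by auto
      show "AE x in lborel. norm (\<psi> (x + y) * u x) \<le> norm (u x)"
        using bd by (intro AE_I2) (auto simp: abs_mult intro!: mult_left_le_one_le)
    qed
    have \<psi>le: "\<bar>\<integral>x. \<psi> (x + y) * u x \<partial>lborel\<bar> \<le> (\<integral>x. \<bar>u x\<bar> \<partial>lborel)" if u: "integrable lborel u" for u y
    proof -
      have "\<bar>\<integral>x. \<psi> (x + y) * u x \<partial>lborel\<bar> \<le> (\<integral>x. \<bar>\<psi> (x + y) * u x\<bar> \<partial>lborel)"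
        by (rule integral_abs_bound)
      also have "\<dots> \<le> (\<integral>x. \<bar>u x\<bar> \<partial>lborel)"
      proof (rule integral_mono[OF integrable_abs[OF \<psi>i[OF u]] integrable_abs[OF u]])
        show "\<bar>\<psi> (x + y) * u x\<bar> \<le> \<bar>u x\<bar>" for x
          using bd by (auto simp: abs_mult intro!: mult_left_le_one_le)
      qed
      finally show ?thesis .
    qed
    define F where "F w = (\<integral>y. \<psi> (y + w) * f y \<partial>lborel)" for w
    define G where "G i w = (\<integral>y. \<psi> (y + w) * g i y \<partial>lborel)" for i w
    have [measurable]: "F \<in> borel_measurable borel" unfolding F_def by measurable
    have Gm [measurable]: "G i \<in> borel_measurable borel" if i: "i \<in> Basis" for i
    proof -
      have [measurable]: "g i \<in> borel_measurable borel" using g[OF i] by auto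
      show ?thesis unfolding G_def by measurable
    qed
    have \<eta>F: "integrable lborel (\<lambda>w. \<eta> w * F w)"
    proof (rule Bochner_Integration.integrable_bound[OF integrable_mult_left[OF \<eta>(1), of "\<integral>x. \<bar>f x\<bar> \<partial>lborel"]])
      show "AE w in lborel. norm (\<eta> w * F w) \<le> norm (\<eta> w * (\<integral>x. \<bar>f x\<bar> \<partial>lborel))"
        proof (intro AE_I2)
        fix w
        have "\<bar>\<eta> w\<bar> * \<bar>F w\<bar> \<le> \<bar>\<eta> w\<bar> * \<bar>\<integral>x. \<bar>f x\<bar> \<partial>lborel\<bar>"
          using \<psi>le[OF f, of w] unfolding F_def by (intro mult_left_mono) auto
        then show "norm (\<eta> w * F w) \<le> norm (\<eta> w * (\<integral>x. \<bar>f x\<bar> \<partial>lborel))"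
          by (simp add: abs_mult)
      qed
    qed measurable
    have aG: "integrable (lborel :: (real \<times> 'a) measure) (\<lambda>z. a i z * G i (v z))" if i: "i \<in> Basis" for i
    proof (rule Bochner_Integration.integrable_bound[OF integrable_mult_left[OF ai[OF i], of "\<integral>x. \<bar>g i x\<bar> \<partial>lborel"]])
      show "AE z in lborel. norm (a i z * G i (v z)) \<le> norm (a i z * (\<integral>x. \<bar>g i x\<bar> \<partial>lborel))"
        proof (intro AE_I2)
        fix z
        have "\<bar>a i z\<bar> * \<bar>G i (v z)\<bar> \<le> \<bar>a i z\<bar> * \<bar>\<integral>x. \<bar>g i x\<bar> \<partial>lborel\<bar>"
          using \<psi>le[OF g[OF i], of "v z"] unfolding G_def by (intro mult_left_mono) auto
        then show "norm (a i z * G i (v z)) \<le> norm (a i z * (\<integral>x. \<bar>g i x\<bar> \<partial>lborel))"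
          by (simp add: abs_mult)
      qed
      show "(\<lambda>z. a i z * G i (v z)) \<in> borel_measurable lborel"
        using measurable_compose[OF _ Gm[OF i], of v borel] by simp
    qed
    have \<psi>T: "(\<integral>x. \<psi> x * T x \<partial>lborel) = (\<integral>w. \<eta> w * F w \<partial>lborel)"
      unfolding T_def F_def using integral_average_test[OF sfl(2) \<eta>(1) _ f, of "\<lambda>w. w" \<psi>] bd by simp
    have \<psi>S: "(\<integral>x. \<psi> x * S i x \<partial>lborel) = (\<integral>z. a i z * G i (v z) \<partial>lborel)" if i: "i \<in> Basis" for i
      unfolding S_def G_def using integral_average_test[OF sfl(1) ai[OF i] _ g[OF i], of v \<psi>] bd by simp
    \<comment> \<open>Since \<eta> has integral 1, the untranslated term can be written as an
      average over w too.\<close>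
    have \<psi>f: "(\<integral>x. \<psi> x * f x \<partial>lborel) = (\<integral>w. \<eta> w * F 0 \<partial>lborel)"
      using \<eta>(2) by (simp add: F_def)
    have "(\<Sum>i\<in>Basis. \<integral>x. \<psi> x * S i x \<partial>lborel) = (\<integral>z. (\<Sum>i\<in>Basis. a i z * G i (v z)) \<partial>lborel)"
      using aG \<psi>S by (subst Bochner_Integration.integral_sum) auto
    \<comment> \<open>The integral over pairs is split with t innermost, so that for each fixed w
      the tested segment formula applies.\<close>
    also have "\<dots> = (\<integral>z. (case z of (t, w) \<Rightarrow> \<Sum>i\<in>Basis. a i (t, w) * G i (v (t, w))) \<partial>(lborel \<Otimes>\<^sub>M lborel))"
      by (simp add: lborel_prod case_prod_unfold)
    also have "\<dots> = (\<integral>w. (\<integral>t. (\<Sum>i\<in>Basis. a i (t, w) * G i (v (t, w))) \<partial>lborel) \<partial>lborel)"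
    proof (rule lborel_pair.integral_snd[symmetric])
      have "integrable (lborel :: (real \<times> 'a) measure) (\<lambda>z. \<Sum>i\<in>Basis. a i z * G i (v z))"
        using aG by (intro Bochner_Integration.integrable_sum)
      then show "integrable (lborel \<Otimes>\<^sub>M lborel) (\<lambda>(t, w). \<Sum>i\<in>Basis. a i (t, w) * G i (v (t, w)))"
        by (simp add: lborel_prod case_prod_unfold)
    qed
    also have "\<dots> = (\<integral>w. \<eta> w * (F 0 - F w) \<partial>lborel)"
    proof (rule Bochner_Integration.integral_cong[OF refl])
      fix w
      show "(\<integral>t. (\<Sum>i\<in>Basis. a i (t, w) * G i (v (t, w))) \<partial>lborel) = \<eta> w * (F 0 - F w)"
      proof (cases "\<eta> w = 0")
        case True
        then show ?thesis by (simp add: a_def)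
      next
        case False
        have "F 0 - F w = (\<integral>t. indicator {0..1} t * (\<Sum>i\<in>Basis. (w \<bullet> i) * G i (t *\<^sub>R w)) \<partial>lborel)"
          unfolding F_def G_def \<psi>_def
          using weak_partials_shift_test[OF wp \<tau> ne, of w] sub[OF _ False] cU by auto
        then have "\<eta> w * (F 0 - F w) = (\<integral>t. \<eta> w * (indicator {0..1} t * (\<Sum>i\<in>Basis. (w \<bullet> i) * G i (t *\<^sub>R w))) \<partial>lborel)"
          by simp
        also have "\<dots> = (\<integral>t. (\<Sum>i\<in>Basis. a i (t, w) * G i (v (t, w))) \<partial>lborel)"
          by (simp add: a_def v_def sum_distrib_left mult_ac)
        finally show ?thesis by simp
      qed
    qed
    also have "\<dots> = (\<integral>w. \<eta> w * F 0 \<partial>lborel) - (\<integral>w. \<eta> w * F w \<partial>lborel)"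
      using \<eta>F \<eta>(1) by (simp add: right_diff_distrib)
    finally have key: "(\<Sum>i\<in>Basis. \<integral>x. \<psi> x * S i x \<partial>lborel) = (\<integral>w. \<eta> w * F 0 \<partial>lborel) - (\<integral>w. \<eta> w * F w \<partial>lborel)" .
    have i0: "integrable lborel (\<lambda>x. \<psi> x * u x)" if "integrable lborel u" for u
      using \<psi>i[OF that, of 0] by simp
    have "(\<integral>x. \<psi> x * h x \<partial>lborel) = (\<integral>x. \<psi> x * f x - \<psi> x * T x - (\<Sum>i\<in>Basis. \<psi> x * S i x) \<partial>lborel)"
      by (simp add: h_def right_diff_distrib sum_distrib_left)
    also have "\<dots> = (\<integral>x. \<psi> x * f x \<partial>lborel) - (\<integral>x. \<psi> x * T x \<partial>lborel) - (\<Sum>i\<in>Basis. \<integral>x. \<psi> x * S i x \<partial>lborel)"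
      using i0[OF f] i0[OF Ti] i0[OF Si]
      by (simp add: Bochner_Integration.integral_diff Bochner_Integration.integrable_sum Bochner_Integration.integrable_diff Bochner_Integration.integral_sum)
    also have "\<dots> = 0" unfolding key \<psi>T \<psi>f by simp
    finally show "(\<integral>x. box_cutoff \<tau> b c x * h x \<partial>lborel) = 0" by (simp add: \<psi>_def)
  qed
  then show "AE x in lborel. x \<in> U \<longrightarrow>
      f x - (\<integral>w. \<eta> w * f (x - w) \<partial>lborel)
        = (\<Sum>i\<in>Basis. \<integral>z. a i z * g i (x - fst z *\<^sub>R snd z) \<partial>(lborel :: (real \<times> 'a) measure))"
    by eventually_elim (simp add: h_def T_def S_def v_def)
qed

text \<open>A test function has compact support K in \<Omega>, so the integrals over \<Omega> see
  only K. There local integrability supplies measurability, and the given functions may be replaced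
  by their Borel representatives.\<close>

lemma weak_gradient_imp_weak_partials:
  assumes wg: "weak_gradient \<Omega> f0 g0"
    and f: "integrable lborel f" "AE x in lborel. x \<in> \<Omega> \<longrightarrow> f x = f0 x"
    and g: "\<And>i. i \<in> Basis \<Longrightarrow> integrable lborel (g i)"
      "\<And>i. i \<in> Basis \<Longrightarrow> AE x in lborel. x \<in> \<Omega> \<longrightarrow> g i x = g0 x \<bullet> i"
  shows "weak_partials \<Omega> f g"
proof -
  have eq: "(LINT x:\<Omega>|lebesgue. u0 x * \<phi> x) = (\<integral>x. u x * \<phi> x \<partial>lborel)"
    if u0: "locally_integrable_on \<Omega> u0" and K: "compact K" "K \<subseteq> \<Omega>" and u: "integrable lborel u"
      and AEu: "AE x in lborel. x \<in> \<Omega> \<longrightarrow> u x = u0 x" and \<phi>: "\<phi> \<in> borel_measurable borel"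
      and supp: "\<And>x. x \<notin> K \<Longrightarrow> \<phi> x = 0" for u0 u \<phi> K
  proof -
    have uK: "(\<lambda>x. indicator K x *\<^sub>R u0 x) \<in> borel_measurable lebesgue"
      using u0 K unfolding locally_integrable_on_def set_integrable_def by blast
    have \<phi>l: "\<phi> \<in> borel_measurable lebesgue" using \<phi> by (intro measurable_completion) simp
    have "(LINT x:\<Omega>|lebesgue. u0 x * \<phi> x) = (\<integral>x. (indicator K x *\<^sub>R u0 x) * \<phi> x \<partial>lebesgue)"
      unfolding set_lebesgue_integral_def using K(2) supp
      by (intro Bochner_Integration.integral_cong) (auto split: split_indicator)
    also have "\<dots> = (\<integral>x. u x * \<phi> x \<partial>lebesgue)"
    proof (rule integral_cong_AE)
      show "(\<lambda>x. indicator K x *\<^sub>R u0 x * \<phi> x) \<in> borel_measurable lebesgue"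
        using uK \<phi>l by (rule borel_measurable_times)
      show "(\<lambda>x. u x * \<phi> x) \<in> borel_measurable lebesgue"
        using u \<phi> by (intro measurable_completion) auto
      show "AE x in lebesgue. indicator K x *\<^sub>R u0 x * \<phi> x = u x * \<phi> x"
        unfolding AE_completion_iff using AEu
        by eventually_elim (use K(2) supp in \<open>auto split: split_indicator\<close>)
    qed
    also have "\<dots> = (\<integral>x. u x * \<phi> x \<partial>lborel)"
      using u \<phi> by (intro integral_completion) auto
    finally show ?thesis .
  qed
  have "(\<integral>x. f x * frechet_derivative (box_cutoff \<tau> a b) (at x) i \<partial>lborel)
         = - (\<integral>x. g i x * box_cutoff \<tau> a b x \<partial>lborel)"
    if i: "i \<in> Basis" and \<tau>: "0 < \<tau>" and ne: "box a b \<noteq> {}" and sub: "cbox a b \<subseteq> \<Omega>" for \<tau> a b i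
  proof -
    let ?\<psi> = "box_cutoff \<tau> a b"
    obtain d where d: "\<And>i x. i \<in> Basis \<Longrightarrow> frechet_derivative ?\<psi> (at x) i = d i x"
      and "\<And>x. (?\<psi> has_derivative (\<lambda>h. \<Sum>i\<in>Basis. (h \<bullet> i) * d i x)) (at x)"
      and dc: "\<And>i. i \<in> Basis \<Longrightarrow> continuous_on UNIV (d i)"
      and d0: "\<And>i x. x \<notin> box a b \<Longrightarrow> i \<in> Basis \<Longrightarrow> d i x = 0"
      using box_cutoff_has_derivative_explicit[OF \<tau> ne] by blast
    have "test_fun \<Omega> ?\<psi>" using test_fun_box_cutoff[OF \<tau> ne sub] .
    then have "(LINT x:\<Omega>|lebesgue. f0 x * frechet_derivative ?\<psi> (at x) i)
          = - (LINT x:\<Omega>|lebesgue. (g0 x \<bullet> i) * ?\<psi> x)"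
      using wg i unfolding weak_gradient_def by blast
    moreover have "(LINT x:\<Omega>|lebesgue. f0 x * d i x) = (\<integral>x. f x * d i x \<partial>lborel)"
    proof (rule eq[OF _ compact_cbox sub f])
      show "locally_integrable_on \<Omega> f0" using wg unfolding weak_gradient_def by blast
      show "d i \<in> borel_measurable borel" using dc[OF i] by (rule borel_measurable_continuous_onI)
      show "d i x = 0" if "x \<notin> cbox a b" for x using d0[OF _ i] that box_subset_cbox by blast
    qed
    moreover have "(LINT x:\<Omega>|lebesgue. (g0 x \<bullet> i) * ?\<psi> x) = (\<integral>x. g i x * ?\<psi> x \<partial>lborel)"
    proof (rule eq[OF _ compact_cbox sub g(1)[OF i] g(2)[OF i]])
      show "locally_integrable_on \<Omega> (\<lambda>x. g0 x \<bullet> i)" using wg i unfolding weak_gradient_def by blast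
      show "?\<psi> \<in> borel_measurable borel" unfolding box_cutoff_def cutoff_def by measurable
      show "?\<psi> x = 0" if "x \<notin> cbox a b" for x
        using that box_cutoff_nonzero_iff[of \<tau> a b x] box_subset_cbox by blast
    qed
    ultimately show ?thesis unfolding d[OF i] by simp
  qed
  then show ?thesis unfolding weak_partials_def using f(1) g(1) by blast
qed

text \<open>The domain lies below the graph of \<gamma>. Going down by s while moving sideways by at
  most s times the norm of z keeps the point below the graph, as long as the slope L cannot make up
  for the descent.\<close>

lemma lipschitz_domain_inner_cone:
  assumes lip: "lipschitz_domain \<Omega>" and p: "p \<in> closure \<Omega>"
  obtains U e \<kappa> s0 where "open U" "p \<in> U" "norm e \<le> 1" "0 < \<kappa>" "\<kappa> \<le> 1" "0 < s0"
    "\<And>x s z. x \<in> U \<Longrightarrow> x \<in> \<Omega> \<Longrightarrow> 0 \<le> s \<Longrightarrow> s \<le> s0 \<Longrightarrow> norm z \<le> \<kappa> \<Longrightarrow> x - s *\<^sub>R (e + z) \<in> \<Omega>"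
proof (cases "p \<in> \<Omega>")
  case True
  have "open \<Omega>" using lip by (simp add: lipschitz_domain_def)
  then obtain r where r: "0 < r" "ball p r \<subseteq> \<Omega>" using True openE by blast
  show thesis
  \<comment> \<open>At an interior point no direction is preferred: e = 0 and the cone is a full
    ball.\<close>
  proof (rule that[of "ball p (r / 2)" 0 1 "r / 2"])
    fix x z :: 'a and s :: real
    assume x: "x \<in> ball p (r / 2)" "0 \<le> s" "s \<le> r / 2" "norm z \<le> 1"
    have "s * norm z \<le> (r / 2) * 1" using x by (intro mult_mono) auto
    then have "norm (s *\<^sub>R z) \<le> r / 2" using x by simp
    then have "dist p (x - s *\<^sub>R z) < r"
      using x(1) norm_triangle_ineq[of "p - x" "s *\<^sub>R z"] by (simp add: dist_norm algebra_simps)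
    then show "x - s *\<^sub>R (0 + z) \<in> \<Omega>" using r(2) by auto
  qed (use r in auto)
next
  case False
  have op: "open \<Omega>" using lip by (simp add: lipschitz_domain_def)
  then have "p \<in> frontier \<Omega>" using False p by (simp add: frontier_def interior_open)
  then obtain e r h L \<gamma> where e: "norm e = 1" and r: "r > 0" and h: "h > 0"
    and L: "L-lipschitz_on {v. v \<bullet> e = 0} \<gamma>"
    and eq': "let P = (\<lambda>v. v - (v \<bullet> e) *\<^sub>R e);
             C = {x. norm (P (x - p)) < r \<and> \<bar>(x - p) \<bullet> e\<bar> < h}
         in \<Omega> \<inter> C = {x\<in>C. (x - p) \<bullet> e < \<gamma> (P (x - p))}"
    using lip unfolding lipschitz_domain_def by blast
  define P where "P v = v - (v \<bullet> e) *\<^sub>R e" for v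
  define C where "C = {x. norm (P (x - p)) < r \<and> \<bar>(x - p) \<bullet> e\<bar> < h}"
  have eq: "\<Omega> \<inter> C = {x\<in>C. (x - p) \<bullet> e < \<gamma> (P (x - p))}"
    using eq' unfolding Let_def C_def P_def .
  have ee: "e \<bullet> e = 1" using e by (simp add: dot_square_norm)
  have Pe: "P v \<bullet> e = 0" for v by (simp add: P_def inner_simps ee)
  have Plin: "P (v - s *\<^sub>R (e + z)) = P v - s *\<^sub>R P z" for v s z
    by (simp add: P_def inner_simps ee algebra_simps)
  have Pn: "norm (P z) \<le> norm z" for z
  proof -
    have "(norm (P z))\<^sup>2 \<le> (norm z)\<^sup>2"
      by (simp add: power2_norm_eq_inner P_def inner_simps ee inner_commute algebra_simps)
    then show ?thesis by (rule power2_le_imp_le) simp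
  qed
  have L0: "0 \<le> L" using L by (rule lipschitz_on_nonneg)
  define U where "U = {x. norm (P (x - p)) < r / 2 \<and> \<bar>(x - p) \<bullet> e\<bar> < h / 2}"
  \<comment> \<open>The perturbation z costs up to its norm in height and up to L times its norm
    through the graph; \<kappa> balances their sum against the unit descent along e.\<close>
  define \<kappa> where "\<kappa> = 1 / (1 + L)"
  \<comment> \<open>A step moves the point by at most s sideways and 2s in height. From the cylinder
    U of half size this stays inside C.\<close>
  define s0 where "s0 = min (r / 4) (h / 8)"
  have \<kappa>: "0 < \<kappa>" "\<kappa> \<le> 1" "(1 + L) * \<kappa> = 1" using L0 by (auto simp: \<kappa>_def)
  show thesis
  proof (rule that[of U e \<kappa> s0])
    show "open U"
      unfolding U_def P_def by (intro open_Collect_conj open_Collect_less continuous_intros)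
    show "p \<in> U" using r h by (simp add: U_def P_def)
    show "norm e \<le> 1" using e by simp
    show "0 < s0" using r h by (simp add: s0_def)
    fix x z :: 'a and s :: real
    assume x: "x \<in> U" "x \<in> \<Omega>" and s: "0 \<le> s" "s \<le> s0" and z: "norm z \<le> \<kappa>"
    define y where "y = x - s *\<^sub>R (e + z)"
    have yp: "y - p = (x - p) - s *\<^sub>R (e + z)" by (simp add: y_def)
    have ze: "\<bar>z \<bullet> e\<bar> \<le> norm z" using Cauchy_Schwarz_ineq2[of z e] e by simp
    have nz: "norm z \<le> 1" using z \<kappa> by linarith
    have sz: "s * norm z \<le> s" using s nz by (simp add: mult_left_le)
    have "norm (P (y - p)) \<le> norm (P (x - p)) + norm (s *\<^sub>R P z)"
      unfolding yp Plin by (rule norm_triangle_ineq4)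
    also have "norm (s *\<^sub>R P z) \<le> s * norm z" using s Pn[of z] by (simp add: mult_left_mono)
    finally have 1: "norm (P (y - p)) < r" using x(1) s sz by (simp add: U_def s0_def)
    have ye: "(y - p) \<bullet> e = (x - p) \<bullet> e - s - s * (z \<bullet> e)"
      unfolding yp by (simp add: inner_simps ee algebra_simps)
    have sze: "\<bar>s * (z \<bullet> e)\<bar> \<le> s * norm z" using s ze by (simp add: abs_mult mult_left_mono)
    have 2: "\<bar>(y - p) \<bullet> e\<bar> < h"
    proof -
      have "\<bar>(x - p) \<bullet> e\<bar> < h / 2" "s \<le> h / 8" using x(1) s by (auto simp: U_def s0_def)
      then show ?thesis unfolding ye using sze sz s h by linarith
    qed
    have yC: "y \<in> C" using 1 2 by (simp add: C_def)
    have xC: "x \<in> C" using x(1) r h by (auto simp: U_def C_def)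
    then have xg: "(x - p) \<bullet> e < \<gamma> (P (x - p))" using eq x(2) by blast
    have "\<bar>\<gamma> (P (y - p)) - \<gamma> (P (x - p))\<bar> \<le> L * norm (P (y - p) - P (x - p))"
      using lipschitz_onD[OF L, of "P (y - p)" "P (x - p)"] Pe by (simp add: dist_norm)
    also have "P (y - p) - P (x - p) = - (s *\<^sub>R P z)" unfolding yp Plin by simp
    also have "L * norm (- (s *\<^sub>R P z)) \<le> L * (s * norm z)"
      using s Pn[of z] L0 by (simp add: mult_left_mono)
    finally have gg: "\<gamma> (P (x - p)) - L * (s * norm z) \<le> \<gamma> (P (y - p))" by linarith
    have "(1 + L) * norm z \<le> 1" using mult_left_mono[OF z, of "1 + L"] L0 \<kappa>(3) by simp
    from mult_left_mono[OF this s(1)] have "s * norm z + L * (s * norm z) \<le> s" by (simp add: algebra_simps)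
    then have "(y - p) \<bullet> e < \<gamma> (P (y - p))" unfolding ye using xg gg sze by linarith
    then have "y \<in> \<Omega> \<inter> C" using yC unfolding eq by blast
    then show "x - s *\<^sub>R (e + z) \<in> \<Omega>" by (simp add: y_def)
  qed (use \<kappa> in auto)
qed

section \<open>Compactness\<close>

lemma integral_lborel_reflect:
  fixes F :: "'a::euclidean_space \<Rightarrow> real"
  assumes [measurable]: "F \<in> borel_measurable borel"
  shows "(\<integral>y. F (x - y) \<partial>lborel) = (\<integral>y. F y \<partial>lborel)"
proof -
  have "lborel = density (distr lborel borel (\<lambda>y::'a. x + (-1) *\<^sub>R y)) (\<lambda>_. 1)"
    using lborel_affine[of "-1" x] by simp
  then have eq: "(lborel :: 'a measure) = distr lborel borel (\<lambda>y. x - y)"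
    by (simp add: density_1)
  have "(\<integral>y. F y \<partial>lborel) = (\<integral>y. F y \<partial>distr lborel borel (\<lambda>y. x - y))"
    by (subst eq) simp
  also have "\<dots> = (\<integral>y. F (x - y) \<partial>lborel)"
    by (rule integral_distr) auto
  finally show ?thesis by simp
qed

text \<open>A normalised cone over the ball. Its Lipschitz continuity is the source of the
  equicontinuity of the averages.\<close>

lemma Lipschitz_kernel:
  fixes c :: "'a::euclidean_space"
  assumes r: "0 < r"
  obtains \<eta> :: "'a \<Rightarrow> real" and K where "0 < K" "\<And>w. 0 \<le> \<eta> w" "integrable lborel \<eta>"
    "(\<integral>w. \<eta> w \<partial>lborel) = 1" "\<And>w. \<eta> w \<noteq> 0 \<Longrightarrow> norm (w - c) < r" "\<And>w. \<eta> w \<le> K"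
    "\<And>w w'. \<bar>\<eta> w - \<eta> w'\<bar> \<le> K * norm (w - w')"
proof -
  define k where "k w = max 0 (r - norm (w - c))" for w
  have [measurable]: "k \<in> borel_measurable borel" unfolding k_def by measurable
  have k0: "0 \<le> k w" and kr: "k w \<le> r" for w using r by (auto simp: k_def)
  have kl: "\<bar>k w - k w'\<bar> \<le> norm (w - w')" for w w'
    using norm_triangle_ineq3[of "w - c" "w' - c"] by (auto simp: k_def max_def)
  have ki: "integrable lborel k"
  proof (rule Bochner_Integration.integrable_bound)
    have "integrable lborel (indicator (cball c r) :: 'a \<Rightarrow> real)"
      by (rule integrable_real_indicator) (use emeasure_bounded_finite in auto)
    then show "integrable lborel (\<lambda>w. r * indicator (cball c r) w)" by simp
    show "AE w in lborel. norm (k w) \<le> norm (r * indicator (cball c r) w)"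
      using r by (intro AE_I2) (auto simp: k_def dist_norm norm_minus_commute split: split_indicator)
  qed measurable
  define I where "I = (\<integral>w. k w \<partial>lborel)"
  \<comment> \<open>The cone has height at least r/2 on the ball of half the radius, so its integral
    I is positive.\<close>
  have "0 < r / 2 * measure lborel (ball c (r / 2))"
    using r content_ball_pos[of "r / 2" c] by (simp add: measure_completion)
  also have "\<dots> = (\<integral>w. r / 2 * indicator (ball c (r / 2)) w \<partial>lborel)" by simp
  also have "\<dots> \<le> I"
    unfolding I_def
  proof (rule integral_mono[OF _ ki])
    have "integrable lborel (indicator (ball c (r / 2)) :: 'a \<Rightarrow> real)"
      by (rule integrable_real_indicator) (use emeasure_bounded_finite in auto)
    then show "integrable lborel (\<lambda>w. r / 2 * indicator (ball c (r / 2)) w)" by simp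
    show "r / 2 * indicator (ball c (r / 2)) w \<le> k w" for w
      using r by (auto simp: k_def dist_norm norm_minus_commute split: split_indicator)
  qed
  finally have I: "0 < I" .
  \<comment> \<open>After division by I, r/I bounds the height and 1/I the slope.\<close>
  define K where "K = max (r / I) (1 / I)"
  have K0: "0 < K" using r I by (simp add: K_def less_max_iff_disj)
  show thesis
  proof (rule that[of K "\<lambda>w. k w / I"])
    show "0 < K" by (rule K0)
    show "0 \<le> k w / I" for w using k0 I by simp
    show "integrable lborel (\<lambda>w. k w / I)" using ki by simp
    show "(\<integral>w. k w / I \<partial>lborel) = 1" using I by (simp add: I_def)
    show "norm (w - c) < r" if "k w / I \<noteq> 0" for w using that by (auto simp: k_def max_def split: if_splits)
    show "k w / I \<le> K" for w
      using kr[of w] I by (auto simp: K_def divide_right_mono intro: max.coboundedI1)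
    show "\<bar>k w / I - k w' / I\<bar> \<le> K * norm (w - w')" for w w'
    proof -
      have "\<bar>k w / I - k w' / I\<bar> = 1 / I * \<bar>k w - k w'\<bar>"
        using I by (simp add: diff_divide_distrib[symmetric])
      also have "\<dots> \<le> K * norm (w - w')"
        using kl[of w w'] K0 by (intro mult_mono) (auto simp: K_def)
      finally show ?thesis .
    qed
  qed
qed

text \<open>Reflection turns the average into the integral of \<open>\<eta>(x - y) F(y)\<close>,
  where x enters only through the kernel. Sup norm and Lipschitz constant then depend on F through
  its L1 norm alone.\<close>

lemma kernel_average_bounds:
  fixes \<eta> F :: "'a::euclidean_space \<Rightarrow> real"
  assumes [measurable]: "\<eta> \<in> borel_measurable borel" and F: "integrable lborel F"
    and N: "(\<integral>y. \<bar>F y\<bar> \<partial>lborel) \<le> N" and K: "0 < K" and \<eta>: "\<And>w. 0 \<le> \<eta> w" "\<And>w. \<eta> w \<le> K"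
    and lip: "\<And>w w'. \<bar>\<eta> w - \<eta> w'\<bar> \<le> K * norm (w - w')"
  defines "T \<equiv> \<lambda>x. \<integral>w. \<eta> w * F (x - w) \<partial>lborel"
  shows "\<bar>T x\<bar> \<le> K * N" and "\<bar>T x - T x'\<bar> \<le> K * N * norm (x - x')"
proof -
  have [measurable]: "F \<in> borel_measurable borel" using F by auto
  have T: "T x = (\<integral>y. \<eta> (x - y) * F y \<partial>lborel)" for x
    unfolding T_def using integral_lborel_reflect[of "\<lambda>y. \<eta> (x - y) * F y" x] by simp
  have bound: "integrable lborel (\<lambda>y. u y * F y)" "\<bar>\<integral>y. u y * F y \<partial>lborel\<bar> \<le> c * N"
    if [measurable]: "u \<in> borel_measurable borel" and u: "\<And>y. \<bar>u y\<bar> \<le> c" for u c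
  proof -
    have c: "0 \<le> c" using u[of 0] by linarith
    have le: "\<bar>u y * F y\<bar> \<le> c * \<bar>F y\<bar>" for y
      using u by (simp add: abs_mult mult_right_mono)
    show int: "integrable lborel (\<lambda>y. u y * F y)"
      by (rule Bochner_Integration.integrable_bound[OF integrable_mult_right[OF F, of c]])
         (use le c in \<open>auto simp: abs_mult\<close>)
    have "\<bar>\<integral>y. u y * F y \<partial>lborel\<bar> \<le> (\<integral>y. \<bar>u y * F y\<bar> \<partial>lborel)" by (rule integral_abs_bound)
    also have "\<dots> \<le> (\<integral>y. c * \<bar>F y\<bar> \<partial>lborel)"
      by (rule integral_mono[OF integrable_abs[OF int] integrable_mult_right[OF integrable_abs[OF F]] le])
    also have "\<dots> = c * (\<integral>y. \<bar>F y\<bar> \<partial>lborel)" by simp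
    also have "\<dots> \<le> c * N" using N c by (rule mult_left_mono)
    finally show "\<bar>\<integral>y. u y * F y \<partial>lborel\<bar> \<le> c * N" .
  qed
  have \<eta>K: "\<bar>\<eta> w\<bar> \<le> K" for w using \<eta>[of w] by simp
  show "\<bar>T x\<bar> \<le> K * N" unfolding T using \<eta>K by (intro bound) auto
  have "T x - T x' = (\<integral>y. (\<eta> (x - y) - \<eta> (x' - y)) * F y \<partial>lborel)"
    unfolding T left_diff_distrib
    by (rule Bochner_Integration.integral_diff[symmetric]; rule bound(1)[where c = K]) (use \<eta>K in auto)
  also have "\<bar>\<dots>\<bar> \<le> (K * norm (x - x')) * N"
  proof (rule bound(2))
    show "\<bar>\<eta> (x - y) - \<eta> (x' - y)\<bar> \<le> K * norm (x - x')" for y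
      using lip[of "x - y" "x' - y"] by simp
  qed measurable
  finally show "\<bar>T x - T x'\<bar> \<le> K * N * norm (x - x')" by (simp add: mult_ac)
qed

text \<open>This mass bound is where the smallness comes from: used with \<rho> = 2s, it makes the
  distance between a function and its average O(s).\<close>

lemma nn_integral_time_weight_le:
  fixes \<eta> :: "'a::euclidean_space \<Rightarrow> real"
  assumes \<eta>: "\<And>w. 0 \<le> \<eta> w" "integrable lborel \<eta>" "(\<integral>w. \<eta> w \<partial>lborel) = 1"
    and supp: "\<And>w. \<eta> w \<noteq> 0 \<Longrightarrow> norm w \<le> \<rho>" and \<rho>: "0 \<le> \<rho>" and i: "i \<in> Basis"
  shows "(\<integral>\<^sup>+z. ennreal \<bar>indicator {0..1} (fst z) * (\<eta> (snd z) * (snd z \<bullet> i))\<bar> \<partial>(lborel :: (real \<times> 'a) measure))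
    \<le> ennreal \<rho>"
proof -
  have [measurable]: "\<eta> \<in> borel_measurable borel" using \<eta> by auto
  have "(\<integral>\<^sup>+z. ennreal \<bar>indicator {0..1} (fst z) * (\<eta> (snd z) * (snd z \<bullet> i))\<bar> \<partial>(lborel :: (real \<times> 'a) measure))
    \<le> (\<integral>\<^sup>+z. indicator {0..1} (fst z) * (ennreal \<rho> * ennreal (\<eta> (snd z))) \<partial>(lborel :: (real \<times> 'a) measure))"
  proof (rule nn_integral_mono)
    fix z :: "real \<times> 'a"
    have "\<bar>\<eta> (snd z) * (snd z \<bullet> i)\<bar> \<le> \<rho> * \<eta> (snd z)"
    proof (cases "\<eta> (snd z) = 0")
      case False
      then have "\<bar>snd z \<bullet> i\<bar> \<le> \<rho>" using supp[OF False] Basis_le_norm[OF i, of "snd z"] by linarith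
      then have "\<eta> (snd z) * \<bar>snd z \<bullet> i\<bar> \<le> \<eta> (snd z) * \<rho>" using \<eta>(1) by (intro mult_left_mono)
      then show ?thesis using \<eta>(1) by (simp add: abs_mult mult.commute)
    qed simp
    then show "ennreal \<bar>indicator {0..1} (fst z) * (\<eta> (snd z) * (snd z \<bullet> i))\<bar>
        \<le> indicator {0..1} (fst z) * (ennreal \<rho> * ennreal (\<eta> (snd z)))"
      using \<rho> \<eta>(1) by (auto simp: ennreal_mult[symmetric] ennreal_leI split: split_indicator)
  qed
  also have "\<dots> = (\<integral>\<^sup>+z. indicator {0..1} (fst z) * (ennreal \<rho> * ennreal (\<eta> (snd z))) \<partial>((lborel :: real measure) \<Otimes>\<^sub>M (lborel :: 'a measure)))"
    by (simp add: lborel_prod)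
  also have "\<dots> = (\<integral>\<^sup>+t. (\<integral>\<^sup>+w. indicator {0..1} t * (ennreal \<rho> * ennreal (\<eta> w)) \<partial>lborel) \<partial>(lborel :: real measure))"
    by (subst lborel.nn_integral_fst[symmetric]) auto
  also have "\<dots> = (\<integral>\<^sup>+t. indicator {0..1} t * ennreal \<rho> \<partial>(lborel :: real measure))"
  proof -
    have "(\<integral>\<^sup>+w. ennreal (\<eta> w) \<partial>lborel) = 1"
      using \<eta> by (subst nn_integral_eq_integral) auto
    then show ?thesis by (simp add: nn_integral_cmult)
  qed
  also have "\<dots> = ennreal \<rho>" by (simp add: nn_integral_multc)
  finally show ?thesis .
qed

section \<open>Precompactness in the block norm\<close>

context block_domain
begin

text \<open>Unlike in \<open>Hle\<close>, the values are prescribed everywhere, and they are 0 off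
  \<Omega>. Averages need this, since their translated arguments may leave \<Omega>.\<close>

definition mol_sum :: "('a \<Rightarrow> real) \<Rightarrow> real \<Rightarrow> bool" where
  "mol_sum F B \<longleftrightarrow> (\<exists>b m. (\<forall>k. mol (b k) (m k)) \<and> summable m \<and> suminf m \<le> B \<and> F = (\<lambda>x. \<Sum>k. b k x))"

lemma mol_sum_integrable: "mol_sum F B \<Longrightarrow> integrable lborel F"
  unfolding mol_sum_def using mol_suminf_integrable by blast

lemma mol_sum_L1:
  assumes "mol_sum F B" shows "(\<integral>x. \<bar>F x\<bar> \<partial>lborel) \<le> L1_const * B"
proof -
  obtain b m where bm: "\<And>k. mol (b k) (m k)" "summable m" "suminf m \<le> B" "F = (\<lambda>x. \<Sum>k. b k x)"
    using assms unfolding mol_sum_def by blast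
  have "(\<integral>x. \<bar>F x\<bar> \<partial>lborel) \<le> L1_const * suminf m"
    unfolding bm(4) using bm by (intro mol_suminf_L1)
  also have "\<dots> \<le> L1_const * B" using bm L1_const_nonneg by (intro mult_left_mono)
  finally show ?thesis .
qed

lemma mol_sum_average:
  assumes "mol_sum F B" and M: "sigma_finite_measure M" "a \<in> borel_measurable M" "v \<in> borel_measurable M"
    "0 \<le> A" "(\<integral>\<^sup>+z. ennreal \<bar>a z\<bar> \<partial>M) \<le> ennreal A"
  shows "Hle (\<lambda>x. \<integral>z. a z * F (x - v z) \<partial>M) (2 powr \<alpha> * A * B)"
proof -
  obtain b m where bm: "\<And>k. mol (b k) (m k)" "summable m" "suminf m \<le> B" "F = (\<lambda>x. \<Sum>k. b k x)"
    using assms unfolding mol_sum_def by blast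
  have "Hle (\<lambda>x. \<integral>z. a z * F (x - v z) \<partial>M) (2 powr \<alpha> * A * suminf m)"
    unfolding bm(4) by (rule Hle_average[OF M bm(1,2)])
  then show ?thesis by (rule Hle_cong) (use bm(3) M(4) in \<open>auto intro!: mult_left_mono\<close>)
qed

lemma Hle_imp_mol_sum:
  assumes "Hle f B"
  obtains F where "mol_sum F B" "AE x in lborel. x \<in> \<Omega> \<longrightarrow> F x = f x"
proof -
  obtain b m where bm: "\<forall>k. mol (b k) (m k)" "summable m" "suminf m \<le> B"
    and AEb: "AE y in lborel. y \<in> \<Omega> \<longrightarrow> (\<lambda>k. b k y) sums f y"
    using assms unfolding Hle_def by blast
  show thesis
  proof (rule that[of "\<lambda>x. \<Sum>k. b k x"])
    show "mol_sum (\<lambda>x. \<Sum>k. b k x) B" unfolding mol_sum_def using bm by blast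
    show "AE x in lborel. x \<in> \<Omega> \<longrightarrow> (\<Sum>k. b k x) = f x"
      using AEb by eventually_elim (auto simp: sums_iff)
  qed
qed

text \<open>Bounded sets of the Sobolev-type space, with representatives on the whole space fixed so
  that averages of the function and of its partials are defined.\<close>

definition sobolev :: "('a \<Rightarrow> real) \<Rightarrow> real \<Rightarrow> bool" where
  "sobolev f B \<longleftrightarrow> (\<exists>F G. weak_partials \<Omega> F G \<and> mol_sum F B \<and> (\<forall>i\<in>Basis. mol_sum (G i) B) \<and>
     (AE x in lborel. x \<in> \<Omega> \<longrightarrow> F x = f x))"

lemma sobolevI:
  assumes f: "Hle f B" and wg: "weak_gradient \<Omega> f g" and g: "\<And>i. i \<in> Basis \<Longrightarrow> Hle (\<lambda>x. g x \<bullet> i) B"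
  shows "sobolev f B"
proof -
  obtain F where F: "mol_sum F B" "AE x in lborel. x \<in> \<Omega> \<longrightarrow> F x = f x" by (rule Hle_imp_mol_sum[OF f])
  have "\<forall>i\<in>Basis. \<exists>Gi. mol_sum Gi B \<and> (AE x in lborel. x \<in> \<Omega> \<longrightarrow> Gi x = g x \<bullet> i)"
  proof
    fix i :: 'a assume "i \<in> Basis"
    obtain Gi where "mol_sum Gi B" "AE x in lborel. x \<in> \<Omega> \<longrightarrow> Gi x = g x \<bullet> i"
      by (rule Hle_imp_mol_sum[OF g[OF \<open>i \<in> Basis\<close>]])
    then show "\<exists>Gi. mol_sum Gi B \<and> (AE x in lborel. x \<in> \<Omega> \<longrightarrow> Gi x = g x \<bullet> i)" by blast
  qed
  from bchoice[OF this] obtain G where G: "\<And>i. i \<in> Basis \<Longrightarrow> mol_sum (G i) B"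
    "\<And>i. i \<in> Basis \<Longrightarrow> AE x in lborel. x \<in> \<Omega> \<longrightarrow> G i x = g x \<bullet> i" by blast
  have "weak_partials \<Omega> F G"
    using weak_gradient_imp_weak_partials[OF wg mol_sum_integrable[OF F(1)] F(2), of G]
      mol_sum_integrable[OF G(1)] G(2) by blast
  then show ?thesis unfolding sobolev_def using F G(1) by blast
qed

lemma sobolev_imp_Hle:
  assumes "sobolev f B" shows "Hle f B"
proof -
  obtain F where F: "mol_sum F B" "AE x in lborel. x \<in> \<Omega> \<longrightarrow> F x = f x"
    using assms unfolding sobolev_def by blast
  obtain b m where bm: "\<And>k. mol (b k) (m k)" "summable m" "suminf m \<le> B" "F = (\<lambda>x. \<Sum>k. b k x)"
    using F(1) unfolding mol_sum_def by blast
  have "Hle F (suminf m)" unfolding bm(4) by (intro Hle_suminf Hle_mol bm)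
  then show ?thesis using F(2) bm(3) by (rule Hle_cong)
qed

text \<open>Total boundedness near U in sequential form. Bounding all mutual distances, and not just
  those from some index on, makes the property inherited by further subsequences.\<close>

definition locally_precompact :: "'a set \<Rightarrow> bool" where
  "locally_precompact U \<longleftrightarrow> open U \<and> (\<forall>f B \<epsilon>. 0 < \<epsilon> \<and> (\<forall>k::nat. sobolev (f k) B) \<longrightarrow>
     (\<exists>r. strict_mono (r :: nat \<Rightarrow> nat) \<and>
       (\<forall>k l. Hle (\<lambda>x. indicator U x * (f (r k) x - f (r l) x)) \<epsilon>)))"

lemma locally_precompactD:
  assumes "locally_precompact U" "0 < \<epsilon>" "\<And>k::nat. sobolev (f k) B"
  obtains r where "strict_mono (r :: nat \<Rightarrow> nat)"
    "\<And>k l. Hle (\<lambda>x. indicator U x * (f (r k) x - f (r l) x)) \<epsilon>"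
  using assms unfolding locally_precompact_def by blast

text \<open>On \<open>U\<close> each function is within \<open>O(s)\<close> of its average over a small ball around the inner
  direction \<open>-s e\<close>, and these averages are equicontinuous.\<close>

lemma locally_precompactI:
  assumes U: "open U" and e: "norm e \<le> 1" and \<kappa>: "0 < \<kappa>" "\<kappa> \<le> 1" and s0: "0 < s0"
    and cone: "\<And>x s z. x \<in> U \<Longrightarrow> x \<in> \<Omega> \<Longrightarrow> 0 \<le> s \<Longrightarrow> s \<le> s0 \<Longrightarrow> norm z \<le> \<kappa> \<Longrightarrow> x - s *\<^sub>R (e + z) \<in> \<Omega>"
  shows "locally_precompact U"
  unfolding locally_precompact_def
proof (intro conjI allI impI)
  fix f :: "nat \<Rightarrow> 'a \<Rightarrow> real" and B \<epsilon> :: real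
  assume asm: "0 < \<epsilon> \<and> (\<forall>k. sobolev (f k) B)"
  then have \<epsilon>: "0 < \<epsilon>" and sob: "\<And>k. sobolev (f k) B" by auto
  have B: "0 \<le> B" using Hle_nonneg[OF sobolev_imp_Hle[OF sob[of 0]]] .
  have [measurable]: "U \<in> sets borel" using U by simp
  from sob have "\<forall>k. \<exists>F G. weak_partials \<Omega> F G \<and> mol_sum F B \<and> (\<forall>i\<in>Basis. mol_sum (G i) B) \<and>
     (AE x in lborel. x \<in> \<Omega> \<longrightarrow> F x = f k x)" unfolding sobolev_def by blast
  from choice[OF this] obtain F where "\<forall>k. \<exists>G. weak_partials \<Omega> (F k) G \<and> mol_sum (F k) B \<and>
     (\<forall>i\<in>Basis. mol_sum (G i) B) \<and> (AE x in lborel. x \<in> \<Omega> \<longrightarrow> F k x = f k x)" by blast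
  from choice[OF this] obtain G where wp: "\<And>k. weak_partials \<Omega> (F k) (G k)" and Fs: "\<And>k. mol_sum (F k) B"
    and Gs: "\<And>k i. i \<in> Basis \<Longrightarrow> mol_sum (G k i) B"
    and Ff: "\<And>k. AE x in lborel. x \<in> \<Omega> \<longrightarrow> F k x = f k x" by blast
  \<comment> \<open>One summand \<open>2 powr \<alpha> * (2 * s) * B\<close> for each partial
    derivative adds up to \<open>c0 * s\<close>.\<close>
  define c0 where "c0 = real DIM('a) * (2 powr \<alpha> * 2 * B)"
  have c0: "0 \<le> c0" using B by (simp add: c0_def)
  define s where "s = min s0 (\<epsilon> / (3 * (c0 + 1)))"
  have s: "0 < s" "s \<le> s0" using s0 \<epsilon> c0 by (auto simp: s_def)
  have c0s: "c0 * s \<le> \<epsilon> / 3"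
  proof -
    have "c0 * s \<le> c0 * (\<epsilon> / (3 * (c0 + 1)))" using c0 by (intro mult_left_mono) (auto simp: s_def)
    also have "\<dots> \<le> \<epsilon> / 3" using c0 \<epsilon> by (simp add: field_simps)
    finally show ?thesis .
  qed
  have ks: "0 < \<kappa> * s" using \<kappa> s by simp
  obtain \<eta> :: "'a \<Rightarrow> real" and K where K: "0 < K" and \<eta>0: "\<And>w. 0 \<le> \<eta> w" and \<eta>i: "integrable lborel \<eta>"
    and \<eta>1: "(\<integral>w. \<eta> w \<partial>lborel) = 1" and \<eta>s: "\<And>w. \<eta> w \<noteq> 0 \<Longrightarrow> norm (w - s *\<^sub>R e) < \<kappa> * s"
    and \<eta>K: "\<And>w. \<eta> w \<le> K" and \<eta>L: "\<And>w w'. \<bar>\<eta> w - \<eta> w'\<bar> \<le> K * norm (w - w')"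
    by (rule Lipschitz_kernel[OF ks, of "s *\<^sub>R e"], blast)
  have [measurable]: "\<eta> \<in> borel_measurable borel" using \<eta>i by auto
  have w2: "norm w \<le> 2 * s" if "\<eta> w \<noteq> 0" for w
  proof -
    have "norm w \<le> norm (w - s *\<^sub>R e) + norm (s *\<^sub>R e)" using norm_triangle_ineq[of "w - s *\<^sub>R e" "s *\<^sub>R e"] by simp
    also have "norm (s *\<^sub>R e) \<le> s" using s e by (simp add: mult_left_le)
    also have "norm (w - s *\<^sub>R e) \<le> s" proof -
      have "\<kappa> * s \<le> 1 * s" using \<kappa>(2) s by (intro mult_right_mono) auto
      then show ?thesis using \<eta>s[OF that] by linarith
    qed
    finally show ?thesis by simp
  qed
  have sub: "x - t *\<^sub>R w \<in> \<Omega>" if "x \<in> U \<inter> \<Omega>" "\<eta> w \<noteq> 0" "t \<in> {0..1}" for x w t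
  proof -
    \<comment> \<open>Rescaling puts w in the form s(e + z) with z in the cone opening; the point t
      w of the segment is then the cone step of length t s.\<close>
    define z where "z = (1 / s) *\<^sub>R (w - s *\<^sub>R e)"
    have "norm z = norm (w - s *\<^sub>R e) / s" using s by (simp add: z_def)
    also have "\<dots> \<le> (\<kappa> * s) / s" using \<eta>s[OF that(2)] s by (intro divide_right_mono) auto
    finally have "norm z \<le> \<kappa>" using s by simp
    moreover have "t * s \<le> 1 * s0" using that(3) s by (intro mult_mono) auto
    ultimately have "x - (t * s) *\<^sub>R (e + z) \<in> \<Omega>" using that s by (intro cone) auto
    moreover have "(t * s) *\<^sub>R (e + z) = t *\<^sub>R w" using s by (simp add: z_def algebra_simps)
    ultimately show ?thesis by simp
  qed
  define T where "T k x = (\<integral>w. \<eta> w * F k (x - w) \<partial>lborel)" for k x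
  have Tm [measurable]: "T k \<in> borel_measurable borel" for k
  proof -
    have "integrable lborel (T k)"
      unfolding T_def using integrable_average[OF sigma_finite_lborel \<eta>i _ mol_sum_integrable[OF Fs], of "\<lambda>w. w"] by simp
    then show ?thesis by auto
  qed
  define N where "N = L1_const * B"
  note bounds = kernel_average_bounds[OF _ mol_sum_integrable[OF Fs] mol_sum_L1[OF Fs] K \<eta>0 \<eta>K \<eta>L, folded N_def T_def]
  have Tb: "\<bar>T k x\<bar> \<le> K * N" and TL: "\<bar>T k x - T k x'\<bar> \<le> K * N * norm (x - x')" for k x x'
    using bounds by auto
  have err: "Hle (\<lambda>x. indicator U x * (F k x - T k x)) (\<epsilon> / 3)" for k
  proof -
    let ?a = "\<lambda>i (z :: real \<times> 'a). indicator {0..1} (fst z) * (\<eta> (snd z) * (snd z \<bullet> i))"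
    have op: "open (U \<inter> \<Omega>)" using U open_\<Omega> by auto
    have id1: "integrable (lborel :: (real \<times> 'a) measure) (?a i)" if "i \<in> Basis" for i
      by (rule weak_partials_average_identity(1)[OF wp[of k] op \<eta>i \<eta>1]) (use w2 sub that in auto)
    have id2: "AE x in lborel. x \<in> U \<inter> \<Omega> \<longrightarrow> F k x - (\<integral>w. \<eta> w * F k (x - w) \<partial>lborel)
        = (\<Sum>i\<in>Basis. \<integral>z. ?a i z * G k i (x - fst z *\<^sub>R snd z) \<partial>(lborel :: (real \<times> 'a) measure))"
      by (rule weak_partials_average_identity(2)[OF wp[of k] op \<eta>i \<eta>1]) (use w2 sub in auto)
    have vm: "(\<lambda>z::real \<times> 'a. fst z *\<^sub>R snd z) \<in> borel_measurable borel"
      unfolding borel_prod[symmetric] by measurable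
    have sm: "Hle (\<lambda>x. \<integral>z. ?a i z * G k i (x - fst z *\<^sub>R snd z) \<partial>(lborel :: (real \<times> 'a) measure)) (2 powr \<alpha> * (2 * s) * B)"
      if i: "i \<in> Basis" for i
    proof (rule mol_sum_average[OF Gs[OF i] sigma_finite_lborel])
      show "?a i \<in> borel_measurable lborel" using id1[OF i] by (rule borel_measurable_integrable)
      show "(\<lambda>z::real \<times> 'a. fst z *\<^sub>R snd z) \<in> borel_measurable lborel"
        using vm by simp
      show "(\<integral>\<^sup>+z. ennreal \<bar>?a i z\<bar> \<partial>lborel) \<le> ennreal (2 * s)"
        by (rule nn_integral_time_weight_le[OF \<eta>0 \<eta>i \<eta>1]) (use w2 s i in auto)
    qed (use s in auto)
    have "Hle (\<lambda>x. indicator U x * (\<Sum>i\<in>Basis. \<integral>z. ?a i z * G k i (x - fst z *\<^sub>R snd z) \<partial>(lborel :: (real \<times> 'a) measure)))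
      (\<Sum>i\<in>(Basis :: 'a set). 2 powr \<alpha> * (2 * s) * B)"
      by (intro Hle_restrict Hle_sum sm) auto
    then show ?thesis
    proof (rule Hle_cong)
      show "AE x in lborel. x \<in> \<Omega> \<longrightarrow>
        indicator U x * (\<Sum>i\<in>Basis. \<integral>z. ?a i z * G k i (x - fst z *\<^sub>R snd z) \<partial>(lborel :: (real \<times> 'a) measure))
          = indicator U x * (F k x - T k x)"
        using id2 by eventually_elim (auto simp: T_def split: split_indicator)
      show "(\<Sum>i\<in>(Basis :: 'a set). 2 powr \<alpha> * (2 * s) * B) \<le> \<epsilon> / 3"
        using c0s by (simp add: c0_def mult_ac)
    qed
  qed
  obtain K2 where K2: "0 \<le> K2"
    and Hb: "\<And>f M. f \<in> borel_measurable borel \<Longrightarrow> 0 \<le> M \<Longrightarrow> (\<And>x. x \<in> \<Omega> \<Longrightarrow> \<bar>f x\<bar> \<le> M) \<Longrightarrow> Hle f (K2 * M)"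
    by (rule Hle_bounded, blast)
  \<comment> \<open>Two averages within \<delta> of their common uniform limit differ by at most
    2\<delta>, which K2 turns into a third of \<epsilon>.\<close>
  define \<delta> where "\<delta> = \<epsilon> / (6 * (K2 + 1))"
  have \<delta>: "0 < \<delta>" using \<epsilon> K2 by (simp add: \<delta>_def)
  have K2\<delta>: "K2 * (2 * \<delta>) \<le> \<epsilon> / 3" using K2 \<epsilon> by (simp add: \<delta>_def field_simps)
  have KN: "0 \<le> K * N" using Tb[of 0 0] by linarith
  have cpt: "compact (closure \<Omega>)" using bounded_\<Omega> by (simp add: compact_closure)
  obtain g and r :: "nat \<Rightarrow> nat" where "continuous_on (closure \<Omega>) g" and r: "strict_mono r"
    and conv: "\<And>e. 0 < e \<Longrightarrow> \<exists>N. \<forall>n x. n \<ge> N \<and> x \<in> closure \<Omega> \<longrightarrow> norm (T (r n) x - g x) < e"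
  proof (rule Arzela_Ascoli[OF cpt, of T "K * N"])
    show "norm (T n x) \<le> K * N" for n x using Tb by simp
    show "\<exists>d>0. \<forall>n y. y \<in> closure \<Omega> \<and> norm (x - y) < d \<longrightarrow> norm (T n x - T n y) < e" if "0 < e" for x e
    proof (intro exI[of _ "e / (K * N + 1)"] conjI allI impI)
      show "0 < e / (K * N + 1)" using that KN by simp
      fix n y assume "y \<in> closure \<Omega> \<and> norm (x - y) < e / (K * N + 1)"
      then have "(K * N + 1) * norm (x - y) < e" using KN by (simp add: field_simps)
      moreover have "K * N * norm (x - y) \<le> (K * N + 1) * norm (x - y)" by (intro mult_right_mono) auto
      ultimately show "norm (T n x - T n y) < e" using TL[of n x y] by simp
    qed
  qed blast
  obtain N0 where N0: "\<And>n x. n \<ge> N0 \<Longrightarrow> x \<in> closure \<Omega> \<Longrightarrow> norm (T (r n) x - g x) < \<delta>"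
    using conv[OF \<delta>] by blast
  \<comment> \<open>Dropping the first N0 terms makes the estimate hold for all pairs of
    indices.\<close>
  define r' where "r' n = r (n + N0)" for n
  have r': "strict_mono r'" using r by (auto simp: r'_def strict_mono_def)
  have "Hle (\<lambda>x. indicator U x * (f (r' k) x - f (r' l) x)) \<epsilon>" for k l
  proof -
    have "Hle (\<lambda>x. T (r' k) x - T (r' l) x) (K2 * (2 * \<delta>))"
    proof (rule Hb)
      fix x assume "x \<in> \<Omega>"
      then have x: "x \<in> closure \<Omega>" using closure_subset by blast
      show "\<bar>T (r' k) x - T (r' l) x\<bar> \<le> 2 * \<delta>"
        using N0[OF _ x, of "k + N0"] N0[OF _ x, of "l + N0"] by (simp add: r'_def)
    qed (use \<delta> in auto)
    then have H3: "Hle (\<lambda>x. indicator U x * (T (r' k) x - T (r' l) x)) (K2 * (2 * \<delta>))"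
      by (rule Hle_restrict) simp
    \<comment> \<open>Two errors between function and average and one difference of averages, each
      at most \<epsilon>/3.\<close>
    have H: "Hle (\<lambda>x. (indicator U x * (F (r' k) x - T (r' k) x) - indicator U x * (F (r' l) x - T (r' l) x))
        + indicator U x * (T (r' k) x - T (r' l) x)) ((\<epsilon> / 3 + \<epsilon> / 3) + K2 * (2 * \<delta>))"
      by (intro Hle_add Hle_diff err H3)
    show ?thesis
    proof (rule Hle_cong[OF H])
      show "AE x in lborel. x \<in> \<Omega> \<longrightarrow>
        (indicator U x * (F (r' k) x - T (r' k) x) - indicator U x * (F (r' l) x - T (r' l) x))
        + indicator U x * (T (r' k) x - T (r' l) x) = indicator U x * (f (r' k) x - f (r' l) x)"
        using Ff[of "r' k"] Ff[of "r' l"] by eventually_elim (auto simp: algebra_simps)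
    qed (use K2\<delta> in linarith)
  qed
  then show "\<exists>r. strict_mono (r :: nat \<Rightarrow> nat) \<and> (\<forall>k l. Hle (\<lambda>x. indicator U x * (f (r k) x - f (r l) x)) \<epsilon>)"
    using r' by (intro exI[of _ r'] conjI allI)
qed (rule U)

text \<open>Each new set contributes fully, and what was covered before is restricted to its
  complement. Restriction does not increase the bound, so the costs simply add up.\<close>

lemma Hle_cover:
  assumes "finite \<U>" "\<And>U. U \<in> \<U> \<Longrightarrow> open U" "\<And>U. U \<in> \<U> \<Longrightarrow> Hle (\<lambda>x. indicator U x * f x) c"
  shows "Hle (\<lambda>x. indicator (\<Union>\<U>) x * f x) (real (card \<U>) * c)"
  using assms
proof (induction \<U> rule: finite_induct)
  case empty
  then show ?case using Hle_zero by simp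
next
  case (insert U \<U>)
  have [measurable]: "U \<in> sets borel" using insert.prems by simp
  have "Hle (\<lambda>x. indicator (\<Union>\<U>) x * f x) (real (card \<U>) * c)" using insert by blast
  then have "Hle (\<lambda>x. indicator (- U) x * (indicator (\<Union>\<U>) x * f x)) (real (card \<U>) * c)"
    by (rule Hle_restrict) simp
  then have "Hle (\<lambda>x. indicator U x * f x + indicator (- U) x * (indicator (\<Union>\<U>) x * f x)) (c + real (card \<U>) * c)"
    using insert.prems by (intro Hle_add) auto
  then show ?case
    by (rule Hle_cong) (use insert.hyps in \<open>auto simp: algebra_simps split: split_indicator\<close>)
qed

lemma sobolev_subseq_small:
  assumes fin: "finite \<U>" and lp: "\<And>U. U \<in> \<U> \<Longrightarrow> locally_precompact U" and \<epsilon>: "0 < \<epsilon>"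
    and sob: "\<And>k::nat. sobolev (f k) B"
  shows "\<exists>r. strict_mono (r :: nat \<Rightarrow> nat) \<and>
    (\<forall>U\<in>\<U>. \<forall>k l. Hle (\<lambda>x. indicator U x * (f (r k) x - f (r l) x)) \<epsilon>)"
  using fin lp
proof (induction \<U> rule: finite_induct)
  case empty
  show ?case by (rule exI[of _ id]) (auto simp: strict_mono_def)
next
  case (insert U \<U>)
  then obtain r :: "nat \<Rightarrow> nat" where r: "strict_mono r"
    "\<And>V k l. V \<in> \<U> \<Longrightarrow> Hle (\<lambda>x. indicator V x * (f (r k) x - f (r l) x)) \<epsilon>" by blast
  have lpU: "locally_precompact U" using insert.prems by simp
  obtain r' :: "nat \<Rightarrow> nat" where r': "strict_mono r'"
    "\<And>k l. Hle (\<lambda>x. indicator U x * (f (r (r' k)) x - f (r (r' l)) x)) \<epsilon>"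
    by (rule locally_precompactD[OF lpU \<epsilon>, of "\<lambda>k. f (r k)" B]) (use sob in blast)+
  show ?case
    using strict_mono_o[OF r(1) r'(1)] r(2) r'(2)
    by (intro exI[of _ "\<lambda>k. r (r' k)"]) (auto simp: o_def)
qed

lemma sobolev_precompact:
  assumes lip: "lipschitz_domain \<Omega>" and \<epsilon>: "0 < \<epsilon>" and sob: "\<And>k::nat. sobolev (f k) B"
  shows "\<exists>r. strict_mono (r :: nat \<Rightarrow> nat) \<and> (\<forall>k l. Hle (\<lambda>x. f (r k) x - f (r l) x) \<epsilon>)"
proof -
  have cpt: "compact (closure \<Omega>)" using bounded_\<Omega> by (simp add: compact_closure)
  have "\<exists>U. p \<in> U \<and> locally_precompact U" if p: "p \<in> closure \<Omega>" for p
  proof -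
    obtain U e \<kappa> s0 where "open U" "p \<in> U" "norm e \<le> 1" "0 < \<kappa>" "\<kappa> \<le> 1" "0 < s0"
      "\<And>x s z. x \<in> U \<Longrightarrow> x \<in> \<Omega> \<Longrightarrow> 0 \<le> s \<Longrightarrow> s \<le> s0 \<Longrightarrow> norm z \<le> \<kappa> \<Longrightarrow> x - s *\<^sub>R (e + z) \<in> \<Omega>"
      by (rule lipschitz_domain_inner_cone[OF lip p], blast)
    then show ?thesis using locally_precompactI by blast
  qed
  then have cov: "closure \<Omega> \<subseteq> \<Union>{U. locally_precompact U}" by blast
  have opn: "\<And>U. U \<in> {U. locally_precompact U} \<Longrightarrow> open U" by (simp add: locally_precompact_def)
  obtain \<U> where \<U>: "\<U> \<subseteq> {U. locally_precompact U}" "finite \<U>" "closure \<Omega> \<subseteq> \<Union>\<U>"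
    by (rule compactE[OF cpt cov opn])
  \<comment> \<open>The cover may be empty, hence the additional 1 in the denominator.\<close>
  define \<delta> where "\<delta> = \<epsilon> / (real (card \<U>) + 1)"
  have \<delta>: "0 < \<delta>" using \<epsilon> by (simp add: \<delta>_def)
  have "\<exists>r. strict_mono (r :: nat \<Rightarrow> nat) \<and>
    (\<forall>U\<in>\<U>. \<forall>k l. Hle (\<lambda>x. indicator U x * (f (r k) x - f (r l) x)) \<delta>)"
    using \<U> \<delta> sob by (intro sobolev_subseq_small) auto
  then obtain r :: "nat \<Rightarrow> nat" where r: "strict_mono r"
    "\<And>U k l. U \<in> \<U> \<Longrightarrow> Hle (\<lambda>x. indicator U x * (f (r k) x - f (r l) x)) \<delta>" by blast
  have "Hle (\<lambda>x. f (r k) x - f (r l) x) \<epsilon>" for k l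
  proof -
    have "Hle (\<lambda>x. indicator (\<Union>\<U>) x * (f (r k) x - f (r l) x)) (real (card \<U>) * \<delta>)"
      using \<U> opn r(2) by (intro Hle_cover) auto
    then show ?thesis
    proof (rule Hle_cong)
      show "AE x in lborel. x \<in> \<Omega> \<longrightarrow> indicator (\<Union>\<U>) x * (f (r k) x - f (r l) x) = f (r k) x - f (r l) x"
        using \<U>(3) closure_subset[of \<Omega>] by (intro AE_I2) (auto split: split_indicator)
      show "real (card \<U>) * \<delta> \<le> \<epsilon>" using \<epsilon> by (simp add: \<delta>_def field_simps)
    qed
  qed
  then show ?thesis using r(1) by blast
qed

text \<open>Consecutive terms of a diagonal sequence differ by at most a geometric sequence in the
  block norm. The telescoping series then converges almost everywhere and its tails bound the
  distance to the limit.\<close>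

lemma sobolev_compact:
  assumes lip: "lipschitz_domain \<Omega>" and sob: "\<And>k::nat. sobolev (f k) B"
  obtains r h where "strict_mono (r :: nat \<Rightarrow> nat)" "Hle h (B + 2)"
    "\<And>N. Hle (\<lambda>x. f (r N) x - h x) (2 * (1 / 2) ^ N)"
proof -
  define P where "P n s \<longleftrightarrow> (\<forall>k l. Hle (\<lambda>x. f (s k) x - f (s l) x) ((1 / 2) ^ n))"
    for n and s :: "nat \<Rightarrow> nat"
  interpret subseqs P
  proof
    fix n and s :: "nat \<Rightarrow> nat"
    have "0 < (1 / 2 :: real) ^ n" by simp
    from sobolev_precompact[OF lip this, of "\<lambda>k. f (s k)" B] sob
    show "\<exists>r'. strict_mono r' \<and> P n (s \<circ> r')" by (simp add: P_def)
  qed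
  have diag: "P n (diagseq \<circ> ((+) (Suc n)))" for n
    by (rule diagseq_holds) (auto simp: P_def)
  \<comment> \<open>The shift by one matters: the diagonal sequence meets the tolerance
    \<open>(1 / 2) ^ n\<close> only from index \<open>Suc n\<close> on.\<close>
  define r where "r n = diagseq (Suc n)" for n
  have r: "strict_mono r" using subseq_diagseq by (auto simp: r_def strict_mono_def)
  define u where "u n x = f (r (Suc n)) x - f (r n) x" for n x
  have u: "Hle (u n) ((1 / 2) ^ n)" for n
  proof -
    have "Hle (\<lambda>x. f (diagseq (Suc n + 1)) x - f (diagseq (Suc n + 0)) x) ((1 / 2) ^ n)"
      using diag[of n] unfolding P_def o_def by blast
    then show ?thesis by (simp add: u_def[abs_def] r_def)
  qed
  \<comment> \<open>The limit exists almost everywhere on \<Omega>; elsewhere the default value of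
    \<open>lim\<close> is harmless.\<close>
  define h where "h x = lim (\<lambda>n. f (r n) x)" for x
  have geo: "(\<lambda>n. (1 / 2 :: real) ^ (n + N)) sums (2 * (1 / 2) ^ N)" for N
    using sums_mult2[OF geometric_sums[of "1 / 2 :: real"], of "(1 / 2) ^ N"] by (simp add: power_add)
  have AEs: "AE x in lborel. x \<in> \<Omega> \<longrightarrow> summable (\<lambda>n. u n x)"
    using Hle_AE_summable[OF u] by simp
  have lim: "AE x in lborel. x \<in> \<Omega> \<longrightarrow> (\<forall>N. (\<Sum>n. u (n + N) x) = h x - f (r N) x)"
    using AEs
  proof eventually_elim
    case (elim x)
    show ?case
    proof (intro impI allI)
      fix N assume "x \<in> \<Omega>"
      with elim have su: "summable (\<lambda>n. u n x)" by blast
      have "(\<Sum>n<M. u n x) = f (r M) x - f (r 0) x" for M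
        unfolding u_def by (induction M) auto
      then have "(\<lambda>M. f (r M) x - f (r 0) x) \<longlonglongrightarrow> (\<Sum>n. u n x)"
        using summable_LIMSEQ[OF su] by simp
      from tendsto_add[OF this tendsto_const[of "f (r 0) x"]]
      have "(\<lambda>M. f (r M) x) \<longlonglongrightarrow> (\<Sum>n. u n x) + f (r 0) x" by simp
      then have "convergent (\<lambda>M. f (r M) x)" unfolding convergent_def by blast
      then have hl: "(\<lambda>M. f (r M) x) \<longlonglongrightarrow> h x" unfolding h_def by (simp add: convergent_LIMSEQ_iff)
      have "(\<Sum>n<M. u (n + N) x) = f (r (M + N)) x - f (r N) x" for M
        unfolding u_def by (induction M) auto
      moreover have "(\<lambda>M. f (r (M + N)) x - f (r N) x) \<longlonglongrightarrow> h x - f (r N) x"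
        by (rule tendsto_diff[OF LIMSEQ_ignore_initial_segment[OF hl] tendsto_const])
      ultimately have "(\<lambda>n. u (n + N) x) sums (h x - f (r N) x)" by (simp add: sums_def)
      then show "(\<Sum>n. u (n + N) x) = h x - f (r N) x" by (rule sums_unique[symmetric])
    qed
  qed
  have tail: "Hle (\<lambda>x. f (r N) x - h x) (2 * (1 / 2) ^ N)" for N
  proof -
    have "Hle (\<lambda>x. \<Sum>n. u (n + N) x) (\<Sum>n. (1 / 2) ^ (n + N))"
      using geo[of N] by (intro Hle_suminf u) (auto simp: sums_iff)
    from Hle_scale[OF this, of "-1"] have "Hle (\<lambda>x. -1 * (\<Sum>n. u (n + N) x)) (2 * (1 / 2) ^ N)"
      using geo[of N] by (simp add: sums_iff)
    then show ?thesis
      by (rule Hle_cong) (use lim in \<open>auto elim!: eventually_mono\<close>)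
  qed
  \<comment> \<open>Comparing h with the initial term costs the full geometric sum, which is
    2.\<close>
  have "Hle (\<lambda>x. f (r 0) x - (f (r 0) x - h x)) (B + 2 * (1 / 2) ^ 0)"
    by (intro Hle_diff sobolev_imp_Hle sob tail)
  then have "Hle h (B + 2)" by simp
  then show thesis using that r tail by blast
qed

end

theorem mainTheorem14:
  fixes \<Omega> :: "'a::euclidean_space set" and q lam :: real
  assumes "bounded \<Omega>" and "lipschitz_domain \<Omega>"
    and "1 < q" and "0 \<le> lam" and "lam < real DIM('a)"
  shows "W1H_space \<Omega> q lam \<subseteq> H_space \<Omega> q lam \<and>
    (\<forall>f :: nat \<Rightarrow> 'a \<Rightarrow> real.
       (\<exists>B. \<forall>k. f k \<in> H_space \<Omega> q lam \<and> H_norm \<Omega> q lam (f k) \<le> B \<and>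
          (\<exists>g. weak_gradient \<Omega> (f k) g \<and>
               (\<forall>i\<in>Basis. (\<lambda>x. g x \<bullet> i) \<in> H_space \<Omega> q lam \<and>
                          H_norm \<Omega> q lam (\<lambda>x. g x \<bullet> i) \<le> B)))
       \<longrightarrow> (\<exists>r h. strict_mono r \<and> h \<in> H_space \<Omega> q lam \<and>
              (\<lambda>k. H_norm \<Omega> q lam (\<lambda>x. f (r k) x - h x)) \<longlonglongrightarrow> 0))"
proof (intro conjI allI impI)
  show "W1H_space \<Omega> q lam \<subseteq> H_space \<Omega> q lam" by (auto simp: W1H_space_def)
  fix f :: "nat \<Rightarrow> 'a \<Rightarrow> real"
  assume "\<exists>B. \<forall>k. f k \<in> H_space \<Omega> q lam \<and> H_norm \<Omega> q lam (f k) \<le> B \<and>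
          (\<exists>g. weak_gradient \<Omega> (f k) g \<and>
               (\<forall>i\<in>Basis. (\<lambda>x. g x \<bullet> i) \<in> H_space \<Omega> q lam \<and>
                          H_norm \<Omega> q lam (\<lambda>x. g x \<bullet> i) \<le> B))"
  then obtain B where fB: "\<And>k. f k \<in> H_space \<Omega> q lam" "\<And>k. H_norm \<Omega> q lam (f k) \<le> B"
    and gB: "\<And>k. \<exists>g. weak_gradient \<Omega> (f k) g \<and>
               (\<forall>i\<in>Basis. (\<lambda>x. g x \<bullet> i) \<in> H_space \<Omega> q lam \<and>
                          H_norm \<Omega> q lam (\<lambda>x. g x \<bullet> i) \<le> B)" by blast
  \<comment> \<open>Every representation contains a block, and a block has its centre in
    \<Omega>.\<close>
  have ne: "\<Omega> \<noteq> {}"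
    using fB(1)[of 0] by (auto simp: H_space_def block_rep_def is_block_def)
  define \<alpha> where "\<alpha> = lam / conj_exp q"
  interpret block_domain \<Omega> q \<alpha>
  proof
    show "open \<Omega>" using assms(2) by (simp add: lipschitz_domain_def)
    show "0 \<le> \<alpha>" using assms by (simp add: \<alpha>_def conj_exp_def)
    have "\<alpha> * q = lam * (q - 1)" using assms by (simp add: \<alpha>_def conj_exp_def)
    also have "\<dots> \<le> real DIM('a) * (q - 1)" using assms by (intro mult_right_mono) auto
    finally show "\<alpha> * q \<le> real DIM('a) * (q - 1)" .
  qed (use assms in auto)
  have sob: "sobolev (f k) (B + 1)" for k
  proof -
    obtain g where g: "weak_gradient \<Omega> (f k) g"
      "\<And>i. i \<in> Basis \<Longrightarrow> (\<lambda>x. g x \<bullet> i) \<in> H_space \<Omega> q lam"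
      "\<And>i. i \<in> Basis \<Longrightarrow> H_norm \<Omega> q lam (\<lambda>x. g x \<bullet> i) \<le> B" using gB[of k] by blast
    show ?thesis
      by (rule sobolevI[OF H_imp_Hle[OF fB \<alpha>_def] g(1) H_imp_Hle[OF g(2,3) \<alpha>_def]])
  qed
  obtain r h where r: "strict_mono (r :: nat \<Rightarrow> nat)" and h: "Hle h (B + 1 + 2)"
    and tail: "\<And>N. Hle (\<lambda>x. f (r N) x - h x) (2 * (1 / 2) ^ N)"
    by (rule sobolev_compact[of f "B + 1", OF assms(2) sob], blast)
  have "(\<lambda>N. 2 powr \<alpha> * (2 * (1 / 2) ^ N)) \<longlonglongrightarrow> 2 powr \<alpha> * (2 * 0)"
    by (intro tendsto_mult tendsto_const LIMSEQ_power_zero) simp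
  then have lim: "(\<lambda>N. 2 powr \<alpha> * (2 * (1 / 2) ^ N)) \<longlonglongrightarrow> 0" by simp
  have "(\<lambda>k. H_norm \<Omega> q lam (\<lambda>x. f (r k) x - h x)) \<longlonglongrightarrow> 0"
    by (rule tendsto_sandwich[OF _ _ tendsto_const lim])
       (use Hle_imp_H[OF tail ne \<alpha>_def] in auto)
  then show "\<exists>r h. strict_mono r \<and> h \<in> H_space \<Omega> q lam \<and>
              (\<lambda>k. H_norm \<Omega> q lam (\<lambda>x. f (r k) x - h x)) \<longlonglongrightarrow> 0"
    using r Hle_imp_H_space[OF h ne \<alpha>_def] by blast
qed

end
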